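(* Let $\sigma\colon\mathbb{R}\to\mathbb{R}$ be a bounded measurable function, and let $u$ be a local minimizer (not necessarily of one sign) in $B_1\subset\mathbb{R}^n$ of the functional $$\mathcal{J}(v,B_1)=\int_{B_1}\tfrac12|Dv|^2+\sigma(v)\,dx .$$ Then there exists a universal constant $C>0$ such that $$|u(x)-u(y)|\le C\|u\|_{L^2(B_1)}\,|x-y|\,\ln\left(|x-y|^{-1}\right),\quad x,y\in B_{1/2}.$$
   Context: $B_r$ is the ball in $\mathbb{R}^n$ of radius $r$ centered at the origin. For an open set $\Omega'\subset B_1$ write $\mathcal{J}(v,\Omega')=\int_{\Omega'}\frac12|Dv|^2+\sigma(v)\,dx$. A function $u\in H^1(B_1)$ is a local minimizer of $\mathcal{J}$ in $B_1$ if, for every open $\Omega'\subset B_1$, $\mathcal{J}(u,\Omega')\le\mathcal{J}(v,\Omega')$ for all $v\in H^1(\Omega')$ with $v-u\in H^1_0(\Omega')$. The minimization setting also fixes a nonnegative boundary datum $\varphi\in H^1\cap L^\infty$ of the minimization problem. A constant is called universal if it depends only on the data: the dimension $n$, the $L^\infty$-norm of $\sigma$, and the boundary datum $\varphi$.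
   Formalization: The estimate is claimed for |x-y| ≤ d with any d<1, C depending also on d (it fails as |x-y|→1, e.g. u=x_1), and for u with boundary datum φ not in H^1_0(B_1) (with zero trace no universal C exists); u is taken up to a null set. *)

theory Defs
  imports "HOL-Analysis.Analysis"
begin

primrec Ck :: "nat \<Rightarrow> ('a::euclidean_space \<Rightarrow> real) \<Rightarrow> bool" where
  "Ck 0 f \<longleftrightarrow> continuous_on UNIV f"
| "Ck (Suc k) f \<longleftrightarrow> (\<forall>x. f differentiable (at x)) \<and>
     (\<forall>b\<in>Basis. Ck k (\<lambda>x. frechet_derivative f (at x) b))"

text \<open>Test functions on \<open>\<Omega>\<close> are represented by their extension by zero to the whole space.\<close>

definition test_function :: "'a::euclidean_space set \<Rightarrow> ('a \<Rightarrow> real) \<Rightarrow> bool" where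
  "test_function \<Omega> \<psi> \<longleftrightarrow> (\<forall>k. Ck k \<psi>) \<and>
     compact (closure {x. \<psi> x \<noteq> 0}) \<and> closure {x. \<psi> x \<noteq> 0} \<subseteq> \<Omega>"

text \<open>Functions on \<open>\<Omega>\<close> are total functions of which only the values on \<open>\<Omega>\<close> matter.\<close>

definition L2_on :: "'a::euclidean_space set \<Rightarrow> ('a \<Rightarrow> 'b::euclidean_space) \<Rightarrow> bool" where
  "L2_on \<Omega> f \<longleftrightarrow> f \<in> borel_measurable (lebesgue_on \<Omega>) \<and>
     integrable (lebesgue_on \<Omega>) (\<lambda>x. (norm (f x))\<^sup>2)"

definition L2_norm_on :: "'a::euclidean_space set \<Rightarrow> ('a \<Rightarrow> 'b::euclidean_space) \<Rightarrow> real" where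
  "L2_norm_on \<Omega> f = sqrt (LINT x|lebesgue_on \<Omega>. (norm (f x))\<^sup>2)"

definition weak_gradient_on ::
    "'a::euclidean_space set \<Rightarrow> ('a \<Rightarrow> real) \<Rightarrow> ('a \<Rightarrow> 'a) \<Rightarrow> bool" where
  "weak_gradient_on \<Omega> u g \<longleftrightarrow> (\<forall>\<psi>. test_function \<Omega> \<psi> \<longrightarrow> (\<forall>b\<in>Basis.
     (LINT x|lebesgue_on \<Omega>. u x * frechet_derivative \<psi> (at x) b) =
     - (LINT x|lebesgue_on \<Omega>. (g x \<bullet> b) * \<psi> x)))"

definition H1 :: "'a::euclidean_space set \<Rightarrow> ('a \<Rightarrow> real) \<Rightarrow> bool" where
  "H1 \<Omega> u \<longleftrightarrow> L2_on \<Omega> u \<and> (\<exists>g. L2_on \<Omega> g \<and> weak_gradient_on \<Omega> u g)"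

text \<open>The weak gradient is unique only up to null sets; \<open>wgrad\<close> picks a representative,
  and it is meaningful only for \<open>u\<close> in \<open>H1 \<Omega>\<close> with \<open>\<Omega>\<close> open.\<close>

definition wgrad :: "'a::euclidean_space set \<Rightarrow> ('a \<Rightarrow> real) \<Rightarrow> 'a \<Rightarrow> 'a" where
  "wgrad \<Omega> u = (SOME g. L2_on \<Omega> g \<and> weak_gradient_on \<Omega> u g)"

definition H1_norm :: "'a::euclidean_space set \<Rightarrow> ('a \<Rightarrow> real) \<Rightarrow> real" where
  "H1_norm \<Omega> u = sqrt ((L2_norm_on \<Omega> u)\<^sup>2 + (L2_norm_on \<Omega> (wgrad \<Omega> u))\<^sup>2)"

definition H10 :: "'a::euclidean_space set \<Rightarrow> ('a \<Rightarrow> real) \<Rightarrow> bool" where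
  "H10 \<Omega> u \<longleftrightarrow> H1 \<Omega> u \<and>
     (\<forall>\<epsilon>>0. \<exists>\<psi>. test_function \<Omega> \<psi> \<and> H1_norm \<Omega> (\<lambda>x. u x - \<psi> x) < \<epsilon>)"

definition J :: "(real \<Rightarrow> real) \<Rightarrow> ('a::euclidean_space \<Rightarrow> real) \<Rightarrow> 'a set \<Rightarrow> real" where
  "J \<sigma> v \<Omega> = (LINT x|lebesgue_on \<Omega>. 1/2 * (norm (wgrad \<Omega> v x))\<^sup>2 + \<sigma> (v x))"

definition local_minimizer :: "(real \<Rightarrow> real) \<Rightarrow> ('a::euclidean_space \<Rightarrow> real) \<Rightarrow> bool" where
  "local_minimizer \<sigma> u \<longleftrightarrow> H1 (ball 0 1) u \<and>
     (\<forall>\<Omega>. open \<Omega> \<and> \<Omega> \<subseteq> ball 0 1 \<longrightarrow>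
       (\<forall>v. H1 \<Omega> v \<and> H10 \<Omega> (\<lambda>x. v x - u x) \<longrightarrow> J \<sigma> u \<Omega> \<le> J \<sigma> v \<Omega>))"

end

theory Submission
  imports Defs "HOL-Computational_Algebra.Polynomial"
begin

text \<open>Comparing \<open>u\<close> with \<open>u \<plusminus> s \<psi>\<close> and using only the bound on \<open>\<sigma>\<close>, the pairing of the gradients
  of \<open>u\<close> and of a test function \<open>\<psi>\<close> is at most a constant times the supremum of \<open>|D\<psi>|\<close> times the volume
  of the support of \<open>\<psi>\<close>. Let \<open>u\<^sub>t\<close> be the convolution of \<open>u\<close> with a radial mollifier at scale \<open>t\<close>. The
  \<open>t\<close>-derivative of the mollifier is minus the Laplacian of an explicit compactly supported potential, so
  the derivative of \<open>u\<^sub>t(x)\<close> in \<open>t\<close> is such a pairing, hence bounded, and the derivative of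
  \<open>u\<^sub>t(x) - u\<^sub>t(y)\<close> is \<open>O(|x - y| / t)\<close>. Integrating the first bound over \<open>t < |x - y|\<close> and the second
  over larger \<open>t\<close> gives the logarithmic modulus of continuity, with no regularity theory for harmonic functions.

  The constant is linear in the \<open>L2\<close> norm of \<open>u\<close> because this norm is bounded below: comparison with \<open>\<phi>\<close>
  bounds the gradient of \<open>u\<close>, and \<open>\<phi>\<close> has positive \<open>H1\<close> distance to the test functions.\<close>

section \<open>Test functions\<close>

text \<open>Since \<open>\<sigma>\<close> is only measurable, the energy has no first variation, and
  a finite displacement must replace it: moving \<open>u\<close> by \<open>\<psi> / Q\<close>, with
  \<open>Q\<close> a bound for the gradient of \<open>\<psi>\<close>, costs beyond the linear term
  at most half the volume of the support in Dirichlet energy and at most \<open>2 * M\<close> times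
  that volume in \<open>\<sigma>\<close>. For the potential at scale t in dimension n the gradient
  has size t^(-n) on a ball of volume of order t^n, and the two powers cancel; the difference of two
  potentials gains a factor |x - y| / t from its Lipschitz gradient. The direct outcome is
  inhomogeneous, with \<open>1 + L2_norm_on (ball 0 1) u\<close> in place of the norm, because the
  bound on \<open>\<sigma>\<close> does not scale with \<open>u\<close>. Removing the 1 is what
  makes the constant depend on \<open>\<phi>\<close>. As \<open>u\<close> is determined only up to
  null sets, the modulus is proved for the pointwise limit of the smoothed functions, which is then
  identified with a multiple of \<open>u\<close> by integration against test functions.\<close>

lemma Ck_SucI:
  assumes "\<And>x. (f has_derivative f' x) (at x)" "\<And>b. b \<in> Basis \<Longrightarrow> Ck k (\<lambda>x. f' x b)"
  shows "Ck (Suc k) f"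
proof -
  have "frechet_derivative f (at x) = f' x" for x
    using frechet_derivative_at[OF assms(1)] by simp
  with assms show ?thesis
    by (auto simp: differentiable_def)
qed

lemma Ck_Suc_imp: "Ck (Suc k) f \<Longrightarrow> Ck k f"
proof (induction k arbitrary: f)
  case 0
  then show ?case
    by (auto simp: continuous_on_eq_continuous_at differentiable_imp_continuous_within)
next
  case (Suc k)
  then show ?case by simp
qed

lemma Ck_Suc_has_derivative:
  "Ck (Suc k) f \<Longrightarrow> (f has_derivative frechet_derivative f (at x)) (at x)"
  by (simp add: frechet_derivative_works[symmetric])

lemma Ck_Suc_partial:
  "Ck (Suc k) f \<Longrightarrow> b \<in> Basis \<Longrightarrow> Ck k (\<lambda>x. frechet_derivative f (at x) b)"
  by simp

declare Ck.simps(2) [simp del]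

section \<open>Closure of the classes \<open>Ck k\<close> under algebra and composition\<close>

lemma Ck_const: "Ck k (\<lambda>x. c)"
proof (induction k arbitrary: c)
  case (Suc k)
  show ?case by (rule Ck_SucI[where f'="\<lambda>_ _. 0"]) (auto simp: Suc)
qed simp

lemma Ck_inner: "Ck k (\<lambda>x. x \<bullet> a)"
  by (cases k) (auto intro!: continuous_intros Ck_SucI[where f'="\<lambda>_ h. h \<bullet> a"] derivative_eq_intros
      simp: Ck_const)

lemma Ck_add: "Ck k f \<Longrightarrow> Ck k g \<Longrightarrow> Ck k (\<lambda>x. f x + g x)"
proof (induction k arbitrary: f g)
  case 0
  then show ?case by (auto intro: continuous_intros)
next
  case (Suc k)
  note d = Suc.prems[THEN Ck_Suc_has_derivative]
  show ?case
    by (rule Ck_SucI[OF has_derivative_add[OF d]]) (auto intro: Suc Ck_Suc_partial[OF Suc.prems(1)] Ck_Suc_partial[OF Suc.prems(2)])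
qed

lemma Ck_mult: "Ck k f \<Longrightarrow> Ck k g \<Longrightarrow> Ck k (\<lambda>x. f x * g x)"
proof (induction k arbitrary: f g)
  case 0
  then show ?case by (auto intro: continuous_intros)
next
  case (Suc k)
  note d = Suc.prems[THEN Ck_Suc_has_derivative]
  have "Ck k f" "Ck k g" using Suc.prems by (auto intro: Ck_Suc_imp)
  then show ?case
    by (intro Ck_SucI[OF has_derivative_mult[OF d]] Ck_add Suc.IH)
      (auto intro: Ck_Suc_partial[OF Suc.prems(1)] Ck_Suc_partial[OF Suc.prems(2)])
qed

lemma Ck_diff: "Ck k f \<Longrightarrow> Ck k g \<Longrightarrow> Ck k (\<lambda>x. f x - g x)"
  using Ck_add[OF _ Ck_mult[OF Ck_const[of _ "-1"]], of k f g] by simp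

lemma Ck_sum: "(\<And>i. i \<in> I \<Longrightarrow> Ck k (f i)) \<Longrightarrow> Ck k (\<lambda>x. \<Sum>i\<in>I. f i x)"
  by (induction I rule: infinite_finite_induct) (auto intro: Ck_add Ck_const)

text \<open>\<open>F\<close> lists the successive derivatives of one real function. The induction
  needs all \<open>j\<close> at once, because the chain rule turns \<open>F j\<close> into
  \<open>F (Suc j)\<close>.\<close>

lemma Ck_compose:
  assumes F: "\<And>j s. (F j has_real_derivative F (Suc j) s) (at s)" and p: "\<And>k. Ck k p"
  shows "Ck k (\<lambda>x. F j (p x))"
proof (induction k arbitrary: j)
  case 0
  have "continuous_on UNIV (F j)"
    using F by (meson DERIV_isCont continuous_at_imp_continuous_on)
  moreover have "continuous_on UNIV p" using p[of 0] by simp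
  ultimately show ?case
    by (auto intro: continuous_on_compose2)
next
  case (Suc k)
  note d = Ck_Suc_has_derivative[OF p[of "Suc k"]]
  have "((\<lambda>x. F j (p x)) has_derivative (\<lambda>h. frechet_derivative p (at x) h * F (Suc j) (p x))) (at x)" for x
    by (rule DERIV_compose_FDERIV[OF F d])
  then show ?case
    by (rule Ck_SucI) (intro Ck_mult Suc Ck_Suc_partial[OF p])
qed

text \<open>The squared distance is a polynomial in the coordinates, whereas the distance itself is
  not smooth at \<open>a\<close>. For this reason every bump below is a function of the squared
  norm.\<close>

lemma Ck_square_dist: "Ck k (\<lambda>x. (norm (x - a))\<^sup>2)"
proof -
  have "(norm (x - a))\<^sup>2 = (\<Sum>b\<in>Basis. (x \<bullet> b - a \<bullet> b) * (x \<bullet> b - a \<bullet> b))" for x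
    unfolding power2_norm_eq_inner by (subst euclidean_inner) (simp add: inner_diff_left)
  then show ?thesis
    by (auto intro!: Ck_sum Ck_mult Ck_diff Ck_inner Ck_const)
qed

text \<open>The derivatives of \<open>exp (- 1 / s)\<close> on the positive half line are polynomials in \<open>1 / s\<close>
  times \<open>exp (- 1 / s)\<close>.\<close>

primrec bump_poly :: "nat \<Rightarrow> real poly" where
  "bump_poly 0 = 1"
| "bump_poly (Suc k) = [:0, 0, 1:] * (bump_poly k - pderiv (bump_poly k))"

definition bump :: "nat \<Rightarrow> real \<Rightarrow> real" where
  "bump k s = (if 0 < s then poly (bump_poly k) (1 / s) * exp (- (1 / s)) else 0)"

lemma tendsto_poly_mult_exp_minus: "((\<lambda>y. poly p y * exp (- y)) \<longlongrightarrow> (0::real)) at_top"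
proof -
  have "((\<lambda>y. \<Sum>i\<le>degree p. coeff p i * (y ^ i / exp y)) \<longlongrightarrow> (\<Sum>i\<le>degree p. coeff p i * 0)) at_top"
    by (intro tendsto_intros tendsto_power_div_exp_0)
  then show ?thesis
    by (simp add: poly_altdef sum_distrib_right exp_minus divide_inverse mult.assoc)
qed

text \<open>With y = 1/s the derivative of p(y) exp(-y) in s is y^2 (p - p')(y) exp(-y), which is
  the recursion of \<open>bump_poly\<close>. At 0 the exponential beats every polynomial in
  y.\<close>

lemma bump_DERIV: "(bump k has_real_derivative bump (Suc k) s) (at s)"
proof -
  consider "s > 0" | "s < 0" | "s = 0" by linarith
  then show ?thesis
  proof cases
    case 1
    have "((\<lambda>s. poly (bump_poly k) (1 / s) * exp (- (1 / s))) has_real_derivative bump (Suc k) s) (at s)"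
    proof (rule DERIV_cong)
      have i: "((\<lambda>s. 1 / s) has_real_derivative - (1 / s * (1 / s))) (at s)"
        using 1 by (auto intro!: derivative_eq_intros)
      show "((\<lambda>s. poly (bump_poly k) (1 / s) * exp (- (1 / s))) has_real_derivative
          poly (pderiv (bump_poly k)) (1 / s) * - (1 / s * (1 / s)) * exp (- (1 / s)) +
          exp (- (1 / s)) * - (- (1 / s * (1 / s))) * poly (bump_poly k) (1 / s)) (at s)"
        by (intro DERIV_mult DERIV_chain2[OF poly_DERIV i] DERIV_chain2[OF DERIV_exp] DERIV_minus i)
      show "poly (pderiv (bump_poly k)) (1 / s) * - (1 / s * (1 / s)) * exp (- (1 / s)) +
          exp (- (1 / s)) * - (- (1 / s * (1 / s))) * poly (bump_poly k) (1 / s) = bump (Suc k) s"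
        using 1 by (simp add: bump_def algebra_simps)
    qed
    moreover have "\<forall>\<^sub>F t in nhds s. bump k t = poly (bump_poly k) (1 / t) * exp (- (1 / t))"
      using eventually_nhds_in_open[of "{0<..}" s] 1 by (auto simp: bump_def elim!: eventually_mono)
    ultimately show ?thesis
      by (subst DERIV_cong_ev[OF refl _ refl])
  next
    case 2
    have "\<forall>\<^sub>F t in nhds s. bump k t = 0"
      using eventually_nhds_in_open[of "{..<0}" s] 2 by (auto simp: bump_def elim!: eventually_mono)
    moreover have "((\<lambda>_. 0) has_real_derivative bump (Suc k) s) (at s)"
      using 2 by (simp add: bump_def)
    ultimately show ?thesis
      by (subst DERIV_cong_ev[OF refl _ refl])
  next
    case 3
    have inv: "filterlim (\<lambda>h::real. 1 / h) at_top (at_right 0)"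
      using filterlim_inverse_at_top_right by (simp add: divide_inverse)
    \<comment> \<open>The factor \<open>[:0, 1:]\<close>, evaluated at \<open>1 / h\<close>, is the
      division by \<open>h\<close> in the difference quotient at 0.\<close>
    have "((\<lambda>h. poly ([:0, 1:] * bump_poly k) (1 / h) * exp (- (1 / h))) \<longlongrightarrow> 0) (at_right 0)"
      using filterlim_compose[OF tendsto_poly_mult_exp_minus inv] .
    then have "((\<lambda>h. bump k h / h) \<longlongrightarrow> 0) (at_right 0)"
      by (rule filterlim_cong[THEN iffD1, rotated -1]) (auto simp: eventually_at_filter bump_def)
    moreover have "((\<lambda>h. bump k h / h) \<longlongrightarrow> 0) (at_left 0)"
      by (rule tendsto_eventually) (auto simp: eventually_at_filter bump_def)
    ultimately have "((\<lambda>h. bump k h / h) \<longlongrightarrow> 0) (at 0)"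
      by (simp add: filterlim_at_split)
    then show ?thesis
      using 3 by (simp add: has_field_derivative_iff bump_def)
  qed
qed

lemma bump_nonpos: "s \<le> 0 \<Longrightarrow> bump k s = 0"
  by (simp add: bump_def)

lemma bump_pos: "0 < s \<Longrightarrow> 0 < bump 0 s" "0 < s \<Longrightarrow> 0 < bump 1 s"
  by (auto simp: bump_def)

lemma bump_Ck: "(\<And>k. Ck k p) \<Longrightarrow> Ck k (\<lambda>x. bump j (p x))"
  by (rule Ck_compose[where F=bump]) (rule bump_DERIV)

section \<open>Gradients, supports and bounds of test functions\<close>

definition grad :: "('a::euclidean_space \<Rightarrow> real) \<Rightarrow> 'a \<Rightarrow> 'a" where
  "grad \<psi> x = (\<Sum>b\<in>Basis. frechet_derivative \<psi> (at x) b *\<^sub>R b)"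

lemma grad_inner: "b \<in> Basis \<Longrightarrow> grad \<psi> x \<bullet> b = frechet_derivative \<psi> (at x) b"
  by (simp add: grad_def)

lemma frechet_derivative_eq_grad:
  assumes "\<psi> differentiable (at x)"
  shows "frechet_derivative \<psi> (at x) h = grad \<psi> x \<bullet> h"
proof -
  have "linear (frechet_derivative \<psi> (at x))"
    using assms by (simp add: linear_frechet_derivative)
  then have "frechet_derivative \<psi> (at x) (\<Sum>b\<in>Basis. (h \<bullet> b) *\<^sub>R b) = (\<Sum>b\<in>Basis. (h \<bullet> b) *\<^sub>R frechet_derivative \<psi> (at x) b)"
    by (simp add: linear_sum linear_scale)
  then show ?thesis
    by (simp add: euclidean_representation grad_def inner_sum_right inner_commute[of _ h] mult.commute)
qed

lemma grad_unique: "(\<psi> has_derivative (\<lambda>h. v \<bullet> h)) (at x) \<Longrightarrow> grad \<psi> x = v"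
  proof -
  assume "(\<psi> has_derivative (\<lambda>h. v \<bullet> h)) (at x)"
  then have "frechet_derivative \<psi> (at x) = (\<lambda>h. v \<bullet> h)"
    using frechet_derivative_at by metis
  then show "grad \<psi> x = v"
    by (simp add: grad_def euclidean_representation)
qed

lemma test_functionI:
  assumes "\<And>k. Ck k \<psi>" "compact K" "K \<subseteq> \<Omega>" "\<And>x. x \<notin> K \<Longrightarrow> \<psi> x = 0"
  shows "test_function \<Omega> \<psi>"
proof -
  have "closure {x. \<psi> x \<noteq> 0} \<subseteq> K"
    using assms by (intro closure_minimal) (auto intro: compact_imp_closed)
  then show ?thesis
    using assms compact_Int_closed[of K "closure {x. \<psi> x \<noteq> 0}"]
    by (auto simp: test_function_def Int_absorb1)
qed

text \<open>The complement of the closed support is open and \<open>\<psi>\<close> is 0 on it, so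
  the gradient vanishes there too and one compact set serves both.\<close>

lemma test_function_support:
  assumes "test_function \<Omega> \<psi>"
  obtains K where "compact K" "K \<subseteq> \<Omega>" "\<And>x. x \<notin> K \<Longrightarrow> \<psi> x = 0" "\<And>x. x \<notin> K \<Longrightarrow> grad \<psi> x = 0"
proof -
  define K where "K = closure {x. \<psi> x \<noteq> 0}"
  have 1: "\<psi> x = 0" if "x \<notin> K" for x
    using that closure_subset[of "{x. \<psi> x \<noteq> 0}"] by (auto simp: K_def)
  have 2: "grad \<psi> x = 0" if "x \<notin> K" for x
  proof (rule grad_unique)
    have "open (- K)" by (auto simp: K_def)
    then have "(\<psi> has_derivative (\<lambda>h. 0)) (at x)"
      by (rule has_derivative_transform_within_open[OF has_derivative_const[of 0]]) (use that 1 in auto)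
    then show "(\<psi> has_derivative (\<lambda>h. 0 \<bullet> h)) (at x)" by simp
  qed
  have "compact K" "K \<subseteq> \<Omega>"
    using assms by (simp_all add: test_function_def K_def)
  then show thesis
    using 1 2 by (rule that)
qed

lemma test_function_Ck: "test_function \<Omega> \<psi> \<Longrightarrow> Ck k \<psi>"
  by (simp add: test_function_def)

lemma test_function_has_derivative:
  assumes "test_function \<Omega> \<psi>"
  shows "(\<psi> has_derivative (\<lambda>h. grad \<psi> x \<bullet> h)) (at x)"
proof -
  have "Ck (Suc 0) \<psi>" using assms by (rule test_function_Ck)
  then have "\<psi> differentiable (at x)" "(\<psi> has_derivative frechet_derivative \<psi> (at x)) (at x)"
    using Ck_Suc_has_derivative[of 0 \<psi>] by (simp_all add: Ck.simps(2))
  then show ?thesis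
    by (simp add: frechet_derivative_eq_grad[symmetric])
qed

lemma test_function_continuous: "test_function \<Omega> \<psi> \<Longrightarrow> continuous_on A \<psi>"
  using test_function_Ck[of \<Omega> \<psi> 0] by (auto intro: continuous_on_subset)

lemma test_function_grad_inner:
  assumes "test_function \<Omega> \<psi>" "b \<in> Basis"
  shows "test_function \<Omega> (\<lambda>x. grad \<psi> x \<bullet> b)"
proof -
  obtain K where K: "compact K" "K \<subseteq> \<Omega>" "\<And>x. x \<notin> K \<Longrightarrow> grad \<psi> x = 0"
    using test_function_support[OF assms(1)] by metis
  have "Ck k (\<lambda>x. grad \<psi> x \<bullet> b)" for k
    using Ck_Suc_partial[OF test_function_Ck[OF assms(1)] assms(2)] assms(2) by (simp add: grad_inner)
  with K show ?thesis
    by (intro test_functionI[of _ K]) auto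
qed

lemma test_function_continuous_grad:
  assumes "test_function \<Omega> \<psi>" shows "continuous_on A (grad \<psi>)"
  using test_function_continuous[OF test_function_grad_inner[OF assms]]
  by (subst continuous_on_componentwise) auto

lemma test_function_mono: "test_function \<Omega> \<psi> \<Longrightarrow> \<Omega> \<subseteq> \<Omega>' \<Longrightarrow> test_function \<Omega>' \<psi>"
  by (auto simp: test_function_def)

lemma test_function_add:
  assumes "test_function \<Omega> f" "test_function \<Omega> g"
  shows "test_function \<Omega> (\<lambda>x. f x + g x)"
proof -
  obtain K where K: "compact K" "K \<subseteq> \<Omega>" "\<And>x. x \<notin> K \<Longrightarrow> f x = 0"
    using test_function_support[OF assms(1)] by metis
  obtain L where L: "compact L" "L \<subseteq> \<Omega>" "\<And>x. x \<notin> L \<Longrightarrow> g x = 0"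
    using test_function_support[OF assms(2)] by metis
  show ?thesis
    using K L assms by (intro test_functionI[of _ "K \<union> L"]) (auto intro: Ck_add test_function_Ck)
qed

lemma test_function_mult:
  assumes "test_function \<Omega> f" "\<And>k. Ck k g"
  shows "test_function \<Omega> (\<lambda>x. g x * f x)"
proof -
  obtain K where K: "compact K" "K \<subseteq> \<Omega>" "\<And>x. x \<notin> K \<Longrightarrow> f x = 0"
    using test_function_support[OF assms(1)] by metis
  show ?thesis
    using K assms by (intro test_functionI[of _ K]) (auto intro: Ck_mult test_function_Ck)
qed

lemma test_function_cmult: "test_function \<Omega> f \<Longrightarrow> test_function \<Omega> (\<lambda>x. c * f x)"
  by (rule test_function_mult[OF _ Ck_const])

lemma test_function_diff:
  "test_function \<Omega> f \<Longrightarrow> test_function \<Omega> g \<Longrightarrow> test_function \<Omega> (\<lambda>x. f x - g x)"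
  using test_function_add[of \<Omega> f, OF _ test_function_cmult[of \<Omega> g "-1"]] by simp

lemma test_function_zero: "test_function \<Omega> (\<lambda>x. 0)"
  by (rule test_functionI[of _ "{}"]) (auto simp: Ck_const)

lemma test_function_bounded:
  assumes "test_function \<Omega> \<psi>"
  obtains B where "0 < B" "\<And>x. \<bar>\<psi> x\<bar> \<le> B" "\<And>x. norm (grad \<psi> x) \<le> B"
proof -
  obtain K where K: "compact K" "K \<subseteq> \<Omega>" "\<And>x. x \<notin> K \<Longrightarrow> \<psi> x = 0" "\<And>x. x \<notin> K \<Longrightarrow> grad \<psi> x = 0"
    using test_function_support[OF assms] by metis
  have "bounded (\<psi> ` K)" "bounded (grad \<psi> ` K)"
    using K assms by (auto intro!: compact_imp_bounded compact_continuous_image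
        test_function_continuous test_function_continuous_grad)
  then obtain B1 B2 where B: "B1 > 0" "B2 > 0" "\<And>x. x \<in> K \<Longrightarrow> \<bar>\<psi> x\<bar> \<le> B1" "\<And>x. x \<in> K \<Longrightarrow> norm (grad \<psi> x) \<le> B2"
    unfolding bounded_pos by auto
  have "\<bar>\<psi> x\<bar> \<le> B1 + B2" "norm (grad \<psi> x) \<le> B1 + B2" for x
    using B K(3,4)[of x] by (cases "x \<in> K"; force)+
  then show thesis
    using B by (intro that[of "B1 + B2"]) auto
qed

lemma test_function_lipschitz:
  assumes "test_function \<Omega> \<psi>"
  obtains L where "0 < L" "\<And>x y. \<bar>\<psi> x - \<psi> y\<bar> \<le> L * norm (x - y)"
proof -
  obtain B where B: "0 < B" "\<And>x. norm (grad \<psi> x) \<le> B"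
    using test_function_bounded[OF assms] by metis
  have "norm (\<psi> x - \<psi> y) \<le> B * norm (x - y)" for x y
  proof (rule differentiable_bound[of UNIV])
    show "onorm (\<lambda>h. grad \<psi> x \<bullet> h) \<le> B" for x
    proof (rule onorm_le)
      fix h
      have "norm (grad \<psi> x \<bullet> h) \<le> norm (grad \<psi> x) * norm h"
        using Cauchy_Schwarz_ineq2 by simp
      also have "\<dots> \<le> B * norm h" using B by (intro mult_right_mono) auto
      finally show "norm (grad \<psi> x \<bullet> h) \<le> B * norm h" .
    qed
  qed (auto intro: has_derivative_at_withinI test_function_has_derivative[OF assms])
  with B show thesis using that by auto
qed

lemma test_function_grad_lipschitz:
  assumes "test_function \<Omega> (\<psi> :: 'a::euclidean_space \<Rightarrow> real)"
  obtains L where "0 < L" "\<And>x y. norm (grad \<psi> x - grad \<psi> y) \<le> L * norm (x - y)"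
proof -
  have "\<exists>L>0. \<forall>x y. \<bar>grad \<psi> x \<bullet> b - grad \<psi> y \<bullet> b\<bar> \<le> L * norm (x - y)" if "b \<in> Basis" for b
    using test_function_lipschitz[OF test_function_grad_inner[OF assms that]] by metis
  then obtain L where L: "\<And>b x y. b \<in> Basis \<Longrightarrow> \<bar>grad \<psi> x \<bullet> b - grad \<psi> y \<bullet> b\<bar> \<le> L b * norm (x - y)"
      "\<And>b. b \<in> Basis \<Longrightarrow> 0 < L b"
    by metis
  have "norm (grad \<psi> x - grad \<psi> y) \<le> (\<Sum>b\<in>Basis. L b) * norm (x - y)" for x y
  proof -
    have "norm (grad \<psi> x - grad \<psi> y) \<le> (\<Sum>b\<in>Basis. \<bar>(grad \<psi> x - grad \<psi> y) \<bullet> b\<bar>)"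
      by (rule norm_le_l1)
    also have "\<dots> \<le> (\<Sum>b\<in>Basis. L b * norm (x - y))"
      by (intro sum_mono) (simp add: L inner_diff_left)
    finally show ?thesis by (simp add: sum_distrib_right)
  qed
  moreover have "0 < (\<Sum>b\<in>(Basis::'a set). L b)"
    using L(2) by (intro sum_pos) auto
  ultimately show thesis using that by blast
qed

lemma grad_linear:
  assumes "test_function \<Omega> f" "test_function \<Omega> g"
  shows "grad (\<lambda>x. f x + c * g x) x = grad f x + c *\<^sub>R grad g x"
  by (rule grad_unique)
    (auto intro!: derivative_eq_intros test_function_has_derivative[OF assms(1)]
      test_function_has_derivative[OF assms(2)] simp: inner_add_left)

text \<open>With \<open>S\<close> a finite sum of bumps that is positive exactly near \<open>K\<close>, the functions
  \<open>1 - exp (- k S)\<close> increase to the indicator of \<open>{S > 0}\<close>.\<close>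

lemma smooth_Urysohn:
  fixes K :: "'a::euclidean_space set"
  assumes "compact K" "open U" "K \<subseteq> U" "0 < e"
  obtains \<psi> where "test_function U \<psi>" "\<And>x. 0 \<le> \<psi> x" "\<And>x. \<psi> x \<le> 1" "\<And>x. x \<in> K \<Longrightarrow> 1 - e \<le> \<psi> x"
proof -
  have "\<forall>x\<in>K. \<exists>r>0. cball x r \<subseteq> U"
    using assms open_contains_cball by blast
  then obtain r where r: "\<And>x. x \<in> K \<Longrightarrow> 0 < r x" "\<And>x. x \<in> K \<Longrightarrow> cball x (r x) \<subseteq> U"
    by metis
  have "K \<subseteq> (\<Union>x\<in>K. ball x (r x))" using r by force
  then obtain C where C: "C \<subseteq> K" "finite C" "K \<subseteq> (\<Union>x\<in>C. ball x (r x))"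
    using compactE_image[OF assms(1), of K "\<lambda>x. ball x (r x)"] by auto
  define S where "S y = (\<Sum>x\<in>C. bump 0 ((r x)\<^sup>2 - (norm (y - x))\<^sup>2))" for y
  have S_Ck: "Ck k S" for k
    unfolding S_def by (intro Ck_sum bump_Ck Ck_diff Ck_square_dist Ck_const)
  have bump_ge: "0 \<le> bump 0 s" for s
    by (cases "s \<le> 0") (auto simp: bump_nonpos bump_pos less_imp_le)
  have S_ge: "0 \<le> S y" for y
    unfolding S_def by (intro sum_nonneg bump_ge)
  have S_pos: "0 < S y" if "y \<in> K" for y
  proof -
    obtain x where x: "x \<in> C" "y \<in> ball x (r x)" using C \<open>y \<in> K\<close> by auto
    then have "0 < (r x)\<^sup>2 - (norm (y - x))\<^sup>2"
      by (simp add: dist_norm norm_minus_commute power_strict_mono)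
    then show ?thesis
      unfolding S_def by (intro sum_pos2[OF C(2) x(1)] bump_pos bump_ge)
  qed
  have S_supp: "S y = 0" if "y \<notin> (\<Union>x\<in>C. cball x (r x))" for y
    unfolding S_def
  proof (intro sum.neutral ballI bump_nonpos)
    fix x assume "x \<in> C"
    with that C r have "r x < norm (y - x)" "0 < r x"
      by (auto simp: dist_norm norm_minus_commute)
    then have "(r x)\<^sup>2 \<le> (norm (y - x))\<^sup>2" by (intro power_mono) auto
    then show "(r x)\<^sup>2 - (norm (y - x))\<^sup>2 \<le> 0" by simp
  qed
  obtain \<delta> where \<delta>: "0 < \<delta>" "\<And>y. y \<in> K \<Longrightarrow> \<delta> \<le> S y"
  proof (cases "K = {}")
    case False
    have "continuous_on K S" using S_Ck[of 0] by (auto intro: continuous_on_subset)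
    then obtain y where "y \<in> K" "\<And>z. z \<in> K \<Longrightarrow> S y \<le> S z"
      using continuous_attains_inf[OF assms(1) False] by blast
    then show thesis using S_pos that by blast
  qed (use that[of 1] in auto)
  obtain k :: real where k: "k > 0" "exp (- k * \<delta>) \<le> e"
  proof -
    \<comment> \<open>Solving \<open>exp (- k * \<delta>) \<le> e\<close> for \<open>k\<close> gives
      the second argument; the maximum with 1 keeps \<open>k\<close> positive also when
      \<open>e\<close> is at least 1.\<close>
    define k where "k = max 1 (- ln e / \<delta>)"
    have "- ln e / \<delta> \<le> k" by (simp add: k_def)
    then have "- k * \<delta> \<le> ln e" using \<delta> by (simp add: field_simps)
    then have "exp (- k * \<delta>) \<le> e" using \<open>0 < e\<close> by (metis exp_le_cancel_iff exp_ln)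
    then show thesis by (intro that[of k]) (auto simp: k_def)
  qed
  \<comment> \<open>The successive derivatives of s -> exp(-k s), in the indexed form that
    \<open>Ck_compose\<close> expects.\<close>
  have "Ck j (\<lambda>x. (\<lambda>i s. (- k) ^ i * exp (- k * s)) 0 (S x))" for j
    by (rule Ck_compose[OF _ S_Ck]) (auto intro!: derivative_eq_intros)
  then have "Ck j (\<lambda>y. 1 - exp (- k * S y))" for j
    by (intro Ck_diff Ck_const) simp
  then have "test_function U (\<lambda>y. 1 - exp (- k * S y))"
  proof (rule test_functionI)
    show "compact (\<Union>x\<in>C. cball x (r x))" using C by auto
    show "(\<Union>x\<in>C. cball x (r x)) \<subseteq> U" using C r by blast
  qed (auto simp: S_supp)
  moreover have "1 - e \<le> 1 - exp (- k * S y)" if "y \<in> K" for y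
  proof -
    have "exp (- k * S y) \<le> exp (- k * \<delta>)" using \<delta>(2)[OF that] k by simp
    then show ?thesis using k by linarith
  qed
  ultimately show thesis
    using that[of "\<lambda>y. 1 - exp (- k * S y)"] S_ge k by simp
qed

section \<open>Integration by parts\<close>

text \<open>The mean value theorem bounds the difference quotients by \<open>w\<close>, so dominated
  convergence applies along every sequence tending to \<open>t0\<close>.\<close>

lemma integral_has_real_derivative:
  fixes f f' :: "real \<Rightarrow> 'b \<Rightarrow> real"
  assumes t0: "t0 \<in> {a<..<b}"
    and f: "\<And>t. t \<in> {a<..<b} \<Longrightarrow> integrable M (f t)"
    and deriv: "\<And>t x. t \<in> {a<..<b} \<Longrightarrow> x \<in> space M \<Longrightarrow> ((\<lambda>t. f t x) has_real_derivative f' t x) (at t)"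
    and bound: "\<And>t x. t \<in> {a<..<b} \<Longrightarrow> x \<in> space M \<Longrightarrow> \<bar>f' t x\<bar> \<le> w x"
    and w: "integrable M w"
  shows "((\<lambda>t. LINT x|M. f t x) has_real_derivative (LINT x|M. f' t0 x)) (at t0)"
proof -
  define q where "q t x = (f t x - f t0 x) / (t - t0)" for t x
  have q_bound: "\<bar>q t x\<bar> \<le> w x" if t: "t \<in> {a<..<b}" "t \<noteq> t0" and x: "x \<in> space M" for t x
  proof -
    have "norm (f t x - f t0 x) \<le> w x * norm (t - t0)"
      by (rule field_differentiable_bound[of "{a<..<b}"])
        (use deriv[OF _ x] bound[OF _ x] t t0 in \<open>auto intro: DERIV_subset\<close>)
    then show ?thesis using t by (simp add: q_def divide_le_eq)
  qed
  have q_int: "integrable M (q t)" if "t \<in> {a<..<b}" for t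
    unfolding q_def using f[OF that] f[OF t0] by simp
  have "((\<lambda>t. LINT x|M. q t x) \<longlongrightarrow> (LINT x|M. f' t0 x)) (at t0 within {a<..<b})"
    unfolding tendsto_at_iff_sequentially comp_def
  proof (intro allI impI)
    fix X assume X: "\<forall>i. X i \<in> {a<..<b} - {t0}" "X \<longlonglongrightarrow> t0"
    have lim: "(\<lambda>i. q (X i) x) \<longlonglongrightarrow> f' t0 x" if "x \<in> space M" for x
    proof -
      have "((\<lambda>t. q t x) \<longlongrightarrow> f' t0 x) (at t0)"
        using deriv[OF t0 that] by (simp add: q_def has_field_derivative_iff)
      then show ?thesis
        using X unfolding tendsto_at_iff_sequentially comp_def by auto
    qed
    show "(\<lambda>i. LINT x|M. q (X i) x) \<longlonglongrightarrow> (LINT x|M. f' t0 x)"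
    proof (rule integral_dominated_convergence[OF _ _ w])
      \<comment> \<open>Measurability comes from the difference quotients, of which
        \<open>f' t0\<close> is the pointwise limit.\<close>
      show "f' t0 \<in> borel_measurable M"
        by (rule borel_measurable_LIMSEQ_real[OF lim]) (use q_int X in auto)
    qed (use q_int X lim q_bound in auto)
  qed
  moreover have "(LINT x|M. q t x) = ((LINT x|M. f t x) - (LINT x|M. f t0 x)) / (t - t0)"
    if "t \<in> {a<..<b}" for t
    unfolding q_def using f[OF that] f[OF t0] by simp
  ultimately have "((\<lambda>t. ((LINT x|M. f t x) - (LINT x|M. f t0 x)) / (t - t0)) \<longlongrightarrow> (LINT x|M. f' t0 x))
      (at t0 within {a<..<b})"
    by (subst filterlim_cong[OF refl refl, of _ "\<lambda>t. LINT x|M. q t x"]) (auto simp: eventually_at_filter)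
  then have "((\<lambda>t. LINT x|M. f t x) has_real_derivative (LINT x|M. f' t0 x)) (at t0 within {a<..<b})"
    by (simp add: has_field_derivative_iff)
  then show ?thesis
    using t0 at_within_open[of t0 "{a<..<b}"] by simp
qed

lemma integrable_compact_support:
  fixes f :: "'a::euclidean_space \<Rightarrow> real"
  assumes "continuous_on UNIV f" "bounded K" "\<And>x. x \<notin> K \<Longrightarrow> f x = 0"
  shows "integrable lborel f"
proof -
  obtain a where K: "K \<subseteq> cbox (-a) a"
    using bounded_subset_cbox_symmetric[OF assms(2)] .
  have "integrable lborel (\<lambda>x. indicator (cbox (-a) a) x *\<^sub>R f x)"
    by (rule borel_integrable_compact) (use assms(1) in \<open>auto intro: continuous_on_subset\<close>)
  moreover have "(\<lambda>x. indicator (cbox (-a) a) x *\<^sub>R f x) = f"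
    using assms(3) K by (auto simp: fun_eq_iff indicator_def)
  ultimately show ?thesis by simp
qed

text \<open>The function spaces are built on \<open>lebesgue_on\<close>, while translation, scaling
  and Fubini are used for \<open>lborel\<close>; this is the bridge for Borel integrands that vanish
  off the domain.\<close>

lemma lebesgue_on_integral_eq:
  fixes h :: "'a::euclidean_space \<Rightarrow> real"
  assumes "\<Omega> \<in> sets lebesgue" "h \<in> borel_measurable borel" "\<And>x. x \<notin> \<Omega> \<Longrightarrow> h x = 0"
  shows "(LINT x|lebesgue_on \<Omega>. h x) = (LINT x|lborel. h x)"
proof -
  have "(\<lambda>x. indicator \<Omega> x *\<^sub>R h x) = h"
    using assms(3) by (auto simp: fun_eq_iff indicator_def)
  then show ?thesis
    using assms(1,2) by (simp add: integral_restrict_space integral_completion)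
qed

lemma integral_translation:
  fixes f :: "'a::euclidean_space \<Rightarrow> real"
  assumes "f \<in> borel_measurable borel"
  shows "(LINT x|lborel. f (c + x)) = (LINT x|lborel. f x)"
proof -
  have "(LINT x|lborel. f x) = (LINT x|distr lborel borel ((+) c). f x)"
    by (simp add: lborel_distr_plus)
  also have "\<dots> = (LINT x|lborel. f (c + x))"
    using assms by (subst integral_distr) auto
  finally show ?thesis by simp
qed

text \<open>The integral of the translate x -> f(s b + x) does not depend on s; differentiating
  under the integral at s = 0 gives the claim.\<close>

lemma integral_grad_inner_eq_0:
  fixes f :: "'a::euclidean_space \<Rightarrow> real"
  assumes f: "test_function UNIV f" and b: "norm b = 1"
  shows "(LINT x|lborel. grad f x \<bullet> b) = 0"
proof -
  obtain K where K: "compact K" "\<And>x. x \<notin> K \<Longrightarrow> f x = 0" "\<And>x. x \<notin> K \<Longrightarrow> grad f x = 0"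
    using test_function_support[OF f] by metis
  obtain B where B: "0 < B" "\<And>x. norm (grad f x) \<le> B"
    using test_function_bounded[OF f] by metis
  obtain R where R: "K \<subseteq> cball 0 R"
    using compact_imp_bounded[OF K(1)] by (auto simp: bounded_iff subset_iff)
  \<comment> \<open>For |s| < 1 the translated supports stay in one ball, which supplies an
    integrable majorant uniform in s.\<close>
  have out: "s *\<^sub>R b + x \<notin> K" if "x \<notin> cball 0 (R + 1)" "s \<in> {-1<..<1}" for x s
  proof
    assume "s *\<^sub>R b + x \<in> K"
    then have "norm (s *\<^sub>R b + x) \<le> R" using R by auto
    moreover have "norm x \<le> norm (s *\<^sub>R b + x) + norm (s *\<^sub>R b)"
      using norm_triangle_ineq4[of "s *\<^sub>R b + x" "s *\<^sub>R b"] by simp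
    moreover have "norm (s *\<^sub>R b) \<le> 1" using that b by auto
    ultimately show False using that by auto
  qed
  have cf: "continuous_on UNIV (\<lambda>x. f (s *\<^sub>R b + x))" for s
    by (intro continuous_on_compose2[OF test_function_continuous[OF f, of UNIV]] continuous_intros) auto
  have "((\<lambda>s. LINT x|lborel. f (s *\<^sub>R b + x)) has_real_derivative (LINT x|lborel. grad f (0 *\<^sub>R b + x) \<bullet> b)) (at 0)"
  proof (rule integral_has_real_derivative[where a="-1" and b=1 and w="\<lambda>x. B * indicator (cball 0 (R + 1)) x"])
    fix s :: real assume s: "s \<in> {-1<..<1}"
    show "integrable lborel (\<lambda>x. f (s *\<^sub>R b + x))"
      using out[OF _ s] K by (intro integrable_compact_support[where K="cball 0 (R + 1)"] cf) auto
    fix x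
    have "((\<lambda>s. f (s *\<^sub>R b + x)) has_derivative (\<lambda>h. grad f (s *\<^sub>R b + x) \<bullet> (h *\<^sub>R b))) (at s)"
      by (rule has_derivative_compose[OF _ test_function_has_derivative[OF f]])
        (auto intro!: derivative_eq_intros)
    then show "((\<lambda>s. f (s *\<^sub>R b + x)) has_real_derivative grad f (s *\<^sub>R b + x) \<bullet> b) (at s)"
      by (simp add: has_field_derivative_def mult_commute_abs)
    have "\<bar>grad f y \<bullet> b\<bar> \<le> B" for y
      using Cauchy_Schwarz_ineq2[of "grad f y" b] B(2)[of y] b by simp
    then show "\<bar>grad f (s *\<^sub>R b + x) \<bullet> b\<bar> \<le> B * indicator (cball 0 (R + 1)) x"
      using out[OF _ s] K by (auto simp: indicator_def)
  qed (auto intro!: integrable_mult_right integrable_real_indicator emeasure_bounded_finite)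
  moreover have "(LINT x|lborel. f (s *\<^sub>R b + x)) = (LINT x|lborel. f x)" for s
    by (intro integral_translation borel_measurable_continuous_onI test_function_continuous[OF f])
  ultimately have "((\<lambda>s::real. LINT x|lborel. f x) has_real_derivative (LINT x|lborel. grad f x \<bullet> b)) (at 0)"
    by simp
  then show ?thesis
    using DERIV_unique[OF _ DERIV_const] by blast
qed

text \<open>The Leibniz rule for \<open>f x * \<psi> x\<close>, whose partial derivatives have
  integral 0.\<close>

lemma test_function_weak_gradient:
  fixes f :: "'a::euclidean_space \<Rightarrow> real"
  assumes f: "test_function \<Omega> f" and \<Omega>: "open \<Omega>"
  shows "weak_gradient_on \<Omega> f (grad f)"
  unfolding weak_gradient_on_def
proof (intro allI impI ballI)
  fix \<psi> b assume \<psi>: "test_function \<Omega> \<psi>" and b: "b \<in> (Basis :: 'a set)"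
  have \<Omega>': "\<Omega> \<in> sets lebesgue" using \<Omega> by (simp add: borel_open lborelD)
  obtain K where K: "compact K" "K \<subseteq> \<Omega>" "\<And>x. x \<notin> K \<Longrightarrow> \<psi> x = 0" "\<And>x. x \<notin> K \<Longrightarrow> grad \<psi> x = 0"
    using test_function_support[OF \<psi>] by metis
  have out: "\<psi> x = 0" "grad \<psi> x = 0" if "x \<notin> \<Omega>" for x
    using K that by blast+
  note cont = test_function_continuous[OF f] test_function_continuous[OF \<psi>]
    test_function_continuous_grad[OF f] test_function_continuous_grad[OF \<psi>]
  have prod: "test_function UNIV (\<lambda>x. f x * \<psi> x)"
    by (rule test_function_mono[OF test_function_mult[OF \<psi>]]) (auto intro: test_function_Ck[OF f])
  have grad_prod: "grad (\<lambda>x. f x * \<psi> x) x = f x *\<^sub>R grad \<psi> x + \<psi> x *\<^sub>R grad f x" for x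
    by (rule grad_unique) (auto intro!: derivative_eq_intros test_function_has_derivative[OF f]
        test_function_has_derivative[OF \<psi>] simp: inner_add_left)
  have i1: "integrable lborel (\<lambda>x. f x * (grad \<psi> x \<bullet> b))" and i2: "integrable lborel (\<lambda>x. (grad f x \<bullet> b) * \<psi> x)"
    using K by (auto intro!: integrable_compact_support[of _ K] continuous_intros cont compact_imp_bounded)
  have "0 = (LINT x|lborel. f x * (grad \<psi> x \<bullet> b) + (grad f x \<bullet> b) * \<psi> x)"
    using integral_grad_inner_eq_0[OF prod, of b] b unfolding grad_prod
    by (simp add: inner_add_left mult.commute[of "grad f _ \<bullet> b"])
  also have "\<dots> = (LINT x|lborel. f x * (grad \<psi> x \<bullet> b)) + (LINT x|lborel. (grad f x \<bullet> b) * \<psi> x)"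
    by (rule Bochner_Integration.integral_add[OF i1 i2])
  finally have "(LINT x|lborel. f x * (grad \<psi> x \<bullet> b)) = - (LINT x|lborel. (grad f x \<bullet> b) * \<psi> x)"
    by simp
  moreover have "(LINT x|lebesgue_on \<Omega>. f x * (grad \<psi> x \<bullet> b)) = (LINT x|lborel. f x * (grad \<psi> x \<bullet> b))"
    "(LINT x|lebesgue_on \<Omega>. (grad f x \<bullet> b) * \<psi> x) = (LINT x|lborel. (grad f x \<bullet> b) * \<psi> x)"
    using out by (auto intro!: lebesgue_on_integral_eq \<Omega>' borel_measurable_continuous_onI continuous_intros cont)
  ultimately have "(LINT x|lebesgue_on \<Omega>. f x * (grad \<psi> x \<bullet> b)) = - (LINT x|lebesgue_on \<Omega>. (grad f x \<bullet> b) * \<psi> x)"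
    by simp
  then show "(LINT x|lebesgue_on \<Omega>. f x * frechet_derivative \<psi> (at x) b) =
      - (LINT x|lebesgue_on \<Omega>. (grad f x \<bullet> b) * \<psi> x)"
    using b by (simp add: grad_inner)
qed

section \<open>Square integrable functions\<close>

lemma L2_on_integrable_inner:
  assumes "L2_on \<Omega> f" "L2_on \<Omega> g"
  shows "integrable (lebesgue_on \<Omega>) (\<lambda>x. f x \<bullet> g x)"
proof (rule Bochner_Integration.integrable_bound)
  show "integrable (lebesgue_on \<Omega>) (\<lambda>x. (norm (f x))\<^sup>2 + (norm (g x))\<^sup>2)"
    using assms by (simp add: L2_on_def)
  show "(\<lambda>x. f x \<bullet> g x) \<in> borel_measurable (lebesgue_on \<Omega>)"
    using assms by (auto simp: L2_on_def)
  have "\<bar>f x \<bullet> g x\<bar> \<le> (norm (f x))\<^sup>2 + (norm (g x))\<^sup>2" for x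
  proof -
    have "\<bar>f x \<bullet> g x\<bar> \<le> norm (f x) * norm (g x)" by (rule Cauchy_Schwarz_ineq2)
    moreover have "0 \<le> (norm (f x) - norm (g x))\<^sup>2" by simp
    moreover have "0 \<le> (norm (f x))\<^sup>2" "0 \<le> (norm (g x))\<^sup>2" by simp_all
    ultimately show ?thesis unfolding power2_diff by linarith
  qed
  then show "AE x in lebesgue_on \<Omega>. norm (f x \<bullet> g x) \<le> norm ((norm (f x))\<^sup>2 + (norm (g x))\<^sup>2)"
    by (auto intro!: AE_I2)
qed

lemma L2_on_lincomb:
  assumes "L2_on \<Omega> f" "L2_on \<Omega> g"
  shows "L2_on \<Omega> (\<lambda>x. f x + c *\<^sub>R g x)"
proof -
  have "integrable (lebesgue_on \<Omega>) (\<lambda>x. f x \<bullet> f x + 2 * c * (f x \<bullet> g x) + c\<^sup>2 * (g x \<bullet> g x))"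
    using assms by (intro Bochner_Integration.integrable_add integrable_mult_right L2_on_integrable_inner)
  moreover have "(norm (f x + c *\<^sub>R g x))\<^sup>2 = f x \<bullet> f x + 2 * c * (f x \<bullet> g x) + c\<^sup>2 * (g x \<bullet> g x)" for x
    unfolding power2_norm_eq_inner
    by (simp add: inner_add_left inner_add_right inner_commute[of "g x" "f x"] power2_eq_square algebra_simps)
  ultimately show ?thesis
    using assms by (auto simp: L2_on_def)
qed

lemma L2_on_diff: "L2_on \<Omega> f \<Longrightarrow> L2_on \<Omega> g \<Longrightarrow> L2_on \<Omega> (\<lambda>x. f x - g x)"
  using L2_on_lincomb[of \<Omega> f g "-1"] by simp

lemma L2_on_add: "L2_on \<Omega> f \<Longrightarrow> L2_on \<Omega> g \<Longrightarrow> L2_on \<Omega> (\<lambda>x. f x + g x)"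
  using L2_on_lincomb[of \<Omega> f g 1] by simp

lemma L2_on_bounded:
  assumes "\<Omega> \<in> lmeasurable" "f \<in> borel_measurable (lebesgue_on \<Omega>)" "\<And>x. x \<in> \<Omega> \<Longrightarrow> norm (f x) \<le> B"
  shows "L2_on \<Omega> f"
proof -
  have "finite_measure (lebesgue_on \<Omega>)"
    using assms(1) by (simp add: finite_measure_lebesgue_on)
  then have "integrable (lebesgue_on \<Omega>) (\<lambda>x. (norm (f x))\<^sup>2)"
    using assms by (intro finite_measure.integrable_const_bound[where B="B\<^sup>2"]) (auto intro!: AE_I2 power_mono)
  then show ?thesis using assms by (simp add: L2_on_def)
qed

lemma continuous_imp_measurable_lebesgue_on:
  "continuous_on UNIV f \<Longrightarrow> f \<in> borel_measurable (lebesgue_on \<Omega>)"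
  by (intro measurable_restrict_space1 measurable_completion) (simp add: borel_measurable_continuous_onI)

lemma L2_on_test_function:
  assumes "test_function \<Omega>' \<psi>" "\<Omega> \<in> lmeasurable"
  shows "L2_on \<Omega> \<psi>" "L2_on \<Omega> (grad \<psi>)"
proof -
  obtain B where "\<And>x. \<bar>\<psi> x\<bar> \<le> B" "\<And>x. norm (grad \<psi> x) \<le> B"
    using test_function_bounded[OF assms(1)] by metis
  then show "L2_on \<Omega> \<psi>" "L2_on \<Omega> (grad \<psi>)"
    by (auto intro!: L2_on_bounded[OF assms(2)] continuous_imp_measurable_lebesgue_on
        test_function_continuous[OF assms(1)] test_function_continuous_grad[OF assms(1)])
qed

text \<open>Values in an arbitrary Euclidean space let the same lemmas serve functions, gradients
  and pairs of a function with its gradient.\<close>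

definition L2_inner :: "'a::euclidean_space set \<Rightarrow> ('a \<Rightarrow> 'b::euclidean_space) \<Rightarrow> ('a \<Rightarrow> 'b) \<Rightarrow> real" where
  "L2_inner \<Omega> f g = (LINT x|lebesgue_on \<Omega>. f x \<bullet> g x)"

lemma L2_norm_on_nonneg: "0 \<le> L2_norm_on \<Omega> f"
  by (simp add: L2_norm_on_def)

lemma L2_norm_on_square: "(L2_norm_on \<Omega> f)\<^sup>2 = L2_inner \<Omega> f f"
  by (simp add: L2_norm_on_def L2_inner_def power2_norm_eq_inner)

lemma L2_inner_commute: "L2_inner \<Omega> f g = L2_inner \<Omega> g f"
  by (simp add: L2_inner_def inner_commute)

lemma L2_inner_lincomb_right:
  assumes "L2_on \<Omega> f" "L2_on \<Omega> g" "L2_on \<Omega> h"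
  shows "L2_inner \<Omega> f (\<lambda>x. g x + c *\<^sub>R h x) = L2_inner \<Omega> f g + c * L2_inner \<Omega> f h"
  using assms by (simp add: L2_inner_def inner_add_right L2_on_integrable_inner)

lemma L2_inner_lincomb_left:
  assumes "L2_on \<Omega> f" "L2_on \<Omega> g" "L2_on \<Omega> h"
  shows "L2_inner \<Omega> (\<lambda>x. g x + c *\<^sub>R h x) f = L2_inner \<Omega> g f + c * L2_inner \<Omega> h f"
  using L2_inner_lincomb_right[OF assms] by (simp add: L2_inner_commute)

lemma L2_norm_on_square_lincomb:
  assumes "L2_on \<Omega> f" "L2_on \<Omega> g"
  shows "(L2_norm_on \<Omega> (\<lambda>x. f x + c *\<^sub>R g x))\<^sup>2 =
    (L2_norm_on \<Omega> f)\<^sup>2 + 2 * c * L2_inner \<Omega> f g + c\<^sup>2 * (L2_norm_on \<Omega> g)\<^sup>2"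
  unfolding L2_norm_on_square
  using assms L2_on_lincomb[OF assms]
  by (simp add: L2_inner_lincomb_right L2_inner_lincomb_left power2_eq_square algebra_simps L2_inner_commute[of _ g f])

text \<open>The squared norm of f + c g is a nonnegative quadratic polynomial in c, evaluated at its
  minimizer -B/D.\<close>

lemma L2_Cauchy_Schwarz:
  assumes "L2_on \<Omega> f" "L2_on \<Omega> g"
  shows "\<bar>L2_inner \<Omega> f g\<bar> \<le> L2_norm_on \<Omega> f * L2_norm_on \<Omega> g"
proof -
  define A B D where "A = (L2_norm_on \<Omega> f)\<^sup>2" and "B = L2_inner \<Omega> f g" and "D = (L2_norm_on \<Omega> g)\<^sup>2"
  have pos: "0 \<le> A + 2 * c * B + c\<^sup>2 * D" for c
    using L2_norm_on_square_lincomb[OF assms, of c] unfolding A_def B_def D_def by (metis zero_le_power2)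
  have "0 \<le> D" by (simp add: D_def)
  have "B\<^sup>2 \<le> A * D"
  proof (cases "D = 0")
    case True
    have "B = 0"
    proof (rule ccontr)
      assume "B \<noteq> 0"
      \<comment> \<open>For \<open>D = 0\<close> the polynomial is affine in c, and this value of c
        makes it equal to -1.\<close>
      with pos[of "- (A + 1) / (2 * B)"] True show False by (simp add: field_simps)
    qed
    then show ?thesis using True by simp
  next
    case False
    have "0 \<le> A - B\<^sup>2 / D"
      using pos[of "- B / D"] False by (simp add: power2_eq_square)
    then show ?thesis using False \<open>0 \<le> D\<close> by (simp add: field_simps)
  qed
  then have "\<bar>B\<bar>\<^sup>2 \<le> (L2_norm_on \<Omega> f * L2_norm_on \<Omega> g)\<^sup>2"
    by (simp add: A_def D_def power_mult_distrib)
  then show ?thesis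
    unfolding B_def by (rule power2_le_imp_le) (simp add: L2_norm_on_nonneg)
qed

lemma L2_norm_on_triangle:
  assumes "L2_on \<Omega> f" "L2_on \<Omega> g"
  shows "L2_norm_on \<Omega> (\<lambda>x. f x + g x) \<le> L2_norm_on \<Omega> f + L2_norm_on \<Omega> g"
proof (rule power2_le_imp_le)
  show "(L2_norm_on \<Omega> (\<lambda>x. f x + g x))\<^sup>2 \<le> (L2_norm_on \<Omega> f + L2_norm_on \<Omega> g)\<^sup>2"
    using L2_norm_on_square_lincomb[OF assms, of 1] L2_Cauchy_Schwarz[OF assms]
    by (simp add: power2_sum)
qed (simp add: L2_norm_on_nonneg)

lemma L2_norm_on_cmult: "L2_norm_on \<Omega> (\<lambda>x. c *\<^sub>R f x) = \<bar>c\<bar> * L2_norm_on \<Omega> f"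
  by (simp add: L2_norm_on_def power_mult_distrib real_sqrt_mult)

lemma L2_norm_on_cong_AE:
  assumes "L2_on \<Omega> f" "L2_on \<Omega> g" "AE x in lebesgue_on \<Omega>. f x = g x"
  shows "L2_norm_on \<Omega> f = L2_norm_on \<Omega> g"
  unfolding L2_norm_on_def using assms
  by (intro arg_cong[where f=sqrt] integral_cong_AE) (auto simp: L2_on_def)

lemma L2_norm_on_eq_0:
  assumes "L2_on \<Omega> f" "L2_norm_on \<Omega> f = 0"
  shows "AE x in lebesgue_on \<Omega>. f x = 0"
proof -
  have "(LINT x|lebesgue_on \<Omega>. (norm (f x))\<^sup>2) = 0"
    using assms(2) by (simp add: L2_norm_on_def)
  then have "AE x in lebesgue_on \<Omega>. (norm (f x))\<^sup>2 = 0"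
    using assms(1) by (subst (asm) integral_nonneg_eq_0_iff_AE) (auto simp: L2_on_def)
  then show ?thesis by simp
qed

section \<open>Density of test functions in L2\<close>

lemma L2_on_subset_bound:
  fixes f g :: "'a::euclidean_space \<Rightarrow> real"
  assumes "L2_on \<Omega> g" "f \<in> borel_measurable (lebesgue_on \<Omega>)" "\<And>x. x \<in> \<Omega> \<Longrightarrow> \<bar>f x\<bar> \<le> \<bar>g x\<bar>"
  shows "L2_on \<Omega> f"
  unfolding L2_on_def
proof
  show "integrable (lebesgue_on \<Omega>) (\<lambda>x. (norm (f x))\<^sup>2)"
  proof (rule Bochner_Integration.integrable_bound)
    show "integrable (lebesgue_on \<Omega>) (\<lambda>x. (norm (g x))\<^sup>2)"
      using assms by (simp add: L2_on_def)
    have "(norm (f x))\<^sup>2 \<le> (norm (g x))\<^sup>2" if "x \<in> \<Omega>" for x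
      using power_mono[OF assms(3)[OF that] abs_ge_zero, of 2] by simp
    then show "AE x in lebesgue_on \<Omega>. norm ((norm (f x))\<^sup>2) \<le> norm ((norm (g x))\<^sup>2)"
      by (intro AE_I2) simp
  qed (use assms(2) in measurable)
qed fact

text \<open>Squeeze \<open>A\<close> between a closed \<open>T\<close> inside it and an open
  \<open>U\<close> around \<open>T\<close>, and take a smooth function that is nearly 1 on
  \<open>T\<close> and supported in \<open>U\<close>. The error lives on \<open>A - T\<close> and
  \<open>U - T\<close>, apart from an error of at most \<open>\<delta>\<close> on
  \<open>T\<close>.\<close>

lemma test_functions_dense_indicator:
  assumes "open \<Omega>" "bounded \<Omega>" "A \<in> sets (lebesgue_on \<Omega>)" "0 < e"
  shows "\<exists>\<psi>. test_function \<Omega> \<psi> \<and> L2_norm_on \<Omega> (\<lambda>x. indicator A x - \<psi> x) < e"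
proof -
  have \<Omega>: "\<Omega> \<in> lmeasurable" using assms by (simp add: bounded_set_imp_lmeasurable lmeasurable_open)
  then have "\<Omega> \<in> sets lebesgue" by blast
  then have A: "A \<in> sets lebesgue" "A \<subseteq> \<Omega>"
    using assms(3) by (auto simp: sets_restrict_space)
  \<comment> \<open>The squared error is a sum of three terms of size at most
    \<open>\<epsilon>\<close>, so a quarter of the squared tolerance suffices.\<close>
  define \<epsilon> where "\<epsilon> = e\<^sup>2 / 4"
  have "0 < \<epsilon>" using assms by (simp add: \<epsilon>_def)
  obtain T where T: "closed T" "T \<subseteq> A" "A - T \<in> lmeasurable" "emeasure lebesgue (A - T) < ennreal \<epsilon>"
    using sets_lebesgue_inner_closed[OF A(1) \<open>0 < \<epsilon>\<close>] .
  then have "T \<in> sets lebesgue" by (simp add: borel_closed lborelD)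
  then obtain U where U: "open U" "T \<subseteq> U" "U - T \<in> lmeasurable" "emeasure lebesgue (U - T) < ennreal \<epsilon>"
    using sets_lebesgue_outer_open[OF _ \<open>0 < \<epsilon>\<close>] by metis
  have m: "measure lebesgue (A - T) < \<epsilon>" "measure lebesgue (U - T) < \<epsilon>"
    using T(3,4) U(3,4) \<open>0 < \<epsilon>\<close> by (simp_all add: emeasure_eq_measure2 ennreal_less_iff)
  \<comment> \<open>\<open>smooth_Urysohn\<close> reaches only \<open>1 - \<delta>\<close> on
    \<open>T\<close>; this choice makes the resulting loss over all of \<open>\<Omega>\<close> at
    most \<open>\<epsilon>\<close>. The added 1 keeps the denominator positive when
    \<open>\<Omega>\<close> is null.\<close>
  define \<delta> where "\<delta> = min 1 (\<epsilon> / (measure lebesgue \<Omega> + 1))"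
  have "0 < measure lebesgue \<Omega> + 1" by (simp add: add_nonneg_pos)
  then have \<delta>: "0 < \<delta>" "\<delta> \<le> 1" "\<delta> * measure lebesgue \<Omega> \<le> \<epsilon>"
  proof -
    have "\<delta> * measure lebesgue \<Omega> \<le> (\<epsilon> / (measure lebesgue \<Omega> + 1)) * (measure lebesgue \<Omega> + 1)"
      using \<open>0 < \<epsilon>\<close> by (intro mult_mono) (auto simp: \<delta>_def)
    then show "\<delta> * measure lebesgue \<Omega> \<le> \<epsilon>"
      using \<open>0 < measure lebesgue \<Omega> + 1\<close> by simp
  qed (use \<open>0 < \<epsilon>\<close> in \<open>auto simp: \<delta>_def\<close>)
  have "compact T" using T(1) A(2) T(2) assms(2) bounded_subset compact_eq_bounded_closed by (metis subset_trans)
  then obtain \<psi> where \<psi>: "test_function (U \<inter> \<Omega>) \<psi>" "\<And>x. 0 \<le> \<psi> x" "\<And>x. \<psi> x \<le> 1" "\<And>x. x \<in> T \<Longrightarrow> 1 - \<delta> \<le> \<psi> x"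
  proof (rule smooth_Urysohn)
    show "open (U \<inter> \<Omega>)" "T \<subseteq> U \<inter> \<Omega>" using U assms(1) T(2) A(2) by auto
  qed (use \<delta>(1) in auto)
  have \<psi>0: "\<psi> x = 0" if "x \<notin> U" for x
    using test_function_support[OF \<psi>(1)] that by (metis IntD1 subsetD)
  define w where "w x = indicator (A - T) x + indicator (U - T) x + (\<delta> * indicator \<Omega> x :: real)" for x
  have "test_function \<Omega> \<psi>" using \<psi>(1) by (rule test_function_mono) auto
  then have L2: "L2_on \<Omega> (\<lambda>x. indicator A x - \<psi> x)"
    by (intro L2_on_diff L2_on_test_function L2_on_bounded[where B=1] \<Omega>)
      (use assms(3) in \<open>auto simp: indicator_def\<close>)
  have le: "(norm (indicator A x - \<psi> x))\<^sup>2 \<le> w x" if "x \<in> \<Omega>" for x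
  proof -
    \<comment> \<open>The pointwise error is at most 1, so its square is dominated by its absolute
      value, which the sum of indicators \<open>w\<close> bounds.\<close>
    have sq: "t\<^sup>2 \<le> \<bar>t\<bar>" if "\<bar>t\<bar> \<le> 1" for t :: real
    proof -
      have "\<bar>t\<bar> * \<bar>t\<bar> \<le> \<bar>t\<bar> * 1" using that by (intro mult_left_mono) auto
      then show ?thesis by (simp add: power2_eq_square flip: abs_mult)
    qed
    have "\<bar>indicator A x - \<psi> x\<bar> \<le> 1"
      using \<psi>(2)[of x] \<psi>(3)[of x] by (auto simp: indicator_def)
    then have "(indicator A x - \<psi> x)\<^sup>2 \<le> \<bar>indicator A x - \<psi> x\<bar>" by (rule sq)
    also have "\<dots> \<le> w x"
      using \<psi>(2)[of x] \<psi>(3)[of x] \<psi>(4)[of x] \<psi>0[of x] \<delta> that T(2)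
      by (auto simp: w_def indicator_def)
    finally show ?thesis by simp
  qed
  have w_int: "integrable lebesgue w"
    unfolding w_def using T U \<Omega>
    by (intro Bochner_Integration.integrable_add integrable_mult_right) (auto simp: fmeasurable_def)
  have w_on: "integrable (lebesgue_on \<Omega>) w"
    using integrable_mult_indicator[OF \<open>\<Omega> \<in> sets lebesgue\<close> w_int] \<open>\<Omega> \<in> sets lebesgue\<close>
    by (simp add: integrable_restrict_space)
  have "(L2_norm_on \<Omega> (\<lambda>x. indicator A x - \<psi> x))\<^sup>2 = (LINT x|lebesgue_on \<Omega>. (norm (indicator A x - \<psi> x))\<^sup>2)"
    by (simp add: L2_norm_on_def)
  also have "\<dots> \<le> (LINT x|lebesgue_on \<Omega>. w x)"
    using L2 w_on le by (intro integral_mono) (auto simp: L2_on_def)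
  also have "\<dots> = (LINT x|lebesgue. indicator \<Omega> x *\<^sub>R w x)"
    using \<open>\<Omega> \<in> sets lebesgue\<close> by (simp add: integral_restrict_space)
  also have "\<dots> \<le> (LINT x|lebesgue. w x)"
  proof (rule integral_mono[OF integrable_mult_indicator[OF \<open>\<Omega> \<in> sets lebesgue\<close> w_int] w_int])
    show "indicator \<Omega> x *\<^sub>R w x \<le> w x" for x
      using \<delta>(1) by (auto simp: w_def indicator_def)
  qed
  also have "\<dots> = measure lebesgue (A - T) + measure lebesgue (U - T) + \<delta> * measure lebesgue \<Omega>"
    unfolding w_def using T U \<Omega>
    by (subst Bochner_Integration.integral_add Bochner_Integration.integrable_add | force simp: fmeasurable_def)+
  also have "\<dots> < e\<^sup>2"
  proof -
    have "4 * \<epsilon> = e\<^sup>2" by (simp add: \<epsilon>_def)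
    then show ?thesis using m \<delta>(3) \<open>0 < \<epsilon>\<close> by linarith
  qed
  finally have "L2_norm_on \<Omega> (\<lambda>x. indicator A x - \<psi> x) < e"
    using assms(4) by (intro power2_less_imp_less[of _ e]) auto
  with \<open>test_function \<Omega> \<psi>\<close> show ?thesis by auto
qed

text \<open>The induction over nonnegative measurable functions carries no integrability, so
  \<open>L2_on\<close> is a premise inside the induction claim and each case passes it down to its
  parts.\<close>

lemma test_functions_dense_nonneg:
  fixes f :: "'a::euclidean_space \<Rightarrow> real"
  assumes \<Omega>: "open \<Omega>" "bounded \<Omega>" and f: "f \<in> borel_measurable (lebesgue_on \<Omega>)" "\<And>x. 0 \<le> f x"
  shows "L2_on \<Omega> f \<longrightarrow> (\<forall>e>0. \<exists>\<psi>. test_function \<Omega> \<psi> \<and> L2_norm_on \<Omega> (\<lambda>x. f x - \<psi> x) < e)"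
  using f
proof (induction rule: borel_measurable_induct_real)
  case (set A)
  then show ?case using test_functions_dense_indicator[OF \<Omega>] by auto
next
  case (mult u c)
  show ?case
  proof (intro impI allI)
    fix e :: real assume L2: "L2_on \<Omega> (\<lambda>x. c * u x)" and "0 < e"
    show "\<exists>\<psi>. test_function \<Omega> \<psi> \<and> L2_norm_on \<Omega> (\<lambda>x. c * u x - \<psi> x) < e"
    proof (cases "c = 0")
      case True
      then show ?thesis
        using \<open>0 < e\<close> by (intro exI[of _ "\<lambda>x. 0"]) (auto simp: test_function_zero L2_norm_on_def)
    next
      case False
      then have "0 < c" using mult by auto
      \<comment> \<open>This combination of \<open>c * u x\<close> with itself equals
        \<open>u x\<close>.\<close>
      have "L2_on \<Omega> (\<lambda>x. c * u x + (1 / c - 1) *\<^sub>R (c * u x))"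
        using L2_on_lincomb[OF L2 L2] .
      then have "L2_on \<Omega> u" using False by (simp add: field_simps)
      moreover have "0 < e / c" using \<open>0 < c\<close> \<open>0 < e\<close> by simp
      ultimately obtain \<psi> where \<psi>: "test_function \<Omega> \<psi>" "L2_norm_on \<Omega> (\<lambda>x. u x - \<psi> x) < e / c"
        using mult.IH by blast
      have "L2_norm_on \<Omega> (\<lambda>x. c *\<^sub>R (u x - \<psi> x)) < e"
        unfolding L2_norm_on_cmult using \<psi>(2) \<open>0 < c\<close> by (simp add: field_simps)
      then show ?thesis
        using test_function_cmult[OF \<psi>(1), of c] by (auto simp: right_diff_distrib)
    qed
  qed
next
  case (add u v)
  have \<Omega>': "\<Omega> \<in> lmeasurable" using \<Omega> by (simp add: bounded_set_imp_lmeasurable lmeasurable_open)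
  show ?case
  proof (intro impI allI)
    fix e :: real assume L2: "L2_on \<Omega> (\<lambda>x. v x + u x)" and "0 < e"
    have uv: "L2_on \<Omega> u" "L2_on \<Omega> v"
      using add by (auto intro!: L2_on_subset_bound[OF L2])
    obtain \<psi> \<theta> where \<psi>: "test_function \<Omega> \<psi>" "L2_norm_on \<Omega> (\<lambda>x. u x - \<psi> x) < e / 2"
      and \<theta>: "test_function \<Omega> \<theta>" "L2_norm_on \<Omega> (\<lambda>x. v x - \<theta> x) < e / 2"
      using add.IH uv \<open>0 < e\<close> by (metis half_gt_zero)
    have "L2_norm_on \<Omega> (\<lambda>x. (v x - \<theta> x) + (u x - \<psi> x)) \<le> L2_norm_on \<Omega> (\<lambda>x. v x - \<theta> x) + L2_norm_on \<Omega> (\<lambda>x. u x - \<psi> x)"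
      by (intro L2_norm_on_triangle L2_on_diff uv L2_on_test_function[OF \<psi>(1) \<Omega>'] L2_on_test_function[OF \<theta>(1) \<Omega>'])
    then have "L2_norm_on \<Omega> (\<lambda>x. v x + u x - (\<theta> x + \<psi> x)) < e"
      using \<psi>(2) \<theta>(2) by (simp add: algebra_simps)
    then show "\<exists>\<psi>. test_function \<Omega> \<psi> \<and> L2_norm_on \<Omega> (\<lambda>x. v x + u x - \<psi> x) < e"
      using test_function_add[OF \<theta>(1) \<psi>(1)] by blast
  qed
next
  case (seq U)
  have \<Omega>': "\<Omega> \<in> lmeasurable" using \<Omega> by (simp add: bounded_set_imp_lmeasurable lmeasurable_open)
  show ?case
  proof (intro impI allI)
    fix e :: real assume L2: "L2_on \<Omega> f" and "0 < e"
    have le: "0 \<le> U i x" "U i x \<le> f x" if "x \<in> \<Omega>" for i x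
      using seq that by (auto intro!: incseq_le simp: incseq_def le_fun_def)
    then have U: "L2_on \<Omega> (U i)" for i
      using seq f by (intro L2_on_subset_bound[OF L2]) auto
    \<comment> \<open>Because \<open>U i\<close> lies between 0 and \<open>f\<close> on the domain,
      the squared differences are dominated by the square of \<open>f\<close>.\<close>
    have "(\<lambda>i. LINT x|lebesgue_on \<Omega>. (norm (f x - U i x))\<^sup>2) \<longlonglongrightarrow> (LINT x|lebesgue_on \<Omega>. 0)"
    proof (rule integral_dominated_convergence[where w="\<lambda>x. (norm (f x))\<^sup>2"])
      show "AE x in lebesgue_on \<Omega>. (\<lambda>i. (norm (f x - U i x))\<^sup>2) \<longlonglongrightarrow> 0"
      proof (rule AE_I2)
        fix x assume "x \<in> space (lebesgue_on \<Omega>)"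
        then have "(\<lambda>i. (norm (f x - U i x))\<^sup>2) \<longlonglongrightarrow> (norm (f x - f x))\<^sup>2"
          by (intro tendsto_intros seq) auto
        then show "(\<lambda>i. (norm (f x - U i x))\<^sup>2) \<longlonglongrightarrow> 0" by simp
      qed
      show "AE x in lebesgue_on \<Omega>. norm ((norm (f x - U i x))\<^sup>2) \<le> (norm (f x))\<^sup>2" for i
      proof -
        have "(norm (f x - U i x))\<^sup>2 \<le> (norm (f x))\<^sup>2" if "x \<in> \<Omega>" for x
          using le[OF that, of i] by (intro power_mono) auto
        then show ?thesis by (intro AE_I2) simp
      qed
    qed (use L2 f seq in \<open>auto simp: L2_on_def\<close>)
    then have "(\<lambda>i. L2_norm_on \<Omega> (\<lambda>x. f x - U i x)) \<longlonglongrightarrow> 0"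
      unfolding L2_norm_on_def using tendsto_real_sqrt by fastforce
    then obtain i where i: "L2_norm_on \<Omega> (\<lambda>x. f x - U i x) < e / 2"
      using order_tendstoD(2)[of _ 0 sequentially "e / 2"] \<open>0 < e\<close> eventually_sequentially by fastforce
    obtain \<psi> where \<psi>: "test_function \<Omega> \<psi>" "L2_norm_on \<Omega> (\<lambda>x. U i x - \<psi> x) < e / 2"
      using seq.IH U \<open>0 < e\<close> by (metis half_gt_zero)
    have "L2_norm_on \<Omega> (\<lambda>x. (f x - U i x) + (U i x - \<psi> x)) \<le> L2_norm_on \<Omega> (\<lambda>x. f x - U i x) + L2_norm_on \<Omega> (\<lambda>x. U i x - \<psi> x)"
      by (intro L2_norm_on_triangle L2_on_diff L2 U L2_on_test_function[OF \<psi>(1) \<Omega>'])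
    then have "L2_norm_on \<Omega> (\<lambda>x. f x - \<psi> x) < e"
      using i \<psi>(2) by simp
    with \<psi>(1) show "\<exists>\<psi>. test_function \<Omega> \<psi> \<and> L2_norm_on \<Omega> (\<lambda>x. f x - \<psi> x) < e" by blast
  qed
qed

text \<open>\<open>p 1\<close> and \<open>p (-1)\<close> are the positive and negative parts of
  \<open>f\<close>; each is approximated within \<open>e / 2\<close>.\<close>

lemma test_functions_dense:
  fixes f :: "'a::euclidean_space \<Rightarrow> real"
  assumes \<Omega>: "open \<Omega>" "bounded \<Omega>" and f: "L2_on \<Omega> f" and "0 < e"
  obtains \<psi> where "test_function \<Omega> \<psi>" "L2_norm_on \<Omega> (\<lambda>x. f x - \<psi> x) < e"
proof -
  have \<Omega>': "\<Omega> \<in> lmeasurable" using \<Omega> by (simp add: bounded_set_imp_lmeasurable lmeasurable_open)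
  have m: "f \<in> borel_measurable (lebesgue_on \<Omega>)" using f by (simp add: L2_on_def)
  define p where "p s x = max 0 (s * f x)" for s x
  have pm: "p s \<in> borel_measurable (lebesgue_on \<Omega>)" for s
    unfolding p_def using m by measurable
  have p: "L2_on \<Omega> (p 1)" "L2_on \<Omega> (p (-1))"
    by (auto intro!: L2_on_subset_bound[OF f] pm) (auto simp: p_def)
  have d: "\<exists>\<psi>. test_function \<Omega> \<psi> \<and> L2_norm_on \<Omega> (\<lambda>x. p s x - \<psi> x) < e / 2" if "L2_on \<Omega> (p s)" for s
  proof -
    have "\<forall>e>0. \<exists>\<psi>. test_function \<Omega> \<psi> \<and> L2_norm_on \<Omega> (\<lambda>x. p s x - \<psi> x) < e"
      using test_functions_dense_nonneg[OF \<Omega> pm] that by (auto simp: p_def)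
    then show ?thesis using half_gt_zero[OF \<open>0 < e\<close>] by blast
  qed
  obtain \<psi> \<theta> where \<psi>: "test_function \<Omega> \<psi>" "L2_norm_on \<Omega> (\<lambda>x. p 1 x - \<psi> x) < e / 2"
    and \<theta>: "test_function \<Omega> \<theta>" "L2_norm_on \<Omega> (\<lambda>x. p (-1) x - \<theta> x) < e / 2"
    using d p by meson
  have "L2_norm_on \<Omega> (\<lambda>x. (p 1 x - \<psi> x) + (-1) *\<^sub>R (p (-1) x - \<theta> x)) \<le>
      L2_norm_on \<Omega> (\<lambda>x. p 1 x - \<psi> x) + L2_norm_on \<Omega> (\<lambda>x. (-1) *\<^sub>R (p (-1) x - \<theta> x))"
  proof (rule L2_norm_on_triangle)
    show "L2_on \<Omega> (\<lambda>x. (-1) *\<^sub>R (p (-1) x - \<theta> x))"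
      using L2_on_diff[OF L2_on_test_function(1)[OF \<theta>(1) \<Omega>'] p(2)] by simp
  qed (intro L2_on_diff p L2_on_test_function[OF \<psi>(1) \<Omega>'])
  then have "L2_norm_on \<Omega> (\<lambda>x. (p 1 x - \<psi> x) + (-1) *\<^sub>R (p (-1) x - \<theta> x)) < e"
    unfolding L2_norm_on_cmult using \<psi>(2) \<theta>(2) by simp
  moreover have "(p 1 x - \<psi> x) + (-1) *\<^sub>R (p (-1) x - \<theta> x) = f x - (\<psi> x - \<theta> x)" for x
    by (auto simp: p_def max_def)
  ultimately show thesis
    using that[OF test_function_diff[OF \<psi>(1) \<theta>(1)]] by (simp only:)
qed

text \<open>Choose a test function closer to \<open>f\<close> than the norm of \<open>f\<close>.
  Orthogonality makes the squared norm equal to the inner product of \<open>f\<close> with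
  \<open>f - \<psi>\<close>, and Cauchy-Schwarz then contradicts a positive norm.\<close>

lemma AE_zero_of_test_functions:
  fixes f :: "'a::euclidean_space \<Rightarrow> real"
  assumes \<Omega>: "open \<Omega>" "bounded \<Omega>" and f: "L2_on \<Omega> f"
    and zero: "\<And>\<psi>. test_function \<Omega> \<psi> \<Longrightarrow> (LINT x|lebesgue_on \<Omega>. f x * \<psi> x) = 0"
  shows "AE x in lebesgue_on \<Omega>. f x = 0"
proof (rule L2_norm_on_eq_0[OF f], rule ccontr)
  have \<Omega>': "\<Omega> \<in> lmeasurable" using \<Omega> by (simp add: bounded_set_imp_lmeasurable lmeasurable_open)
  assume "L2_norm_on \<Omega> f \<noteq> 0"
  then have pos: "0 < L2_norm_on \<Omega> f" using L2_norm_on_nonneg[of \<Omega> f] by linarith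
  then obtain \<psi> where \<psi>: "test_function \<Omega> \<psi>" "L2_norm_on \<Omega> (\<lambda>x. f x - \<psi> x) < L2_norm_on \<Omega> f"
    using test_functions_dense[OF \<Omega> f] by metis
  note L2 = L2_on_test_function(1)[OF \<psi>(1) \<Omega>']
  have "L2_inner \<Omega> f (\<lambda>x. f x + (-1) *\<^sub>R \<psi> x) = L2_inner \<Omega> f f"
    using L2_inner_lincomb_right[OF f f L2, of "-1"] zero[OF \<psi>(1)] by (simp add: L2_inner_def)
  then have "L2_norm_on \<Omega> f * L2_norm_on \<Omega> f \<le> L2_norm_on \<Omega> f * L2_norm_on \<Omega> (\<lambda>x. f x - \<psi> x)"
    using L2_Cauchy_Schwarz[OF f L2_on_diff[OF f L2]] L2_norm_on_square[of \<Omega> f]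
    by (simp add: power2_eq_square)
  with \<psi>(2) pos show False by simp
qed

lemma norm_square_component_le:
  "b \<in> Basis \<Longrightarrow> (norm (x \<bullet> b))\<^sup>2 \<le> (norm x)\<^sup>2"
  using power_mono[OF Basis_le_norm abs_ge_zero, of b x 2] by simp

lemma L2_on_component:
  fixes h :: "'a::euclidean_space \<Rightarrow> 'b::euclidean_space"
  assumes h: "L2_on \<Omega> h" and b: "b \<in> Basis"
  shows "L2_on \<Omega> (\<lambda>x. h x \<bullet> b)"
  unfolding L2_on_def
proof
  show m: "(\<lambda>x. h x \<bullet> b) \<in> borel_measurable (lebesgue_on \<Omega>)"
    using h by (auto simp: L2_on_def)
  show "integrable (lebesgue_on \<Omega>) (\<lambda>x. (norm (h x \<bullet> b))\<^sup>2)"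
  proof (rule Bochner_Integration.integrable_bound)
    show "integrable (lebesgue_on \<Omega>) (\<lambda>x. (norm (h x))\<^sup>2)"
      using h by (simp add: L2_on_def)
    show "AE x in lebesgue_on \<Omega>. norm ((norm (h x \<bullet> b))\<^sup>2) \<le> norm ((norm (h x))\<^sup>2)"
      using norm_square_component_le[OF b] by (intro AE_I2) simp
  qed (use m in measurable)
qed

lemma L2_norm_on_component_le:
  assumes "L2_on \<Omega> h" "b \<in> Basis"
  shows "L2_norm_on \<Omega> (\<lambda>x. h x \<bullet> b) \<le> L2_norm_on \<Omega> h"
  unfolding L2_norm_on_def
  using assms L2_on_component[OF assms] norm_square_component_le[OF assms(2)]
  by (intro real_sqrt_le_mono integral_mono) (auto simp: L2_on_def)

text \<open>Each coordinate of the difference is orthogonal to all test functions. This makes the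
  choice in \<open>wgrad\<close> harmless.\<close>

lemma weak_gradient_unique:
  assumes \<Omega>: "open \<Omega>" "bounded \<Omega>" and "L2_on \<Omega> g" "L2_on \<Omega> g'" "weak_gradient_on \<Omega> u g" "weak_gradient_on \<Omega> u g'"
  shows "AE x in lebesgue_on \<Omega>. g x = g' x"
proof -
  have \<Omega>': "\<Omega> \<in> lmeasurable" using \<Omega> by (simp add: bounded_set_imp_lmeasurable lmeasurable_open)
  have L2: "L2_on \<Omega> (\<lambda>x. g x - g' x)" using assms by (intro L2_on_diff)
  have "AE x in lebesgue_on \<Omega>. (g x - g' x) \<bullet> b = 0" if b: "b \<in> Basis" for b
  proof (rule AE_zero_of_test_functions[OF \<Omega>])
    show "L2_on \<Omega> (\<lambda>x. (g x - g' x) \<bullet> b)" by (rule L2_on_component[OF L2 b])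
    fix \<psi> assume \<psi>: "test_function \<Omega> \<psi>"
    note i = L2_on_integrable_inner[OF L2_on_component[OF _ b] L2_on_test_function(1)[OF \<psi> \<Omega>'], simplified]
    have "(LINT x|lebesgue_on \<Omega>. (g x \<bullet> b) * \<psi> x) = (LINT x|lebesgue_on \<Omega>. (g' x \<bullet> b) * \<psi> x)"
      using assms(5)[unfolded weak_gradient_on_def, rule_format, OF \<psi> b]
        assms(6)[unfolded weak_gradient_on_def, rule_format, OF \<psi> b] by linarith
    then show "(LINT x|lebesgue_on \<Omega>. (g x - g' x) \<bullet> b * \<psi> x) = 0"
      using i[OF assms(3)] i[OF assms(4)] by (simp add: inner_diff_left left_diff_distrib)
  qed
  then have "AE x in lebesgue_on \<Omega>. \<forall>b\<in>Basis. (g x - g' x) \<bullet> b = 0"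
    by (subst AE_ball_countable) (auto simp: countable_finite)
  then show ?thesis
  proof eventually_elim
    case (elim x)
    then have "g x - g' x = 0"
      unfolding euclidean_all_zero_iff .
    then show ?case by simp
  qed
qed

lemma bounded_open_lmeasurable: "open \<Omega> \<Longrightarrow> bounded \<Omega> \<Longrightarrow> \<Omega> \<in> lmeasurable"
  by (simp add: bounded_set_imp_lmeasurable lmeasurable_open)

section \<open>Weak gradients and minimizers\<close>

text \<open>Lets the proofs work with any convenient weak gradient \<open>g\<close> while the
  definitions of \<open>H1_norm\<close> and \<open>J\<close> refer to the chosen one.\<close>

lemma wgrad_props:
  assumes "open \<Omega>" "bounded \<Omega>" "L2_on \<Omega> g" "weak_gradient_on \<Omega> u g"
  shows "L2_on \<Omega> (wgrad \<Omega> u)" "weak_gradient_on \<Omega> u (wgrad \<Omega> u)" "AE x in lebesgue_on \<Omega>. wgrad \<Omega> u x = g x"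
proof -
  have "L2_on \<Omega> (wgrad \<Omega> u) \<and> weak_gradient_on \<Omega> u (wgrad \<Omega> u)"
    unfolding wgrad_def by (rule someI[of _ g]) (use assms in auto)
  then show "L2_on \<Omega> (wgrad \<Omega> u)" "weak_gradient_on \<Omega> u (wgrad \<Omega> u)" by auto
  then show "AE x in lebesgue_on \<Omega>. wgrad \<Omega> u x = g x"
    using assms by (intro weak_gradient_unique)
qed

lemma H1_norm_square:
  assumes "open \<Omega>" "bounded \<Omega>" "L2_on \<Omega> g" "weak_gradient_on \<Omega> u g"
  shows "(H1_norm \<Omega> u)\<^sup>2 = (L2_norm_on \<Omega> u)\<^sup>2 + (L2_norm_on \<Omega> g)\<^sup>2"
  using L2_norm_on_cong_AE[OF wgrad_props(1)[OF assms] assms(3) wgrad_props(3)[OF assms]]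
  by (simp add: H1_norm_def)

lemma weak_gradient_lincomb:
  assumes \<Omega>: "open \<Omega>" "bounded \<Omega>"
    and u: "L2_on \<Omega> u" "L2_on \<Omega> g" "weak_gradient_on \<Omega> u g"
    and v: "L2_on \<Omega> v" "L2_on \<Omega> h" "weak_gradient_on \<Omega> v h"
  shows "weak_gradient_on \<Omega> (\<lambda>x. u x + c * v x) (\<lambda>x. g x + c *\<^sub>R h x)"
  unfolding weak_gradient_on_def
proof (intro allI impI ballI)
  fix \<psi> b assume \<psi>: "test_function \<Omega> \<psi>" and b: "b \<in> (Basis :: 'a set)"
  note \<Omega>' = bounded_open_lmeasurable[OF \<Omega>]
  note i1 = L2_on_integrable_inner[OF _ L2_on_test_function(1)[OF test_function_grad_inner[OF \<psi> b] \<Omega>'],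
      simplified grad_inner[OF b], simplified]
  note i2 = L2_on_integrable_inner[OF _ L2_on_test_function(1)[OF \<psi> \<Omega>'], simplified]
  show "(LINT x|lebesgue_on \<Omega>. (u x + c * v x) * frechet_derivative \<psi> (at x) b) =
      - (LINT x|lebesgue_on \<Omega>. (g x + c *\<^sub>R h x) \<bullet> b * \<psi> x)"
    using i1[OF u(1)] i1[OF v(1)] i2[OF L2_on_component[OF u(2) b]] i2[OF L2_on_component[OF v(2) b]]
      u(3)[unfolded weak_gradient_on_def, rule_format, OF \<psi> b]
      v(3)[unfolded weak_gradient_on_def, rule_format, OF \<psi> b]
    by (simp add: distrib_right inner_add_left mult.assoc)
qed

lemma H1_norm_zero:
  assumes "open \<Omega>" "bounded (\<Omega> :: 'a::euclidean_space set)"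
  shows "H1_norm \<Omega> (\<lambda>x. 0) = 0"
proof -
  have "(H1_norm \<Omega> (\<lambda>x. 0))\<^sup>2 = (L2_norm_on \<Omega> (\<lambda>x. 0::real))\<^sup>2 + (L2_norm_on \<Omega> (\<lambda>x. 0 :: 'a))\<^sup>2"
    by (rule H1_norm_square[OF assms]) (auto simp: L2_on_def weak_gradient_on_def)
  then show ?thesis by (simp add: L2_norm_on_def)
qed

lemma H10_test_function:
  assumes "open \<Omega>" "bounded \<Omega>" and \<psi>: "test_function \<Omega> \<psi>"
  shows "H10 \<Omega> \<psi>"
  unfolding H10_def H1_def
  using L2_on_test_function[OF \<psi> bounded_open_lmeasurable[OF assms(1,2)]]
    test_function_weak_gradient[OF \<psi> assms(1)] H1_norm_zero[OF assms(1,2)] \<psi>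
  by (auto intro!: exI[of _ \<psi>])

text \<open>The boundary condition is stated for \<open>u - \<phi>\<close>, but
  \<open>local_minimizer\<close> admits \<open>\<phi>\<close> as competitor only through
  \<open>\<phi> - u\<close>.\<close>

lemma H10_minus:
  fixes f :: "'a::euclidean_space \<Rightarrow> real"
  assumes \<Omega>: "open \<Omega>" "bounded \<Omega>" and "H10 \<Omega> f"
  shows "H10 \<Omega> (\<lambda>x. - f x)"
proof -
  note \<Omega>' = bounded_open_lmeasurable[OF \<Omega>]
  have zero: "L2_on \<Omega> (\<lambda>x. 0 :: real)" "L2_on \<Omega> (\<lambda>x. 0 :: 'a)"
    by (simp_all add: L2_on_def)
  have wzero: "weak_gradient_on \<Omega> (\<lambda>x. 0) (\<lambda>x. 0)"
    by (simp add: weak_gradient_on_def)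
  obtain g where f: "L2_on \<Omega> f" and g: "L2_on \<Omega> g" "weak_gradient_on \<Omega> f g"
    using assms(3) by (auto simp: H10_def H1_def)
  have wm: "weak_gradient_on \<Omega> (\<lambda>x. - p x) (\<lambda>x. - q x)" and Lm: "L2_on \<Omega> (\<lambda>x. - p x)" "L2_on \<Omega> (\<lambda>x. - q x)"
    if "L2_on \<Omega> p" "L2_on \<Omega> q" "weak_gradient_on \<Omega> p q" for p q
    using weak_gradient_lincomb[OF \<Omega> zero wzero that, of "-1"]
      L2_on_lincomb[OF zero(1) that(1), of "-1"] L2_on_lincomb[OF zero(2) that(2), of "-1"] by simp_all
  show ?thesis
    unfolding H10_def H1_def
  proof (intro conjI allI impI)
    show "L2_on \<Omega> (\<lambda>x. - f x)" "\<exists>g. L2_on \<Omega> g \<and> weak_gradient_on \<Omega> (\<lambda>x. - f x) g"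
      using Lm[OF f g] wm[OF f g] by auto
    fix \<epsilon> :: real assume "0 < \<epsilon>"
    then obtain \<psi> where \<psi>: "test_function \<Omega> \<psi>" "H1_norm \<Omega> (\<lambda>x. f x - \<psi> x) < \<epsilon>"
      using assms(3) by (auto simp: H10_def)
    define q where "q x = g x - grad \<psi> x" for x
    have q: "L2_on \<Omega> (\<lambda>x. f x - \<psi> x)" "L2_on \<Omega> q" "weak_gradient_on \<Omega> (\<lambda>x. f x - \<psi> x) q"
      using weak_gradient_lincomb[OF \<Omega> f g L2_on_test_function[OF \<psi>(1) \<Omega>'] test_function_weak_gradient[OF \<psi>(1) \<Omega>(1)], of "-1"]
      by (auto simp: q_def[abs_def] intro!: L2_on_diff f g L2_on_test_function[OF \<psi>(1) \<Omega>'])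
    have "(H1_norm \<Omega> (\<lambda>x. - (f x - \<psi> x)))\<^sup>2 = (H1_norm \<Omega> (\<lambda>x. f x - \<psi> x))\<^sup>2"
      unfolding H1_norm_square[OF \<Omega> Lm(2)[OF q] wm[OF q]] H1_norm_square[OF \<Omega> q(2,3)]
      by (simp add: L2_norm_on_def power2_commute[of "\<psi> _"])
    then have "H1_norm \<Omega> (\<lambda>x. - (f x - \<psi> x)) = H1_norm \<Omega> (\<lambda>x. f x - \<psi> x)"
      by (simp add: H1_norm_def)
    then show "\<exists>\<psi>. test_function \<Omega> \<psi> \<and> H1_norm \<Omega> (\<lambda>x. - f x - \<psi> x) < \<epsilon>"
      using \<psi> test_function_cmult[OF \<psi>(1), of "-1"] by (intro exI[of _ "\<lambda>x. - \<psi> x"]) simp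
  qed
qed

section \<open>The energy and its comparison inequalities\<close>

lemma integrable_bounded_comp:
  fixes \<sigma> :: "real \<Rightarrow> real"
  assumes "\<Omega> \<in> lmeasurable" "\<sigma> \<in> borel_measurable borel" "\<And>t. \<bar>\<sigma> t\<bar> \<le> M" "L2_on \<Omega> v"
  shows "integrable (lebesgue_on \<Omega>) (\<lambda>x. \<sigma> (v x))"
proof -
  have "finite_measure (lebesgue_on \<Omega>)"
    using assms(1) by (simp add: finite_measure_lebesgue_on)
  moreover have "(\<lambda>x. \<sigma> (v x)) \<in> borel_measurable (lebesgue_on \<Omega>)"
    using measurable_compose[OF _ assms(2), of v] assms(4) by (simp add: L2_on_def)
  ultimately show ?thesis
    using assms(3) by (intro finite_measure.integrable_const_bound[where B=M]) auto
qed

text \<open>On a bounded domain the bounded \<open>\<sigma>\<close> contributes an integrable term,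
  so the energy splits and its Dirichlet part can be computed with any weak gradient.\<close>

lemma J_eq:
  fixes \<sigma> :: "real \<Rightarrow> real"
  assumes \<Omega>: "open \<Omega>" "bounded \<Omega>" and \<sigma>: "\<sigma> \<in> borel_measurable borel" "\<And>t. \<bar>\<sigma> t\<bar> \<le> M"
    and v: "L2_on \<Omega> v" "L2_on \<Omega> g" "weak_gradient_on \<Omega> v g"
  shows "J \<sigma> v \<Omega> = 1/2 * (L2_norm_on \<Omega> g)\<^sup>2 + (LINT x|lebesgue_on \<Omega>. \<sigma> (v x))"
proof -
  note w = wgrad_props[OF \<Omega> v(2,3)]
  have "J \<sigma> v \<Omega> = (LINT x|lebesgue_on \<Omega>. 1/2 * (norm (wgrad \<Omega> v x))\<^sup>2) + (LINT x|lebesgue_on \<Omega>. \<sigma> (v x))"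
    unfolding J_def using w(1) integrable_bounded_comp[OF bounded_open_lmeasurable[OF \<Omega>] \<sigma> v(1)]
    by (intro Bochner_Integration.integral_add) (auto simp: L2_on_def)
  also have "(LINT x|lebesgue_on \<Omega>. 1/2 * (norm (wgrad \<Omega> v x))\<^sup>2) = 1/2 * (L2_norm_on \<Omega> (wgrad \<Omega> v))\<^sup>2"
    by (simp add: L2_norm_on_def)
  finally show ?thesis
    using L2_norm_on_cong_AE[OF w(1) v(2) w(3)] by simp
qed

text \<open>If \<open>f\<close> is not integrable its integral is 0 by convention, and the bound
  still holds since the right-hand side is nonnegative; hence \<open>integral_mono'\<close>.\<close>

lemma integral_lebesgue_on_indicator_le:
  assumes "\<Omega> \<in> sets lebesgue" "A \<in> lmeasurable" "0 \<le> c"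
    and "f \<in> borel_measurable (lebesgue_on \<Omega>)" "\<And>x. x \<in> \<Omega> \<Longrightarrow> f x \<le> c * indicator A x"
  shows "(LINT x|lebesgue_on \<Omega>. f x) \<le> c * measure lebesgue A"
proof -
  have i: "integrable lebesgue (\<lambda>x. c * indicator A x :: real)"
    using assms(2) by (intro integrable_mult_right) (auto simp: fmeasurable_def)
  have j: "integrable (lebesgue_on \<Omega>) (\<lambda>x. c * indicator A x :: real)"
  proof (rule integrable_restrict_space[THEN iffD2])
    show "integrable lebesgue (\<lambda>x. indicator \<Omega> x *\<^sub>R (c * indicator A x) :: real)"
      by (rule integrable_mult_indicator[OF assms(1) i])
  qed (use assms(1) in simp)
  have "(LINT x|lebesgue_on \<Omega>. f x) \<le> (LINT x|lebesgue_on \<Omega>. c * indicator A x)"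
    using assms(3,5) by (intro integral_mono'[OF j]) auto
  also have "\<dots> = (LINT x|lebesgue. indicator \<Omega> x *\<^sub>R (c * indicator A x))"
    by (rule integral_restrict_space) (use assms(1) in simp)
  also have "\<dots> \<le> (LINT x|lebesgue. c * indicator A x)"
    using assms(3) by (intro integral_mono[OF integrable_mult_indicator[OF assms(1) i] i]) (auto simp: indicator_def)
  also have "\<dots> = c * measure lebesgue A"
    using assms(2) by simp
  finally show ?thesis .
qed

text \<open>Comparison with \<open>u \<plusminus> \<psi> / Q\<close>: the boundedness of \<open>\<sigma>\<close> makes \<open>u\<close> weakly harmonic up to
  an error controlled by the size of the support of the test function.\<close>

lemma local_minimizer_almost_harmonic:
  fixes u :: "'a::euclidean_space \<Rightarrow> real"
  assumes min: "local_minimizer \<sigma> u" and \<sigma>: "\<sigma> \<in> borel_measurable borel" "\<And>t. \<bar>\<sigma> t\<bar> \<le> M"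
    and g: "L2_on (ball 0 1) g" "weak_gradient_on (ball 0 1) u g"
    and \<psi>: "test_function (ball 0 1) \<psi>" "A \<in> lmeasurable" "\<And>x. x \<notin> A \<Longrightarrow> \<psi> x = 0" "\<And>x. x \<notin> A \<Longrightarrow> grad \<psi> x = 0"
    and Q: "0 < Q" "\<And>x. norm (grad \<psi> x) \<le> Q"
  shows "\<bar>L2_inner (ball 0 1) g (grad \<psi>)\<bar> \<le> (1/2 + 2 * M) * Q * measure lebesgue A"
proof -
  define B :: "'a set" where "B = ball 0 1"
  have B: "open B" "bounded B" by (auto simp: B_def)
  have B': "B \<in> lmeasurable" "B \<in> sets lebesgue" using bounded_open_lmeasurable[OF B] by auto
  define m where "m = measure lebesgue A"
  have u: "L2_on B u" using min by (simp add: local_minimizer_def H1_def B_def)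
  note g = g[folded B_def] and \<psi> = \<psi>[folded B_def]
  note L2\<psi> = L2_on_test_function[OF \<psi>(1) B'(1)]
  have M: "0 \<le> M" using \<sigma>(2)[of 0] by linarith
  \<comment> \<open>Minimality against \<open>u + s \<psi>\<close>, with both signs of
    \<open>s\<close> available. The two \<open>\<sigma>\<close> terms agree off \<open>A\<close> and
    differ by at most \<open>2 * M\<close> on it.\<close>
  have var: "0 \<le> s * L2_inner B g (grad \<psi>) + 1/2 * s\<^sup>2 * (L2_norm_on B (grad \<psi>))\<^sup>2 + 2 * M * m" for s
  proof -
    define v where "v x = u x + s * \<psi> x" for x
    define h where "h x = g x + s *\<^sub>R grad \<psi> x" for x
    have v: "L2_on B v" and h: "L2_on B h"
      unfolding v_def[abs_def] h_def[abs_def] using L2_on_lincomb[OF u L2\<psi>(1), of s] L2_on_lincomb[OF g(1) L2\<psi>(2), of s] by simp_all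
    have vh: "weak_gradient_on B v h"
      unfolding v_def[abs_def] h_def[abs_def]
      by (intro weak_gradient_lincomb B u g L2\<psi> test_function_weak_gradient[OF \<psi>(1)])
    have "H10 B (\<lambda>x. v x - u x)"
      using H10_test_function[OF B test_function_cmult[OF \<psi>(1), of s]] by (simp add: v_def[abs_def])
    then have "J \<sigma> u B \<le> J \<sigma> v B"
      using min v h vh B unfolding local_minimizer_def by (auto simp: H1_def B_def)
    then have "1/2 * (L2_norm_on B g)\<^sup>2 + (LINT x|lebesgue_on B. \<sigma> (u x)) \<le>
        1/2 * (L2_norm_on B h)\<^sup>2 + (LINT x|lebesgue_on B. \<sigma> (v x))"
      by (simp add: J_eq[OF B \<sigma> u g] J_eq[OF B \<sigma> v h vh])
    moreover have "(L2_norm_on B h)\<^sup>2 = (L2_norm_on B g)\<^sup>2 + 2 * s * L2_inner B g (grad \<psi>) + s\<^sup>2 * (L2_norm_on B (grad \<psi>))\<^sup>2"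
      unfolding h_def[abs_def] by (rule L2_norm_on_square_lincomb[OF g(1) L2\<psi>(2)])
    moreover have "(LINT x|lebesgue_on B. \<sigma> (v x)) - (LINT x|lebesgue_on B. \<sigma> (u x)) \<le> 2 * M * m"
    proof -
      note i = integrable_bounded_comp[OF B'(1) \<sigma>]
      have "(LINT x|lebesgue_on B. \<sigma> (v x)) - (LINT x|lebesgue_on B. \<sigma> (u x)) = (LINT x|lebesgue_on B. \<sigma> (v x) - \<sigma> (u x))"
        using i[OF v] i[OF u] by simp
      also have "\<dots> \<le> 2 * M * m"
        unfolding m_def
      proof (rule integral_lebesgue_on_indicator_le[OF B'(2) \<psi>(2)])
        show "(\<lambda>x. \<sigma> (v x) - \<sigma> (u x)) \<in> borel_measurable (lebesgue_on B)"
          using i[OF v] i[OF u] by simp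
        fix x
        have "\<sigma> (v x) - \<sigma> (u x) \<le> 2 * M" using \<sigma>(2)[of "v x"] \<sigma>(2)[of "u x"] by linarith
        then show "\<sigma> (v x) - \<sigma> (u x) \<le> 2 * M * indicator A x"
          using \<psi>(3)[of x] by (cases "x \<in> A") (auto simp: v_def)
      qed (use M in simp)
      finally show ?thesis .
    qed
    ultimately show ?thesis by argo
  qed
  have Q2: "(L2_norm_on B (grad \<psi>))\<^sup>2 \<le> Q\<^sup>2 * m"
  proof -
    have "(L2_norm_on B (grad \<psi>))\<^sup>2 = (LINT x|lebesgue_on B. (norm (grad \<psi> x))\<^sup>2)"
      by (simp add: L2_norm_on_def)
    also have "\<dots> \<le> Q\<^sup>2 * m"
      unfolding m_def
    proof (rule integral_lebesgue_on_indicator_le[OF B'(2) \<psi>(2)])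
      show "(\<lambda>x. (norm (grad \<psi> x))\<^sup>2) \<in> borel_measurable (lebesgue_on B)"
        using L2\<psi>(2) unfolding L2_on_def by (intro borel_measurable_integrable) simp
      show "(norm (grad \<psi> x))\<^sup>2 \<le> Q\<^sup>2 * indicator A x" for x
        using \<psi>(4)[of x] power_mono[OF Q(2)[of x] norm_ge_zero, of 2] by (cases "x \<in> A") auto
    qed simp
    finally show ?thesis .
  qed
  \<comment> \<open>Now \<open>s\<close> is a sign and the displacement is \<open>s / Q\<close>. At
    this size the quadratic Dirichlet term is at most half of \<open>m\<close>, of the same order as
    the loss in \<open>\<sigma>\<close>.\<close>
  have "0 \<le> s * Q * L2_inner B g (grad \<psi>) + (1/2 + 2 * M) * Q\<^sup>2 * m" if "s\<^sup>2 = 1" for s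
  proof -
    have "0 \<le> Q\<^sup>2 * (s / Q * L2_inner B g (grad \<psi>) + 1/2 * (s / Q)\<^sup>2 * (L2_norm_on B (grad \<psi>))\<^sup>2 + 2 * M * m)"
      using var[of "s / Q"] by (intro mult_nonneg_nonneg) auto
    also have "\<dots> = s * Q * L2_inner B g (grad \<psi>) + 1/2 * (L2_norm_on B (grad \<psi>))\<^sup>2 + 2 * M * Q\<^sup>2 * m"
      using Q(1) that by (simp add: power_divide field_simps power2_eq_square)
    finally show ?thesis using Q2 by (simp add: algebra_simps)
  qed
  from this[of 1] this[of "-1"]
  have "Q * \<bar>L2_inner B g (grad \<psi>)\<bar> \<le> Q * ((1/2 + 2 * M) * Q * m)"
    by (simp add: power2_eq_square mult_ac abs_if)
  then show ?thesis using Q(1) by (simp add: B_def m_def)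
qed

text \<open>The competitor is \<open>\<phi>\<close>. Each of the two \<open>\<sigma>\<close>
  integrals is at most \<open>M\<close> times the volume in absolute value, and clearing the factor
  1/2 of the Dirichlet term turns \<open>2 * M\<close> into \<open>4 * M\<close>.\<close>

lemma local_minimizer_gradient_bound:
  fixes u :: "'a::euclidean_space \<Rightarrow> real"
  assumes min: "local_minimizer \<sigma> u" and \<sigma>: "\<sigma> \<in> borel_measurable borel" "\<And>t. \<bar>\<sigma> t\<bar> \<le> M"
    and g: "L2_on (ball 0 1) g" "weak_gradient_on (ball 0 1) u g"
    and \<phi>: "L2_on (ball 0 1) \<phi>" "L2_on (ball 0 1) G" "weak_gradient_on (ball 0 1) \<phi> G"
    and diff: "H10 (ball 0 1) (\<lambda>x. u x - \<phi> x)"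
  shows "(L2_norm_on (ball 0 1) g)\<^sup>2 \<le> (L2_norm_on (ball 0 1) G)\<^sup>2 + 4 * M * measure lebesgue (ball (0::'a) 1)"
proof -
  define B :: "'a set" where "B = ball 0 1"
  have B: "open B" "bounded B" by (auto simp: B_def)
  have B': "B \<in> lmeasurable" "B \<in> sets lebesgue" using bounded_open_lmeasurable[OF B] by auto
  have u: "L2_on B u" using min by (simp add: local_minimizer_def H1_def B_def)
  note g = g[folded B_def] and \<phi> = \<phi>[folded B_def]
  have M: "0 \<le> M" using \<sigma>(2)[of 0] by linarith
  have "H10 B (\<lambda>x. \<phi> x - u x)"
    using H10_minus[OF B diff[folded B_def]] by simp
  then have "J \<sigma> u B \<le> J \<sigma> \<phi> B"
    using min \<phi> B unfolding local_minimizer_def by (auto simp: H1_def B_def)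
  then have "1/2 * (L2_norm_on B g)\<^sup>2 + (LINT x|lebesgue_on B. \<sigma> (u x)) \<le>
      1/2 * (L2_norm_on B G)\<^sup>2 + (LINT x|lebesgue_on B. \<sigma> (\<phi> x))"
    by (simp add: J_eq[OF B \<sigma> u g] J_eq[OF B \<sigma> \<phi>])
  \<comment> \<open>The sign \<open>s\<close> covers the lower bound for \<open>u\<close> and the
    upper bound for \<open>\<phi>\<close> in one claim.\<close>
  moreover have "(LINT x|lebesgue_on B. s * \<sigma> (v x)) \<le> M * measure lebesgue B" if "L2_on B v" "\<bar>s\<bar> = 1" for v s
  proof (rule integral_lebesgue_on_indicator_le[OF B'(2,1)])
    show "(\<lambda>x. s * \<sigma> (v x)) \<in> borel_measurable (lebesgue_on B)"
      using integrable_bounded_comp[OF B'(1) \<sigma> that(1)] by simp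
    show "s * \<sigma> (v x) \<le> M * indicator B x" if "x \<in> B" for x
      using \<sigma>(2)[of "v x"] \<open>\<bar>s\<bar> = 1\<close> that by (auto simp: abs_if split: if_splits)
  qed (fact M)
  from this[OF u, of "-1"] this[OF \<phi>(1), of 1]
  have "- (LINT x|lebesgue_on B. \<sigma> (u x)) \<le> M * measure lebesgue B" "(LINT x|lebesgue_on B. \<sigma> (\<phi> x)) \<le> M * measure lebesgue B"
    by simp_all
  ultimately show ?thesis by (simp add: B_def)
qed

text \<open>Pairing a function with its weak gradient turns H1 geometry into L2 geometry, so the
  expansion of squares and Cauchy-Schwarz need no second version.\<close>

lemma L2_on_Pair:
  assumes "L2_on \<Omega> u" "L2_on \<Omega> g"
  shows "L2_on \<Omega> (\<lambda>x. (u x, g x))"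
  using assms by (auto simp: L2_on_def norm_Pair)

lemma L2_inner_Pair:
  assumes "L2_on \<Omega> u" "L2_on \<Omega> g" "L2_on \<Omega> v" "L2_on \<Omega> h"
  shows "L2_inner \<Omega> (\<lambda>x. (u x, g x)) (\<lambda>x. (v x, h x)) = L2_inner \<Omega> u v + L2_inner \<Omega> g h"
  unfolding L2_inner_def inner_Pair using assms by (intro Bochner_Integration.integral_add L2_on_integrable_inner)

lemma L2_norm_on_Pair:
  assumes "L2_on \<Omega> u" "L2_on \<Omega> g"
  shows "(L2_norm_on \<Omega> (\<lambda>x. (u x, g x)))\<^sup>2 = (L2_norm_on \<Omega> u)\<^sup>2 + (L2_norm_on \<Omega> g)\<^sup>2"
  unfolding L2_norm_on_square using assms by (intro L2_inner_Pair)

section \<open>Lower bound for the \<open>L2\<close> norm\<close>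

text \<open>If \<open>h\<close> is the difference of \<open>\<phi>\<close> and an almost nearest test function, then \<open>h\<close> is almost
  orthogonal in \<open>H1\<close> to test functions, so its \<open>H1\<close> inner product with \<open>u\<close> is bounded below.
  Approximating the gradient of \<open>h\<close> by test fields, the inner product is controlled by the
  \<open>L2\<close> norm of \<open>u\<close> alone.\<close>

lemma L2_norm_lower_bound:
  fixes \<phi> :: "'a::euclidean_space \<Rightarrow> real"
  assumes \<Omega>: "open \<Omega>" "bounded \<Omega>" and \<phi>: "H1 \<Omega> \<phi>" "\<not> H10 \<Omega> \<phi>" and K: "0 \<le> K"
  obtains c where "0 < c" "\<And>u g. L2_on \<Omega> u \<Longrightarrow> L2_on \<Omega> g \<Longrightarrow> weak_gradient_on \<Omega> u g \<Longrightarrow>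
    L2_norm_on \<Omega> g \<le> K \<Longrightarrow> H10 \<Omega> (\<lambda>x. u x - \<phi> x) \<Longrightarrow> c \<le> L2_norm_on \<Omega> u"
proof -
  note \<Omega>' = bounded_open_lmeasurable[OF \<Omega>]
  obtain G where L2\<phi>: "L2_on \<Omega> \<phi>" and G: "L2_on \<Omega> G" "weak_gradient_on \<Omega> \<phi> G"
    using \<phi>(1) by (auto simp: H1_def)
  obtain \<epsilon>0 where \<epsilon>0: "0 < \<epsilon>0" "\<And>\<psi>. test_function \<Omega> \<psi> \<Longrightarrow> \<epsilon>0 \<le> H1_norm \<Omega> (\<lambda>x. \<phi> x - \<psi> x)"
    using \<phi> by (auto simp: H10_def not_less)
  define P where "P \<psi> x = (\<phi> x - \<psi> x, G x - grad \<psi> x)" for \<psi> x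
  have comps: "L2_on \<Omega> (\<lambda>x. \<phi> x - \<psi> x)" "L2_on \<Omega> (\<lambda>x. G x - grad \<psi> x)"
    "weak_gradient_on \<Omega> (\<lambda>x. \<phi> x - \<psi> x) (\<lambda>x. G x - grad \<psi> x)" if "test_function \<Omega> \<psi>" for \<psi>
    using weak_gradient_lincomb[OF \<Omega> L2\<phi> G L2_on_test_function[OF that \<Omega>'] test_function_weak_gradient[OF that \<Omega>(1)], of "-1"]
    by (auto intro!: L2_on_diff L2\<phi> G L2_on_test_function[OF that \<Omega>'])
  have P: "L2_on \<Omega> (P \<psi>)" if "test_function \<Omega> \<psi>" for \<psi>
    unfolding P_def[abs_def] using comps[OF that] by (intro L2_on_Pair)
  define N where "N \<psi> = (L2_norm_on \<Omega> (P \<psi>))\<^sup>2" for \<psi>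
  have N: "\<epsilon>0\<^sup>2 \<le> N \<psi>" if "test_function \<Omega> \<psi>" for \<psi>
  proof -
    have "N \<psi> = (H1_norm \<Omega> (\<lambda>x. \<phi> x - \<psi> x))\<^sup>2"
      unfolding N_def P_def[abs_def] using comps[OF that] by (simp add: L2_norm_on_Pair H1_norm_square[OF \<Omega>])
    then show ?thesis using power_mono[OF \<epsilon>0(2)[OF that], of 2] \<epsilon>0(1) by simp
  qed
  \<comment> \<open>The squared H1 distance from \<open>\<phi>\<close> to the test functions,
    positive because \<open>\<phi>\<close> is not in \<open>H10\<close>.\<close>
  define m where "m = (INF \<psi>\<in>Collect (test_function \<Omega>). N \<psi>)"
  have ne: "Collect (test_function \<Omega>) \<noteq> {}" using test_function_zero by auto
  have bdd: "bdd_below (N ` Collect (test_function \<Omega>))" using N by (intro bdd_belowI2) auto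
  have m_le: "m \<le> N \<psi>" if "test_function \<Omega> \<psi>" for \<psi>
    unfolding m_def using bdd that by (intro cINF_lower) auto
  have "\<epsilon>0\<^sup>2 \<le> m" unfolding m_def using ne N by (intro cINF_greatest) auto
  then have m: "0 < m" using \<epsilon>0(1) by (meson less_le_trans zero_less_power)
  \<comment> \<open>Bounds the squared norm of \<open>z\<close> below: the pair
    \<open>(u, g)\<close> has norm at most \<open>sqrt (1 + K\<^sup>2)\<close> and its correction
    \<open>e\<close> has norm at most 1.\<close>
  define L where "L = (sqrt (1 + K\<^sup>2) + 1)\<^sup>2"
  have "0 < L" unfolding L_def by (intro zero_less_power add_nonneg_pos) auto
  \<comment> \<open>Step length of the move from \<open>h\<close> towards \<open>z\<close>, short
    enough that the second-order terms stay below the first-order gain.\<close>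
  define s where "s = m / (m + L) / 2"
  have s: "0 < s" "s \<le> 1/2" "s * (m + L) \<le> m"
    using m \<open>0 < L\<close> by (auto simp: s_def field_simps)
  \<comment> \<open>The infimum is approached within a slack proportional to \<open>s\<close>, so
    that dividing by \<open>s\<close> later still leaves a fixed part of \<open>m\<close>.\<close>
  have "m < m + s * m / 2" using s(1) m by simp
  then obtain \<psi>0 where \<psi>0: "test_function \<Omega> \<psi>0" "N \<psi>0 < m + s * m / 2"
    using cINF_less_iff[OF ne bdd, of "m + s * m / 2", folded m_def] by blast
  define h where "h = P \<psi>0"
  have h: "L2_on \<Omega> h" using P[OF \<psi>0(1)] by (simp add: h_def)
  define H where "H x = G x - grad \<psi>0 x" for x
  have H: "L2_on \<Omega> H" using comps[OF \<psi>0(1)] by (simp add: H_def[abs_def])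
  define \<epsilon> where "\<epsilon> = min 1 (m / (8 * (L2_norm_on \<Omega> h + 1)))"
  have h1: "0 < L2_norm_on \<Omega> h + 1" using L2_norm_on_nonneg[of \<Omega> h] by linarith
  have \<epsilon>: "0 < \<epsilon>" "\<epsilon> \<le> 1" "L2_norm_on \<Omega> h * \<epsilon> \<le> m / 8"
  proof -
    show "0 < \<epsilon>" "\<epsilon> \<le> 1" using m h1 by (auto simp: \<epsilon>_def)
    have "L2_norm_on \<Omega> h * \<epsilon> \<le> (L2_norm_on \<Omega> h + 1) * (m / (8 * (L2_norm_on \<Omega> h + 1)))"
      using m h1 L2_norm_on_nonneg[of \<Omega> h] \<open>0 < \<epsilon>\<close> by (intro mult_mono) (auto simp: \<epsilon>_def)
    also have "\<dots> = m / 8" using h1 by (simp add: divide_simps)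
    finally show "L2_norm_on \<Omega> h * \<epsilon> \<le> m / 8" .
  qed
  have lower: "m / 8 \<le> L2_inner \<Omega> h (\<lambda>x. (u x, g x))"
    if u: "L2_on \<Omega> u" and g: "L2_on \<Omega> g" "weak_gradient_on \<Omega> u g" and gK: "L2_norm_on \<Omega> g \<le> K"
      and d: "H10 \<Omega> (\<lambda>x. u x - \<phi> x)" and u1: "L2_norm_on \<Omega> u \<le> 1" for u g
  proof -
    obtain \<psi> where \<psi>: "test_function \<Omega> \<psi>" "H1_norm \<Omega> (\<lambda>x. u x - \<phi> x - \<psi> x) < \<epsilon>"
      using d \<epsilon>(1) by (auto simp: H10_def)
    note \<psi>' = L2_on_test_function[OF \<psi>(1) \<Omega>'] test_function_weak_gradient[OF \<psi>(1) \<Omega>(1)]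
    have ud: "L2_on \<Omega> (\<lambda>x. u x - \<phi> x)" "L2_on \<Omega> (\<lambda>x. g x - G x)" "weak_gradient_on \<Omega> (\<lambda>x. u x - \<phi> x) (\<lambda>x. g x - G x)"
      using weak_gradient_lincomb[OF \<Omega> u g L2\<phi> G, of "-1"] by (auto intro!: L2_on_diff u L2\<phi> G g)
    have ue: "L2_on \<Omega> (\<lambda>x. u x - \<phi> x - \<psi> x)" "L2_on \<Omega> (\<lambda>x. g x - G x - grad \<psi> x)"
      "weak_gradient_on \<Omega> (\<lambda>x. u x - \<phi> x - \<psi> x) (\<lambda>x. g x - G x - grad \<psi> x)"
      using weak_gradient_lincomb[OF \<Omega> ud \<psi>', of "-1"] by (auto intro!: L2_on_diff ud \<psi>')
    define e where "e x = (u x - \<phi> x - \<psi> x, g x - G x - grad \<psi> x)" for x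
    have e: "L2_on \<Omega> e" unfolding e_def[abs_def] using ue by (intro L2_on_Pair)
    have "(L2_norm_on \<Omega> e)\<^sup>2 = (H1_norm \<Omega> (\<lambda>x. u x - \<phi> x - \<psi> x))\<^sup>2"
      unfolding e_def[abs_def] H1_norm_square[OF \<Omega> ue(2,3)] using ue by (intro L2_norm_on_Pair)
    then have "L2_norm_on \<Omega> e = H1_norm \<Omega> (\<lambda>x. u x - \<phi> x - \<psi> x)"
      by (rule power2_eq_imp_eq) (auto simp: L2_norm_on_nonneg H1_norm_def)
    then have e\<epsilon>: "L2_norm_on \<Omega> e < \<epsilon>" using \<psi>(2) by simp
    define U where "U x = (u x, g x)" for x
    have U: "L2_on \<Omega> U" unfolding U_def[abs_def] using u g(1) by (rule L2_on_Pair)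
    \<comment> \<open>Up to the small error \<open>e\<close>, the pair \<open>U\<close> is of the
      form \<open>P\<close> at a test function: \<open>z\<close> equals \<open>P\<close> at the
      negative of \<open>\<psi>\<close>.\<close>
    define z where "z x = U x + (-1) *\<^sub>R e x" for x
    have z: "L2_on \<Omega> z" unfolding z_def[abs_def] by (rule L2_on_lincomb[OF U e])
    have zL: "(L2_norm_on \<Omega> z)\<^sup>2 \<le> L"
    proof -
      have "(L2_norm_on \<Omega> U)\<^sup>2 \<le> 1 + K\<^sup>2"
        unfolding U_def[abs_def] L2_norm_on_Pair[OF u g(1)]
        using power_mono[OF u1 L2_norm_on_nonneg, of 2] power_mono[OF gK L2_norm_on_nonneg, of 2] by simp
      then have "L2_norm_on \<Omega> U \<le> sqrt (1 + K\<^sup>2)" by (rule real_le_rsqrt)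
      moreover have "L2_norm_on \<Omega> z \<le> L2_norm_on \<Omega> U + L2_norm_on \<Omega> (\<lambda>x. (-1) *\<^sub>R e x)"
        unfolding z_def[abs_def] using L2_on_diff[OF e L2_on_add[OF e e]] by (intro L2_norm_on_triangle U) simp
      ultimately have "L2_norm_on \<Omega> z \<le> sqrt (1 + K\<^sup>2) + 1"
        using e\<epsilon> \<epsilon>(2) unfolding L2_norm_on_cmult by simp
      then show ?thesis unfolding L_def by (rule power_mono[OF _ L2_norm_on_nonneg])
    qed
    \<comment> \<open>Chosen so that \<open>P \<psi>s\<close> is the convex combination of
      \<open>h\<close> and \<open>z\<close>; its squared norm is therefore at least
      \<open>m\<close>.\<close>
    define \<psi>s where "\<psi>s x = (1 - s) * \<psi>0 x + (- s) * \<psi> x" for x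
    have \<psi>s: "test_function \<Omega> \<psi>s"
      unfolding \<psi>s_def[abs_def] by (intro test_function_add test_function_cmult \<psi> \<psi>0)
    have gs: "grad \<psi>s x = (1 - s) *\<^sub>R grad \<psi>0 x + (- s) *\<^sub>R grad \<psi> x" for x
      unfolding \<psi>s_def[abs_def]
      by (rule grad_unique) (auto intro!: derivative_eq_intros test_function_has_derivative[OF \<psi>(1)]
        test_function_has_derivative[OF \<psi>0(1)] simp: inner_add_left inner_diff_left)
    have Ps: "P \<psi>s = (\<lambda>x. (1 - s) *\<^sub>R h x + s *\<^sub>R z x)"
      by (rule ext) (simp add: P_def h_def z_def U_def e_def gs \<psi>s_def algebra_simps)
    have h': "L2_on \<Omega> (\<lambda>x. (1 - s) *\<^sub>R h x)"
      using L2_on_lincomb[OF h h, of "-s"] by (simp add: algebra_simps)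
    have "m \<le> (L2_norm_on \<Omega> (P \<psi>s))\<^sup>2" using m_le[OF \<psi>s] by (simp add: N_def)
    also have "\<dots> = (1 - s)\<^sup>2 * (L2_norm_on \<Omega> h)\<^sup>2 + 2 * s * ((1 - s) * L2_inner \<Omega> h z) + s\<^sup>2 * (L2_norm_on \<Omega> z)\<^sup>2"
      unfolding Ps L2_norm_on_square_lincomb[OF h' z] L2_norm_on_cmult
      by (simp add: power_mult_distrib L2_inner_def)
    finally have 1: "m \<le> (1 - s)\<^sup>2 * (L2_norm_on \<Omega> h)\<^sup>2 + 2 * s * ((1 - s) * L2_inner \<Omega> h z) + s\<^sup>2 * (L2_norm_on \<Omega> z)\<^sup>2" .
    have "(1 - s)\<^sup>2 * (L2_norm_on \<Omega> h)\<^sup>2 \<le> (1 - s)\<^sup>2 * (m + s * m / 2)"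
      using \<psi>0(2) by (intro mult_left_mono) (auto simp: N_def h_def)
    also have "\<dots> \<le> (1 - s)\<^sup>2 * m + s * m / 2"
    proof -
      have "(1 - s)\<^sup>2 \<le> 1" using s by (intro power_le_one) auto
      then have "(1 - s)\<^sup>2 * (s * m / 2) \<le> 1 * (s * m / 2)" using s m by (intro mult_right_mono) auto
      then show ?thesis by (simp add: distrib_left)
    qed
    finally have 2: "(1 - s)\<^sup>2 * (L2_norm_on \<Omega> h)\<^sup>2 \<le> (1 - s)\<^sup>2 * m + s * m / 2" .
    have 3: "s\<^sup>2 * (L2_norm_on \<Omega> z)\<^sup>2 \<le> s\<^sup>2 * L" using zL by (intro mult_left_mono) auto
    have "s * (s * (m + L)) \<le> s * m" using s by (intro mult_left_mono) auto
    \<comment> \<open>The terms in \<open>m\<close> leave 2s - s^2 times \<open>m\<close>;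
      \<open>s * (m + L) \<le> m\<close> absorbs the quadratic terms and the slack costs
      \<open>s * m / 2\<close>, so half of \<open>s * m\<close> survives.\<close>
    with 1 2 3 have "s * (m / 2) \<le> s * (2 * ((1 - s) * L2_inner \<Omega> h z))"
      by (simp add: power2_eq_square algebra_simps)
    then have 4: "m / 4 \<le> (1 - s) * L2_inner \<Omega> h z" using s(1) by simp
    then have "0 < (1 - s) * L2_inner \<Omega> h z" using m by linarith
    then have "0 < L2_inner \<Omega> h z" using s by (simp add: zero_less_mult_iff)
    then have "(1 - s) * L2_inner \<Omega> h z \<le> 1 * L2_inner \<Omega> h z" using s by (intro mult_right_mono) auto
    with 4 have "m / 4 \<le> L2_inner \<Omega> h z" by linarith
    also have "\<dots> = L2_inner \<Omega> h U - L2_inner \<Omega> h e"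
      unfolding z_def[abs_def] L2_inner_lincomb_right[OF h U e] by simp
    also have "\<dots> \<le> L2_inner \<Omega> h U + m / 8"
    proof -
      have "\<bar>L2_inner \<Omega> h e\<bar> \<le> L2_norm_on \<Omega> h * L2_norm_on \<Omega> e" by (rule L2_Cauchy_Schwarz[OF h e])
      also have "\<dots> \<le> L2_norm_on \<Omega> h * \<epsilon>" using e\<epsilon> by (intro mult_left_mono) (auto simp: L2_norm_on_nonneg)
      finally show ?thesis using \<epsilon>(3) by linarith
    qed
    finally show ?thesis by (simp add: U_def[abs_def])
  qed
  define n where "n = real DIM('a)"
  have n: "0 < n" by (simp add: n_def)
  \<comment> \<open>Replacing the coordinates of \<open>H\<close> by test functions within
    \<open>\<tau>\<close> costs at most \<open>n * \<tau> * K\<close>, which this makes at most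
    \<open>m / 16\<close>.\<close>
  define \<tau> where "\<tau> = m / (16 * n * (K + 1))"
  have \<tau>: "0 < \<tau>" using m n K by (simp add: \<tau>_def)
  have "\<exists>\<psi>. test_function \<Omega> \<psi> \<and> L2_norm_on \<Omega> (\<lambda>x. H x \<bullet> b - \<psi> x) < \<tau>" if "b \<in> Basis" for b
    using test_functions_dense[OF \<Omega> L2_on_component[OF H that] \<tau>] by blast
  then obtain F where F: "\<And>b. b \<in> Basis \<Longrightarrow> test_function \<Omega> (F b)"
    "\<And>b. b \<in> Basis \<Longrightarrow> L2_norm_on \<Omega> (\<lambda>x. H x \<bullet> b - F b x) < \<tau>" by metis
  define D where "D = L2_norm_on \<Omega> (\<lambda>x. \<phi> x - \<psi>0 x) + (\<Sum>b\<in>Basis. L2_norm_on \<Omega> (\<lambda>x. grad (F b) x \<bullet> b)) + 1"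
  have D: "0 < D" unfolding D_def by (intro add_nonneg_pos add_nonneg_nonneg sum_nonneg L2_norm_on_nonneg) auto
  have upper: "L2_inner \<Omega> h (\<lambda>x. (u x, g x)) \<le> L2_norm_on \<Omega> u * D + m / 16"
    if u: "L2_on \<Omega> u" and g: "L2_on \<Omega> g" "weak_gradient_on \<Omega> u g" and gK: "L2_norm_on \<Omega> g \<le> K" for u g
  proof -
    have L2F: "L2_on \<Omega> (F b)" "L2_on \<Omega> (\<lambda>x. grad (F b) x \<bullet> b)" if "b \<in> Basis" for b
      using L2_on_test_function(1)[OF F(1)[OF that] \<Omega>'] L2_on_test_function(1)[OF test_function_grad_inner[OF F(1)[OF that] that] \<Omega>']
      by auto
    have "L2_inner \<Omega> H g = (LINT x|lebesgue_on \<Omega>. (\<Sum>b\<in>Basis. (H x \<bullet> b) * (g x \<bullet> b)))"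
      unfolding L2_inner_def by (subst euclidean_inner) simp
    also have "\<dots> = (\<Sum>b\<in>Basis. L2_inner \<Omega> (\<lambda>x. H x \<bullet> b) (\<lambda>x. g x \<bullet> b))"
      unfolding L2_inner_def inner_real_def
      using L2_on_integrable_inner[OF L2_on_component[OF H] L2_on_component[OF g(1)]]
      by (intro Bochner_Integration.integral_sum) simp
    also have "\<dots> \<le> (\<Sum>b\<in>Basis. \<tau> * K + L2_norm_on \<Omega> u * L2_norm_on \<Omega> (\<lambda>x. grad (F b) x \<bullet> b))"
    proof (rule sum_mono)
      fix b :: 'a assume b: "b \<in> Basis"
      note gb = L2_on_component[OF g(1) b] and Hb = L2_on_component[OF H b]
      have "L2_inner \<Omega> (\<lambda>x. H x \<bullet> b) (\<lambda>x. g x \<bullet> b) =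
          L2_inner \<Omega> (\<lambda>x. H x \<bullet> b - F b x) (\<lambda>x. g x \<bullet> b) + L2_inner \<Omega> (F b) (\<lambda>x. g x \<bullet> b)"
        using L2_inner_lincomb_left[OF gb Hb L2F(1)[OF b], of "-1"] by simp
      \<comment> \<open>Integration by parts moves the derivative from \<open>u\<close> to
        \<open>F b\<close>, leaving only the L2 norm of \<open>u\<close>.\<close>
      moreover have "L2_inner \<Omega> (F b) (\<lambda>x. g x \<bullet> b) = - L2_inner \<Omega> u (\<lambda>x. grad (F b) x \<bullet> b)"
        using g(2)[unfolded weak_gradient_on_def, rule_format, OF F(1)[OF b] b] b
        by (simp add: L2_inner_def grad_inner mult.commute)
      moreover have "\<bar>L2_inner \<Omega> u (\<lambda>x. grad (F b) x \<bullet> b)\<bar> \<le> L2_norm_on \<Omega> u * L2_norm_on \<Omega> (\<lambda>x. grad (F b) x \<bullet> b)"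
        by (rule L2_Cauchy_Schwarz[OF u L2F(2)[OF b]])
      moreover have "\<bar>L2_inner \<Omega> (\<lambda>x. H x \<bullet> b - F b x) (\<lambda>x. g x \<bullet> b)\<bar> \<le> L2_norm_on \<Omega> (\<lambda>x. H x \<bullet> b - F b x) * L2_norm_on \<Omega> (\<lambda>x. g x \<bullet> b)"
        by (rule L2_Cauchy_Schwarz[OF L2_on_diff[OF Hb L2F(1)[OF b]] gb])
      moreover have "\<dots> \<le> \<tau> * K"
        using F(2)[OF b] L2_norm_on_component_le[OF g(1) b] gK \<tau> by (intro mult_mono) (auto simp: L2_norm_on_nonneg)
      ultimately show "L2_inner \<Omega> (\<lambda>x. H x \<bullet> b) (\<lambda>x. g x \<bullet> b) \<le> \<tau> * K + L2_norm_on \<Omega> u * L2_norm_on \<Omega> (\<lambda>x. grad (F b) x \<bullet> b)"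
        by linarith
    qed
    also have "\<dots> = n * (\<tau> * K) + L2_norm_on \<Omega> u * (\<Sum>b\<in>Basis. L2_norm_on \<Omega> (\<lambda>x. grad (F b) x \<bullet> b))"
      by (simp add: sum.distrib n_def sum_distrib_left)
    also have "n * (\<tau> * K) \<le> m / 16"
    proof -
      have "n * (\<tau> * K) = m / 16 * (K / (K + 1))"
        using n K by (simp add: \<tau>_def)
      also have "\<dots> \<le> m / 16 * 1"
        using m K by (intro mult_left_mono) auto
      finally show ?thesis by simp
    qed
    finally have 1: "L2_inner \<Omega> H g \<le> m / 16 + L2_norm_on \<Omega> u * (\<Sum>b\<in>Basis. L2_norm_on \<Omega> (\<lambda>x. grad (F b) x \<bullet> b))"
      by simp
    have 2: "L2_inner \<Omega> (\<lambda>x. \<phi> x - \<psi>0 x) u \<le> L2_norm_on \<Omega> u * L2_norm_on \<Omega> (\<lambda>x. \<phi> x - \<psi>0 x)"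
      using L2_Cauchy_Schwarz[OF comps(1)[OF \<psi>0(1)] u] by (simp add: mult.commute)
    have "L2_inner \<Omega> h (\<lambda>x. (u x, g x)) = L2_inner \<Omega> (\<lambda>x. \<phi> x - \<psi>0 x) u + L2_inner \<Omega> H g"
      unfolding h_def P_def[abs_def] H_def[abs_def] using comps[OF \<psi>0(1)] u g by (intro L2_inner_Pair)
    with 1 2 L2_norm_on_nonneg[of \<Omega> u] show ?thesis by (simp add: D_def algebra_simps)
  qed
  show thesis
  \<comment> \<open>The bounds \<open>m / 8\<close> from below and norm times \<open>D\<close> plus
    \<open>m / 16\<close> from above leave \<open>m / 16\<close>. The minimum with 1 covers norms
    above 1, where \<open>lower\<close> does not apply.\<close>
  proof (rule that[of "min 1 (m / (16 * D))"])
    show "0 < min 1 (m / (16 * D))" using m D by simp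
    fix u g assume A: "L2_on \<Omega> u" "L2_on \<Omega> g" "weak_gradient_on \<Omega> u g" "L2_norm_on \<Omega> g \<le> K" "H10 \<Omega> (\<lambda>x. u x - \<phi> x)"
    show "min 1 (m / (16 * D)) \<le> L2_norm_on \<Omega> u"
    proof (cases "L2_norm_on \<Omega> u \<le> 1")
      case True
      have "m / 16 \<le> L2_norm_on \<Omega> u * D"
        using lower[OF A True] upper[OF A(1-4)] by linarith
      then show ?thesis using D by (simp add: field_simps min_le_iff_disj)
    qed simp
  qed
qed

section \<open>Mollification\<close>

text \<open>Each partial derivative of \<open>\<psi>\<close> is itself a test function; test the
  weak gradient with it and sum over the coordinates.\<close>

lemma weak_gradient_laplacian:
  fixes u :: "'a::euclidean_space \<Rightarrow> real"
  assumes \<Omega>: "open \<Omega>" "bounded \<Omega>" and u: "L2_on \<Omega> u" "L2_on \<Omega> g" "weak_gradient_on \<Omega> u g"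
    and \<psi>: "test_function \<Omega> \<psi>"
  shows "(LINT x|lebesgue_on \<Omega>. u x * (\<Sum>b\<in>Basis. grad (\<lambda>y. grad \<psi> y \<bullet> b) x \<bullet> b)) = - L2_inner \<Omega> g (grad \<psi>)"
proof -
  note \<Omega>' = bounded_open_lmeasurable[OF \<Omega>]
  note t1 = test_function_grad_inner[OF \<psi>]
  have "(LINT x|lebesgue_on \<Omega>. u x * (\<Sum>b\<in>Basis. grad (\<lambda>y. grad \<psi> y \<bullet> b) x \<bullet> b)) =
      (\<Sum>b\<in>Basis. LINT x|lebesgue_on \<Omega>. u x * (grad (\<lambda>y. grad \<psi> y \<bullet> b) x \<bullet> b))"
    unfolding sum_distrib_left
  proof (rule Bochner_Integration.integral_sum)
    fix b :: 'a assume b: "b \<in> Basis"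
    show "integrable (lebesgue_on \<Omega>) (\<lambda>x. u x * (grad (\<lambda>y. grad \<psi> y \<bullet> b) x \<bullet> b))"
      using L2_on_integrable_inner[OF u(1) L2_on_test_function(1)[OF test_function_grad_inner[OF t1[OF b] b] \<Omega>']] by simp
  qed
  also have "\<dots> = (\<Sum>b\<in>Basis. - (LINT x|lebesgue_on \<Omega>. (g x \<bullet> b) * (grad \<psi> x \<bullet> b)))"
  proof (rule sum.cong[OF refl])
    fix b :: 'a assume b: "b \<in> Basis"
    show "(LINT x|lebesgue_on \<Omega>. u x * (grad (\<lambda>y. grad \<psi> y \<bullet> b) x \<bullet> b)) =
        - (LINT x|lebesgue_on \<Omega>. (g x \<bullet> b) * (grad \<psi> x \<bullet> b))"
      using u(3)[unfolded weak_gradient_on_def, rule_format, OF t1[OF b] b] by (simp add: grad_inner[OF b])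
  qed
  also have "\<dots> = - (LINT x|lebesgue_on \<Omega>. (\<Sum>b\<in>Basis. (g x \<bullet> b) * (grad \<psi> x \<bullet> b)))"
    unfolding sum_negf
    using L2_on_integrable_inner[OF L2_on_component[OF u(2)] L2_on_component[OF L2_on_test_function(2)[OF \<psi> \<Omega>']]]
    by (subst Bochner_Integration.integral_sum) simp_all
  also have "\<dots> = - L2_inner \<Omega> g (grad \<psi>)"
    unfolding L2_inner_def by (subst (2) euclidean_inner) simp
  finally show ?thesis .
qed

text \<open>Minus the gradient of \<open>bump 0 (1 - (norm z)\<^sup>2)\<close> is
  \<open>mollifier z *\<^sub>R z\<close>; this dictates both the profile \<open>bump 1\<close> and
  the factor 2.\<close>

definition mollifier :: "'a::euclidean_space \<Rightarrow> real" where
  "mollifier z = 2 * bump 1 (1 - (norm z)\<^sup>2)"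

definition scaled_mollifier :: "real \<Rightarrow> 'a::euclidean_space \<Rightarrow> 'a \<Rightarrow> real" where
  "scaled_mollifier t a x = mollifier ((1 / t) *\<^sub>R (x - a)) / t ^ DIM('a)"

text \<open>The potential is chosen such that its Laplacian is minus the \<open>t\<close>-derivative of the scaled mollifier.\<close>

definition potential :: "real \<Rightarrow> 'a::euclidean_space \<Rightarrow> 'a \<Rightarrow> real" where
  "potential t a x = - (t / t ^ DIM('a)) * bump 0 (1 - (norm ((1 / t) *\<^sub>R (x - a)))\<^sup>2)"

lemma mollifier_outside: "1 \<le> norm z \<Longrightarrow> mollifier z = 0"
  by (simp add: mollifier_def bump_nonpos)

lemma mollifier_pos: "norm z < 1 \<Longrightarrow> 0 < mollifier z"
  by (simp add: mollifier_def bump_pos(2)[simplified] power_less_one_iff)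

lemma mollifier_nonneg: "0 \<le> mollifier z"
  using mollifier_outside[of z] mollifier_pos[of z] by (cases "norm z < 1") auto

lemma mollifier_test_function: "test_function UNIV (mollifier :: 'a::euclidean_space \<Rightarrow> real)"
proof (rule test_functionI[of _ "cball 0 1"])
  have "Ck k (\<lambda>z::'a. bump 1 (1 - (norm (z - 0))\<^sup>2))" for k
    by (intro bump_Ck Ck_diff Ck_square_dist Ck_const)
  then show "Ck k (mollifier :: 'a \<Rightarrow> real)" for k
    unfolding mollifier_def[abs_def] by (intro Ck_mult Ck_const) simp
qed (auto simp: mollifier_outside)

lemma scaled_mollifier_outside: "0 < t \<Longrightarrow> t \<le> norm (x - a) \<Longrightarrow> scaled_mollifier t a x = 0"
  by (simp add: scaled_mollifier_def mollifier_outside)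

lemma continuous_scaled_mollifier:
  fixes f g :: "'b::topological_space \<Rightarrow> 'a::euclidean_space"
  assumes "continuous_on A f" "continuous_on A g"
  shows "continuous_on A (\<lambda>x. scaled_mollifier t (f x) (g x))"
  unfolding scaled_mollifier_def divide_inverse
  by (intro continuous_on_compose2[OF test_function_continuous[OF mollifier_test_function, of UNIV]] continuous_intros assms) auto

lemma potential_test_function:
  fixes a :: "'a::euclidean_space"
  assumes "0 < t" "cball a t \<subseteq> \<Omega>"
  shows "test_function \<Omega> (potential t a)"
proof (rule test_functionI[of _ "cball a t"])
  have "potential t a = (\<lambda>x. - (t / t ^ DIM('a)) * bump 0 (1 - (1 / t\<^sup>2) * (norm (x - a))\<^sup>2))"
    by (simp add: potential_def[abs_def] power_mult_distrib power_divide)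
  moreover have "Ck k (\<lambda>x. bump 0 (1 - (1 / t\<^sup>2) * (norm (x - a))\<^sup>2))" for k
    by (intro bump_Ck Ck_diff Ck_square_dist Ck_const Ck_mult)
  ultimately show "Ck k (potential t a)" for k
    by (simp only:) (intro Ck_mult Ck_const)
  fix x assume "x \<notin> cball a t"
  then have "1 \<le> norm ((1 / t) *\<^sub>R (x - a))" using assms by (simp add: dist_norm norm_minus_commute)
  then have "1 \<le> (norm ((1 / t) *\<^sub>R (x - a)))\<^sup>2" by (rule one_le_power)
  then show "potential t a x = 0" unfolding potential_def by (simp add: bump_nonpos)
qed (use assms in auto)

lemma potential_outside: "0 < t \<Longrightarrow> x \<notin> cball a t \<Longrightarrow> potential t a x = 0 \<and> grad (potential t a) x = 0"
  using test_function_support[OF potential_test_function[of t a "cball a t"], of "potential t a x = 0 \<and> grad (potential t a) x = 0"]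
  by (metis order_refl subsetD)

text \<open>The factor \<open>t\<close> in the potential cancels the \<open>1 / t\<close> of the
  chain rule, which leaves the scaled mollifier times the radial field (x - a)/t.\<close>

lemma grad_potential:
  fixes a :: "'a::euclidean_space"
  assumes "0 < t"
  shows "grad (potential t a) x = (mollifier ((1 / t) *\<^sub>R (x - a)) / t ^ DIM('a)) *\<^sub>R ((1 / t) *\<^sub>R (x - a))"
proof (rule grad_unique)
  define z where "z = (1 / t) *\<^sub>R (x - a)"
  have "((\<lambda>x. 1 - ((1 / t) *\<^sub>R (x - a)) \<bullet> ((1 / t) *\<^sub>R (x - a))) has_derivative (\<lambda>h. - (2 / t) * (z \<bullet> h))) (at x)"
    using assms by (auto intro!: derivative_eq_intros simp: z_def inner_commute algebra_simps)
  then have "((\<lambda>x. 1 - (norm ((1 / t) *\<^sub>R (x - a)))\<^sup>2) has_derivative (\<lambda>h. - (2 / t) * (z \<bullet> h))) (at x)"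
    by (simp only: power2_norm_eq_inner)
  from DERIV_compose_FDERIV[OF bump_DERIV this]
  have "((\<lambda>x. bump 0 (1 - (norm ((1 / t) *\<^sub>R (x - a)))\<^sup>2)) has_derivative
      (\<lambda>h. - (2 / t) * (z \<bullet> h) * bump 1 (1 - (norm z)\<^sup>2))) (at x)"
    by (simp add: z_def)
  then have "((\<lambda>x. potential t a x) has_derivative
      (\<lambda>h. - (t / t ^ DIM('a)) * (- (2 / t) * (z \<bullet> h) * bump 1 (1 - (norm z)\<^sup>2)))) (at x)"
    unfolding potential_def by (rule has_derivative_mult_right)
  moreover have "- (t / t ^ DIM('a)) * (- (2 / t) * (z \<bullet> h) * bump 1 (1 - (norm z)\<^sup>2)) =
      ((mollifier z / t ^ DIM('a)) *\<^sub>R z) \<bullet> h" for h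
    using assms by (simp add: mollifier_def field_simps)
  ultimately show "(potential t a has_derivative
      (\<bullet>) ((mollifier ((1 / t) *\<^sub>R (x - a)) / t ^ DIM('a)) *\<^sub>R (1 / t) *\<^sub>R (x - a))) (at x)"
    unfolding z_def by (simp only:)
qed

lemma laplacian_potential:
  fixes a :: "'a::euclidean_space"
  assumes "0 < t"
  defines "z \<equiv> \<lambda>x. (1 / t) *\<^sub>R (x - a)"
  shows "(\<Sum>b\<in>Basis. grad (\<lambda>y. grad (potential t a) y \<bullet> b) x \<bullet> b) =
    (grad mollifier (z x) \<bullet> z x + DIM('a) * mollifier (z x)) / t ^ Suc DIM('a)"
proof -
  have "grad (\<lambda>y. grad (potential t a) y \<bullet> b) x =
      ((z x \<bullet> b) / t ^ Suc DIM('a)) *\<^sub>R grad mollifier (z x) + (mollifier (z x) / t ^ Suc DIM('a)) *\<^sub>R b" for b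
  proof (rule grad_unique)
    have dz: "((\<lambda>y. z y) has_derivative (\<lambda>h. (1 / t) *\<^sub>R h)) (at x)"
      unfolding z_def by (auto intro!: derivative_eq_intros)
    have "((\<lambda>y. mollifier (z y)) has_derivative (\<lambda>h. grad mollifier (z x) \<bullet> ((1 / t) *\<^sub>R h))) (at x)"
      by (rule has_derivative_compose[OF dz test_function_has_derivative[OF mollifier_test_function]])
    then have "((\<lambda>y. (1 / t ^ DIM('a)) * (mollifier (z y) * (z y \<bullet> b))) has_derivative
        (\<lambda>h. (1 / t ^ DIM('a)) * (mollifier (z x) * (((1 / t) *\<^sub>R h) \<bullet> b) + (grad mollifier (z x) \<bullet> ((1 / t) *\<^sub>R h)) * (z x \<bullet> b)))) (at x)"
      by (intro has_derivative_mult_right has_derivative_mult has_derivative_inner_left dz)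
    moreover have "(\<lambda>y. (1 / t ^ DIM('a)) * (mollifier (z y) * (z y \<bullet> b))) = (\<lambda>y. grad (potential t a) y \<bullet> b)"
      using assms(1) by (simp add: grad_potential z_def fun_eq_iff)
    moreover have "(1 / t ^ DIM('a)) * (mollifier (z x) * (((1 / t) *\<^sub>R h) \<bullet> b) + (grad mollifier (z x) \<bullet> ((1 / t) *\<^sub>R h)) * (z x \<bullet> b)) =
        (((z x \<bullet> b) / t ^ Suc DIM('a)) *\<^sub>R grad mollifier (z x) + (mollifier (z x) / t ^ Suc DIM('a)) *\<^sub>R b) \<bullet> h" for h
      using assms(1) by (simp add: inner_add_left inner_commute[of b] field_simps)
    ultimately show "((\<lambda>y. grad (potential t a) y \<bullet> b) has_derivative
        (\<bullet>) (((z x \<bullet> b) / t ^ Suc DIM('a)) *\<^sub>R grad mollifier (z x) + (mollifier (z x) / t ^ Suc DIM('a)) *\<^sub>R b)) (at x)"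
      by (simp only:)
  qed
  then have "(\<Sum>b\<in>Basis. grad (\<lambda>y. grad (potential t a) y \<bullet> b) x \<bullet> b) =
      (\<Sum>b\<in>Basis. ((grad mollifier (z x) \<bullet> b) * (z x \<bullet> b) + mollifier (z x)) / t ^ Suc DIM('a))"
    by (intro sum.cong) (simp_all add: inner_add_left add_divide_distrib)
  also have "\<dots> = (grad mollifier (z x) \<bullet> z x + DIM('a) * mollifier (z x)) / t ^ Suc DIM('a)"
    unfolding euclidean_inner[of "grad mollifier (z x)" "z x"]
    by (simp add: sum_divide_distrib[symmetric] sum.distrib)
  finally show ?thesis .
qed

text \<open>Scaling that preserves the integral transports mass along the radial field. With k the
  mollifier, n the dimension and z = (x - a)/t, both sides equal -(grad k . z + n
  k)/t^(n+1).\<close>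

lemma scaled_mollifier_DERIV:
  fixes a :: "'a::euclidean_space"
  assumes "0 < t"
  shows "((\<lambda>t. scaled_mollifier t a x) has_real_derivative
    - (\<Sum>b\<in>Basis. grad (\<lambda>y. grad (potential t a) y \<bullet> b) x \<bullet> b)) (at t)"
proof -
  define z where "z = (1 / t) *\<^sub>R (x - a)"
  have "((\<lambda>t. (1 / t) *\<^sub>R (x - a)) has_derivative (\<lambda>h. (- (h / t)) *\<^sub>R z)) (at t)"
    using assms by (auto intro!: derivative_eq_intros simp: z_def field_simps)
  then have "((\<lambda>t. mollifier ((1 / t) *\<^sub>R (x - a))) has_derivative (\<lambda>h. grad mollifier z \<bullet> ((- (h / t)) *\<^sub>R z))) (at t)"
    unfolding z_def by (rule has_derivative_compose[OF _ test_function_has_derivative[OF mollifier_test_function]])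
  moreover have "(\<lambda>h. grad mollifier z \<bullet> ((- (h / t)) *\<^sub>R z)) = (*) (- (grad mollifier z \<bullet> z) / t)"
    by (auto simp: fun_eq_iff)
  ultimately have k: "((\<lambda>t. mollifier ((1 / t) *\<^sub>R (x - a))) has_real_derivative - (grad mollifier z \<bullet> z) / t) (at t)"
    by (simp add: has_field_derivative_def)
  have "((\<lambda>t. scaled_mollifier t a x) has_real_derivative
      ((- (grad mollifier z \<bullet> z) / t) * t ^ DIM('a) - mollifier z * (DIM('a) * t ^ (DIM('a) - Suc 0))) / (t ^ DIM('a) * t ^ DIM('a))) (at t)"
    unfolding scaled_mollifier_def using assms DERIV_divide[OF k DERIV_pow, of "DIM('a)"] by (simp add: z_def)
  moreover have "((- (grad mollifier z \<bullet> z) / t) * t ^ DIM('a) - mollifier z * (DIM('a) * t ^ (DIM('a) - Suc 0))) / (t ^ DIM('a) * t ^ DIM('a))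
      = - ((grad mollifier z \<bullet> z + DIM('a) * mollifier z) / t ^ Suc DIM('a))"
  proof -
    \<comment> \<open>Writing the dimension as a successor removes the truncated subtraction in the
      exponent.\<close>
    obtain m where "DIM('a) = Suc m" using DIM_positive[where 'a='a] gr0_conv_Suc by blast
    then show ?thesis using assms by (simp add: field_simps)
  qed
  ultimately show ?thesis
    unfolding laplacian_potential[OF assms] z_def by simp
qed

section \<open>The smoothed function and its derivative in the scale\<close>

lemma L2_norm_on_le_bound:
  assumes "\<Omega> \<in> lmeasurable" "f \<in> borel_measurable (lebesgue_on \<Omega>)" "0 \<le> c" "\<And>x. x \<in> \<Omega> \<Longrightarrow> norm (f x) \<le> c"
  shows "L2_norm_on \<Omega> f \<le> c * sqrt (measure lebesgue \<Omega>)"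
proof -
  have "(LINT x|lebesgue_on \<Omega>. (norm (f x))\<^sup>2) \<le> c\<^sup>2 * measure lebesgue \<Omega>"
  proof (rule integral_lebesgue_on_indicator_le)
    show "(\<lambda>x. (norm (f x))\<^sup>2) \<in> borel_measurable (lebesgue_on \<Omega>)"
      using L2_on_bounded[OF assms(1,2,4)] unfolding L2_on_def by (intro borel_measurable_integrable) simp
    show "(norm (f x))\<^sup>2 \<le> c\<^sup>2 * indicator \<Omega> x" if "x \<in> \<Omega>" for x
      using assms(4)[OF that] that by (simp add: power_mono)
  qed (use assms in auto)
  then have "L2_norm_on \<Omega> f \<le> sqrt (c\<^sup>2 * measure lebesgue \<Omega>)"
    unfolding L2_norm_on_def by simp
  then show ?thesis using assms(3) by (simp add: real_sqrt_mult)
qed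

text \<open>The mollifier does not have integral \<open>1\<close>; its integral is \<open>mollifier_mass\<close> below.\<close>

definition smoothed :: "('a::euclidean_space \<Rightarrow> real) \<Rightarrow> real \<Rightarrow> 'a \<Rightarrow> real" where
  "smoothed u t a = (LINT x|lebesgue_on (ball 0 1). u x * scaled_mollifier t a x)"

lemma L2_on_scaled_mollifier: "L2_on (ball 0 1) (scaled_mollifier t a)"
proof -
  obtain B where "\<And>x::'a. \<bar>mollifier x\<bar> \<le> B"
    using test_function_bounded[OF mollifier_test_function] by metis
  then have "norm (scaled_mollifier t a x) \<le> B / \<bar>t ^ DIM('a)\<bar>" for x
    by (simp add: scaled_mollifier_def divide_right_mono)
  then show ?thesis
    by (intro L2_on_bounded continuous_imp_measurable_lebesgue_on continuous_scaled_mollifier continuous_intros) auto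
qed

text \<open>Under the integral the kernel's derivative is minus the Laplacian of the potential; the
  minus sign cancels against the one from integration by parts.\<close>

lemma smoothed_DERIV:
  fixes u :: "'a::euclidean_space \<Rightarrow> real"
  assumes u: "L2_on (ball 0 1) u" "L2_on (ball 0 1) g" "weak_gradient_on (ball 0 1) u g"
    and t: "0 < t" "cball a t \<subseteq> ball 0 1"
  shows "((\<lambda>t. smoothed u t a) has_real_derivative L2_inner (ball 0 1) g (grad (potential t a))) (at t)"
proof -
  define k' where "k' t x = - (\<Sum>b\<in>Basis. grad (\<lambda>y. grad (potential t a) y \<bullet> b) x \<bullet> b)" for t x
  obtain B where B: "0 < B" "\<And>z::'a. \<bar>mollifier z\<bar> \<le> B" "\<And>z::'a. norm (grad mollifier z) \<le> B"
    using test_function_bounded[OF mollifier_test_function] by metis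
  have gz: "\<bar>grad mollifier z \<bullet> z\<bar> \<le> B" for z :: 'a
  proof (cases "z \<in> cball 0 1")
    case True
    have "\<bar>grad mollifier z \<bullet> z\<bar> \<le> norm (grad mollifier z) * norm z" by (rule Cauchy_Schwarz_ineq2)
    also have "\<dots> \<le> B * 1" using True B by (intro mult_mono) auto
    finally show ?thesis by simp
  next
    case False
    have "(mollifier has_derivative (\<lambda>h. 0)) (at z)"
      by (rule has_derivative_transform_within_open[OF has_derivative_const[of 0], where s="- cball 0 1"])
        (use False in \<open>auto simp: mollifier_outside\<close>)
    then have "grad mollifier z = 0" by (intro grad_unique) simp
    then show ?thesis using B by simp
  qed
  define D where "D = (B + DIM('a) * B) / (t / 2) ^ Suc DIM('a)"
  have "((\<lambda>t. LINT x|lebesgue_on (ball 0 1). u x * scaled_mollifier t a x) has_real_derivative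
      (LINT x|lebesgue_on (ball 0 1). u x * k' t x)) (at t)"
  \<comment> \<open>Staying above \<open>t / 2\<close> bounds the kernel derivative uniformly. At
    nearby scales the support may leave the unit ball; integration by parts is applied at
    \<open>t\<close> only.\<close>
  proof (rule integral_has_real_derivative[where a="t / 2" and b="2 * t" and w="\<lambda>x. D * \<bar>u x\<bar>"])
    show "t \<in> {t / 2<..<2 * t}" using t by simp
    fix s assume s: "s \<in> {t / 2<..<2 * t}"
    then have "0 < s" using t by simp
    show "integrable (lebesgue_on (ball 0 1)) (\<lambda>x. u x * scaled_mollifier s a x)"
      using L2_on_integrable_inner[OF u(1) L2_on_scaled_mollifier] by simp
    fix x
    show "((\<lambda>t. u x * scaled_mollifier t a x) has_real_derivative u x * k' s x) (at s)"
      unfolding k'_def by (intro DERIV_cmult scaled_mollifier_DERIV \<open>0 < s\<close>)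
    define z where "z = (1 / s) *\<^sub>R (x - a)"
    have "\<bar>k' s x\<bar> = \<bar>grad mollifier z \<bullet> z + DIM('a) * mollifier z\<bar> / s ^ Suc DIM('a)"
      unfolding k'_def laplacian_potential[OF \<open>0 < s\<close>] z_def using \<open>0 < s\<close> by simp
    also have "\<dots> \<le> D"
      unfolding D_def
    proof (rule frac_le)
      have "\<bar>DIM('a) * mollifier z\<bar> \<le> DIM('a) * B"
        using B by (simp add: abs_mult mult_left_mono)
      then show "\<bar>grad mollifier z \<bullet> z + DIM('a) * mollifier z\<bar> \<le> B + DIM('a) * B"
        using gz[of z] by linarith
      show "(t / 2) ^ Suc DIM('a) \<le> s ^ Suc DIM('a)"
        using s t by (intro power_mono) auto
    qed (use t B in auto)
    finally have "\<bar>k' s x\<bar> * \<bar>u x\<bar> \<le> D * \<bar>u x\<bar>"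
      by (rule mult_right_mono) simp
    then show "\<bar>u x * k' s x\<bar> \<le> D * \<bar>u x\<bar>"
      by (simp add: abs_mult mult.commute)
  next
    have "L2_on (ball 0 1) (\<lambda>x::'a. 1::real)"
      by (intro L2_on_bounded[where B=1]) auto
    from L2_on_integrable_inner[OF u(1) this]
    show "integrable (lebesgue_on (ball 0 1)) (\<lambda>x. D * \<bar>u x\<bar>)"
      by (intro integrable_mult_right integrable_abs) simp
  qed
  moreover have "(LINT x|lebesgue_on (ball 0 1). u x * k' t x) = L2_inner (ball 0 1) g (grad (potential t a))"
    unfolding k'_def using weak_gradient_laplacian[OF _ _ u potential_test_function[OF t]] by simp
  ultimately show ?thesis unfolding smoothed_def by simp
qed

section \<open>Mass of the mollifier and the limit of small scales\<close>

lemma integral_affine: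
  fixes f :: "'a::euclidean_space \<Rightarrow> real"
  assumes "f \<in> borel_measurable borel" "c \<noteq> 0"
  shows "(LINT x|lborel. f x) = \<bar>c\<bar> ^ DIM('a) * (LINT z|lborel. f (a + c *\<^sub>R z))"
proof -
  have "(LINT x|lborel. f x) = (LINT x|density (distr lborel borel (\<lambda>z. a + c *\<^sub>R z)) (\<lambda>_. \<bar>c\<bar> ^ DIM('a)). f x)"
    using lborel_affine[OF assms(2), of a] by simp
  also have "\<dots> = (LINT x|distr lborel borel (\<lambda>z. a + c *\<^sub>R z). \<bar>c\<bar> ^ DIM('a) *\<^sub>R f x)"
    using assms(1) by (subst integral_density[symmetric]) (auto simp: ennreal_power)
  also have "\<dots> = (LINT z|lborel. \<bar>c\<bar> ^ DIM('a) *\<^sub>R f (a + c *\<^sub>R z))"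
    using assms(1) by (subst integral_distr) auto
  finally show ?thesis by simp
qed

text \<open>The type argument carries the space, on which alone this constant depends. It is divided
  out only when the representative of \<open>u\<close> is formed, so the potential stays free of a
  normalizing factor.\<close>

definition mollifier_mass :: "'a::euclidean_space itself \<Rightarrow> real" where
  "mollifier_mass _ = (LINT z|lborel. mollifier (z :: 'a))"

lemma integrable_mollifier: "integrable lborel (mollifier :: 'a::euclidean_space \<Rightarrow> real)"
  by (rule integrable_compact_support[of _ "cball 0 1"])
    (auto simp: mollifier_outside intro: test_function_continuous[OF mollifier_test_function])

lemma mollifier_mass_pos: "0 < mollifier_mass TYPE('a::euclidean_space)"
proof -
  have "mollifier_mass TYPE('a) \<noteq> 0"
  proof
    assume "mollifier_mass TYPE('a) = 0"
    then have "AE z in lborel. mollifier (z :: 'a) = 0"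
      unfolding mollifier_mass_def
      using integral_nonneg_eq_0_iff_AE[OF integrable_mollifier[where 'a='a]] by (simp add: mollifier_nonneg)
    then have "AE z in lborel. z \<notin> ball (0 :: 'a) 1"
    proof eventually_elim
      case (elim z)
      then show ?case using mollifier_pos[of z] by force
    qed
    then have "ball (0 :: 'a) 1 \<in> null_sets lborel"
      by (subst (asm) AE_iff_null_sets[symmetric]) auto
    then have "measure lborel (ball (0 :: 'a) 1) = 0"
      by (simp add: measure_def null_sets_def)
    then show False
      using content_ball_pos[of 1 "0 :: 'a"] by simp
  qed
  moreover have "0 \<le> mollifier_mass TYPE('a)"
    unfolding mollifier_mass_def by (intro integral_nonneg_AE AE_I2 mollifier_nonneg)
  ultimately show ?thesis by simp
qed

lemma continuous_scaled_mollifier_fst: "continuous_on A (\<lambda>a. scaled_mollifier t a y)"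
  by (intro continuous_scaled_mollifier continuous_intros)

lemma integral_scaled_mollifier:
  fixes y :: "'a::euclidean_space"
  assumes "0 < t"
  shows "(LINT a|lborel. scaled_mollifier t a y) = mollifier_mass TYPE('a)"
proof -
  \<comment> \<open>The integration is over the center, so the substitution a = y - t z brings the
    argument (y - a)/t to z.\<close>
  have "(LINT a|lborel. scaled_mollifier t a y) =
      \<bar>- t\<bar> ^ DIM('a) * (LINT z|lborel. scaled_mollifier t (y + (- t) *\<^sub>R z) y)"
    using assms by (intro integral_affine borel_measurable_continuous_onI continuous_scaled_mollifier_fst) auto
  also have "\<dots> = (LINT z|lborel. mollifier (z :: 'a))"
    using assms by (simp add: scaled_mollifier_def)
  finally show ?thesis by (simp add: mollifier_mass_def)
qed

text \<open>Only centers within distance \<open>t\<close> of \<open>y\<close> contribute, and there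
  \<open>\<psi>\<close> differs from its value at \<open>y\<close> by at most
  \<open>L * t\<close>.\<close>

lemma scaled_mollifier_convolution:
  fixes \<psi> :: "'a::euclidean_space \<Rightarrow> real"
  assumes \<psi>: "test_function \<Omega> \<psi>" and L: "\<And>x y. \<bar>\<psi> x - \<psi> y\<bar> \<le> L * norm (x - y)" "0 \<le> L" and t: "0 < t"
  shows "\<bar>(LINT a|lborel. scaled_mollifier t a y * \<psi> a) - mollifier_mass TYPE('a) * \<psi> y\<bar>
    \<le> mollifier_mass TYPE('a) * (L * t)"
proof -
  have out: "scaled_mollifier t a y = 0" if "a \<notin> cball y t" for a
    using that t by (intro scaled_mollifier_outside) (auto simp: dist_norm)
  have nonneg: "0 \<le> scaled_mollifier t a y" for a
    using t by (simp add: scaled_mollifier_def mollifier_nonneg)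
  have i: "integrable lborel (\<lambda>a. scaled_mollifier t a y * f a)" if "continuous_on UNIV f" for f
    using out that
    by (intro integrable_compact_support[of _ "cball y t"] continuous_intros continuous_scaled_mollifier_fst) auto
  note i1 = i[OF test_function_continuous[OF \<psi>]] and i2 = i[OF continuous_on_const]
  have "(LINT a|lborel. scaled_mollifier t a y * \<psi> a) - mollifier_mass TYPE('a) * \<psi> y =
      (LINT a|lborel. scaled_mollifier t a y * \<psi> a) - (LINT a|lborel. scaled_mollifier t a y * \<psi> y)"
    using integral_scaled_mollifier[OF t, of y] by simp
  also have "\<dots> = (LINT a|lborel. scaled_mollifier t a y * \<psi> a - scaled_mollifier t a y * \<psi> y)"
    by (rule Bochner_Integration.integral_diff[symmetric, OF i1 i2])
  finally have "\<bar>(LINT a|lborel. scaled_mollifier t a y * \<psi> a) - mollifier_mass TYPE('a) * \<psi> y\<bar> \<le>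
      (LINT a|lborel. \<bar>scaled_mollifier t a y * \<psi> a - scaled_mollifier t a y * \<psi> y\<bar>)"
    by (simp only: integral_abs_bound)
  also have "\<dots> \<le> (LINT a|lborel. scaled_mollifier t a y * (L * t))"
  proof (rule integral_mono)
    fix a
    show "\<bar>scaled_mollifier t a y * \<psi> a - scaled_mollifier t a y * \<psi> y\<bar> \<le> scaled_mollifier t a y * (L * t)"
    proof (cases "a \<in> cball y t")
      case True
      have "\<bar>scaled_mollifier t a y * \<psi> a - scaled_mollifier t a y * \<psi> y\<bar> = scaled_mollifier t a y * \<bar>\<psi> a - \<psi> y\<bar>"
        using nonneg[of a] by (simp add: abs_mult flip: right_diff_distrib)
      also have "\<dots> \<le> scaled_mollifier t a y * (L * t)"
      proof (rule mult_left_mono[OF _ nonneg])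
        have "L * norm (a - y) \<le> L * t"
          using True L(2) by (intro mult_left_mono) (auto simp: dist_norm norm_minus_commute)
        then show "\<bar>\<psi> a - \<psi> y\<bar> \<le> L * t" using L(1)[of a y] by linarith
      qed
      finally show ?thesis .
    qed (simp add: out)
  qed (intro integrable_abs Bochner_Integration.integrable_diff i1 i2)+
  also have "\<dots> = mollifier_mass TYPE('a) * (L * t)"
    using integral_scaled_mollifier[OF t, of y] by simp
  finally show ?thesis .
qed

text \<open>Fubini's theorem needs product measurability, hence the passage to a Borel representative.\<close>

lemma smoothed_weak_limit:
  fixes u \<psi> :: "'a::euclidean_space \<Rightarrow> real"
  assumes u: "L2_on (ball 0 1) u"
    and \<psi>: "test_function \<Omega> \<psi>" and L: "\<And>x y. \<bar>\<psi> x - \<psi> y\<bar> \<le> L * norm (x - y)" "0 \<le> L" and t: "0 < t"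
  shows "\<bar>(LINT a|lborel. smoothed u t a * \<psi> a) -
      mollifier_mass TYPE('a) * (LINT y|lebesgue_on (ball 0 1). u y * \<psi> y)\<bar>
    \<le> mollifier_mass TYPE('a) * (L * t) * (LINT y|lebesgue_on (ball 0 1). \<bar>u y\<bar>)"
proof -
  define B :: "'a set" where "B = ball 0 1"
  have B: "B \<in> lmeasurable" "B \<in> sets lebesgue" by (auto simp: B_def)
  define c where "c = mollifier_mass TYPE('a)"
  have c: "0 < c" by (simp add: c_def mollifier_mass_pos)
  have "L2_on B (\<lambda>x::'a. 1::real)" by (intro L2_on_bounded[where B=1] B) auto
  from L2_on_integrable_inner[OF u[folded B_def] this]
  have u1: "integrable (lebesgue_on B) u" by simp
  then have iu: "integrable lebesgue (\<lambda>y. indicator B y * u y)"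
    using integrable_restrict_space[of B lebesgue u] B by simp
  then obtain v where v: "v \<in> borel_measurable lborel" "AE y in lborel. indicator B y * u y = v y"
    using completion_ex_borel_measurable_real[of _ lborel] borel_measurable_integrable by metis
  have AE_v: "AE y in lebesgue. indicator B y * u y = v y"
    using v(2) by (rule AE_completion)
  have [measurable]: "v \<in> borel_measurable borel" using v(1) by simp
  \<comment> \<open>The condition \<open>h y 0 = 0\<close> makes the zero extension of
    \<open>u\<close> contribute nothing outside the ball.\<close>
  have transfer: "(LINT y|lebesgue_on B. h y (u y)) = (LINT y|lborel. h y (v y))"
    if h0: "\<And>y. h y 0 = 0" and hm: "(\<lambda>y. h y (v y)) \<in> borel_measurable borel"
      and hi: "(\<lambda>y. h y (u y)) \<in> borel_measurable (lebesgue_on B)"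
    for h :: "'a \<Rightarrow> real \<Rightarrow> real"
  proof -
    have "(LINT y|lebesgue_on B. h y (u y)) = (LINT y|lebesgue. indicator B y *\<^sub>R h y (u y))"
      by (rule integral_restrict_space) (use B in simp)
    also have "\<dots> = (LINT y|lebesgue. h y (v y))"
    proof (rule integral_cong_AE)
      show "(\<lambda>y. indicator B y *\<^sub>R h y (u y)) \<in> borel_measurable lebesgue"
        using hi B borel_measurable_restrict_space_iff[of B lebesgue "\<lambda>y. h y (u y)"] by simp
      show "(\<lambda>y. h y (v y)) \<in> borel_measurable lebesgue"
        using hm by (simp add: measurable_completion)
      show "AE y in lebesgue. indicator B y *\<^sub>R h y (u y) = h y (v y)"
        using AE_v by eventually_elim (auto simp: indicator_def h0 split: if_splits)
    qed
    also have "\<dots> = (LINT y|lborel. h y (v y))"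
      using hm by (intro integral_completion) simp
    finally show ?thesis .
  qed
  have u_meas: "u \<in> borel_measurable (lebesgue_on B)" using u1 by simp
  have iv: "integrable lborel v"
  proof -
    have "integrable lebesgue v"
      using iu AE_v by (subst integrable_cong_AE[symmetric]) (auto simp: measurable_completion)
    then show ?thesis by (simp add: integrable_completion)
  qed
  have tr: "(LINT y|lebesgue_on B. u y * f y) = (LINT y|lborel. v y * f y)" if "continuous_on UNIV f" for f
  proof -
    have [measurable]: "f \<in> borel_measurable borel" using that by (rule borel_measurable_continuous_onI)
    show ?thesis
      using u_meas continuous_imp_measurable_lebesgue_on[OF that]
      by (intro transfer[of "\<lambda>y s. s * f y"]) auto
  qed
  have abs_tr: "(LINT y|lebesgue_on B. \<bar>u y\<bar>) = (LINT y|lborel. \<bar>v y\<bar>)"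
    using u_meas by (intro transfer[of "\<lambda>y s. \<bar>s\<bar>"]) auto
  have c\<psi>: "continuous_on UNIV \<psi>" using \<psi> by (rule test_function_continuous)
  then have [measurable]: "\<psi> \<in> borel_measurable borel" by (rule borel_measurable_continuous_onI)
  obtain K where K: "compact K" "\<And>x. x \<notin> K \<Longrightarrow> \<psi> x = 0"
    using test_function_support[OF \<psi>] by metis
  have i\<psi>: "integrable lborel \<psi>"
    using K c\<psi> by (intro integrable_compact_support[of _ K] compact_imp_bounded)
  obtain R where "\<And>x::'a. \<bar>mollifier x\<bar> \<le> R"
    using test_function_bounded[OF mollifier_test_function] by metis
  then have R: "\<bar>scaled_mollifier t a y\<bar> \<le> R / t ^ DIM('a)" for a y :: 'a
    using t by (simp add: scaled_mollifier_def divide_right_mono)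
  have k_meas: "(\<lambda>p. scaled_mollifier t (fst p) (snd p)) \<in> borel_measurable (lborel \<Otimes>\<^sub>M (lborel :: 'a measure))"
  proof -
    have "continuous_on UNIV (\<lambda>p::'a \<times> 'a. scaled_mollifier t (fst p) (snd p))"
      by (intro continuous_scaled_mollifier continuous_intros)
    then have "(\<lambda>p::'a \<times> 'a. scaled_mollifier t (fst p) (snd p)) \<in> borel_measurable borel"
      by (rule borel_measurable_continuous_onI)
    then show ?thesis by (simp add: lborel_prod)
  qed
  define f where "f a y = v y * scaled_mollifier t a y * \<psi> a" for a y
  \<comment> \<open>The kernel is bounded at fixed \<open>t\<close>, so a multiple of the product of
    \<open>\<psi>\<close> and \<open>v\<close> in separate variables is a majorant.\<close>
  have f: "integrable (lborel \<Otimes>\<^sub>M lborel) (case_prod f)"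
  proof (rule Bochner_Integration.integrable_bound)
    show "integrable (lborel \<Otimes>\<^sub>M lborel) (\<lambda>p. (R / t ^ DIM('a)) * (\<psi> (fst p) * v (snd p)))"
    proof (intro integrable_mult_right lborel_pair.Fubini_integrable)
      show "integrable lborel (\<lambda>a. LINT y|lborel. norm (\<psi> (fst (a, y)) * v (snd (a, y))))"
        using i\<psi> by (simp add: abs_mult)
      show "AE a in lborel. integrable lborel (\<lambda>y. \<psi> (fst (a, y)) * v (snd (a, y)))"
        using iv by simp
    qed measurable
    show "case_prod f \<in> borel_measurable (lborel \<Otimes>\<^sub>M lborel)"
      unfolding f_def split_beta' using k_meas by measurable
    show "AE p in lborel \<Otimes>\<^sub>M lborel. norm (case_prod f p) \<le> norm ((R / t ^ DIM('a)) * (\<psi> (fst p) * v (snd p)))"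
    proof (rule AE_I2)
      fix p :: "'a \<times> 'a"
      have "\<bar>scaled_mollifier t (fst p) (snd p)\<bar> * \<bar>\<psi> (fst p) * v (snd p)\<bar> \<le> \<bar>R / t ^ DIM('a)\<bar> * \<bar>\<psi> (fst p) * v (snd p)\<bar>"
        by (intro mult_right_mono order_trans[OF R abs_ge_self]) simp
      then show "norm (case_prod f p) \<le> norm ((R / t ^ DIM('a)) * (\<psi> (fst p) * v (snd p)))"
        by (simp add: f_def split_beta abs_mult mult_ac)
    qed
  qed
  define w where "w y = (LINT a|lborel. scaled_mollifier t a y * \<psi> a)" for y
  have fw: "(LINT a|lborel. f a y) = v y * w y" for y
    by (simp add: f_def w_def mult.assoc)
  have ivw: "integrable lborel (\<lambda>y. v y * w y)"
    using lborel_pair.integrable_snd[OF f] by (simp add: fw)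
  have iv\<psi>: "integrable lborel (\<lambda>y. v y * \<psi> y)"
  proof -
    obtain b where b: "\<And>x. \<bar>\<psi> x\<bar> \<le> b" using test_function_bounded[OF \<psi>] by metis
    show ?thesis
    proof (rule Bochner_Integration.integrable_bound)
      show "integrable lborel (\<lambda>y. b * v y)" using iv by simp
      have "\<bar>v y\<bar> * \<bar>\<psi> y\<bar> \<le> \<bar>b\<bar> * \<bar>v y\<bar>" for y
        using b[of y] by (simp add: mult.commute mult_right_mono)
      then show "AE y in lborel. norm (v y * \<psi> y) \<le> norm (b * v y)"
        by (simp add: abs_mult)
    qed measurable
  qed
  \<comment> \<open>Fubini moves the smoothing from \<open>u\<close> onto \<open>\<psi>\<close>,
    where the Lipschitz bound controls it.\<close>
  have "(LINT a|lborel. smoothed u t a * \<psi> a) = (LINT a|lborel. LINT y|lborel. f a y)"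
    unfolding smoothed_def B_def[symmetric] f_def
    by (subst tr) (auto intro!: continuous_scaled_mollifier continuous_intros)
  also have "\<dots> = (LINT y|lborel. LINT a|lborel. f a y)"
    by (rule lborel_pair.Fubini_integral[OF f, symmetric])
  finally have "(LINT a|lborel. smoothed u t a * \<psi> a) - c * (LINT y|lebesgue_on B. u y * \<psi> y) =
      (LINT y|lborel. v y * w y) - (LINT y|lborel. c * (v y * \<psi> y))"
    by (simp add: fw tr[OF c\<psi>])
  also have "\<dots> = (LINT y|lborel. v y * (w y - c * \<psi> y))"
    using ivw iv\<psi> by (subst Bochner_Integration.integral_diff[symmetric]) (auto simp: algebra_simps)
  finally have "\<bar>(LINT a|lborel. smoothed u t a * \<psi> a) - c * (LINT y|lebesgue_on B. u y * \<psi> y)\<bar> \<le>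
      (LINT y|lborel. \<bar>v y * (w y - c * \<psi> y)\<bar>)"
    by (simp only: integral_abs_bound)
  also have "\<dots> \<le> (LINT y|lborel. c * (L * t) * \<bar>v y\<bar>)"
  proof (rule integral_mono)
    have "integrable lborel (\<lambda>y. v y * w y - c * (v y * \<psi> y))"
      using ivw iv\<psi> by simp
    then show "integrable lborel (\<lambda>y. \<bar>v y * (w y - c * \<psi> y)\<bar>)"
      by (intro integrable_abs) (simp add: algebra_simps)
    show "integrable lborel (\<lambda>y. c * (L * t) * \<bar>v y\<bar>)" using iv by simp
    fix y
    have "\<bar>w y - c * \<psi> y\<bar> \<le> c * (L * t)"
      unfolding w_def c_def by (rule scaled_mollifier_convolution[OF \<psi> L t])
    then have "\<bar>w y - c * \<psi> y\<bar> * \<bar>v y\<bar> \<le> c * (L * t) * \<bar>v y\<bar>" by (rule mult_right_mono) simp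
    then show "\<bar>v y * (w y - c * \<psi> y)\<bar> \<le> c * (L * t) * \<bar>v y\<bar>" by (simp add: abs_mult mult.commute)
  qed
  also have "\<dots> = c * (L * t) * (LINT y|lebesgue_on B. \<bar>u y\<bar>)"
    by (simp add: abs_tr)
  finally show ?thesis by (simp add: c_def B_def)
qed

text \<open>Lipschitz continuity of the kernel in its center, then Cauchy-Schwarz. The constant
  depends on \<open>t\<close>: it enters the final estimate only at \<open>t = 1/2\<close>, and at
  other scales it merely gives continuity.\<close>

lemma smoothed_lipschitz:
  assumes "0 < t"
  obtains C where "0 \<le> C"
    "\<And>u x y. L2_on (ball 0 1) u \<Longrightarrow>
      \<bar>smoothed u t x - smoothed u t (y :: 'a::euclidean_space)\<bar> \<le> C * L2_norm_on (ball 0 1) u * norm (x - y)"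
proof -
  obtain L where L: "0 < L" "\<And>x y. \<bar>mollifier x - mollifier (y :: 'a)\<bar> \<le> L * norm (x - y)"
    using test_function_lipschitz[OF mollifier_test_function] by metis
  define D where "D = L / t ^ Suc DIM('a)"
  have D: "0 \<le> D" using L assms by (simp add: D_def)
  define s where "s = sqrt (measure lebesgue (ball (0 :: 'a) 1))"
  have k: "\<bar>scaled_mollifier t x z - scaled_mollifier t y z\<bar> \<le> D * norm (x - y)" for x y z :: 'a
  proof -
    have "\<bar>scaled_mollifier t x z - scaled_mollifier t y z\<bar> =
        \<bar>mollifier ((1 / t) *\<^sub>R (z - x)) - mollifier ((1 / t) *\<^sub>R (z - y))\<bar> / t ^ DIM('a)"
      using assms by (simp add: scaled_mollifier_def flip: diff_divide_distrib)
    also have "\<dots> \<le> (L * norm ((1 / t) *\<^sub>R (z - x) - (1 / t) *\<^sub>R (z - y))) / t ^ DIM('a)"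
      using assms by (intro divide_right_mono L) simp
    also have "(1 / t) *\<^sub>R (z - x) - (1 / t) *\<^sub>R (z - y) = (1 / t) *\<^sub>R (y - x)"
      by (simp add: algebra_simps)
    finally show ?thesis
      using assms by (simp add: D_def norm_minus_commute mult.commute)
  qed
  have "\<bar>smoothed u t x - smoothed u t y\<bar> \<le> (D * s) * L2_norm_on (ball 0 1) u * norm (x - y)"
    if u: "L2_on (ball 0 1) u" for u and x y :: 'a
  proof -
    define q where "q z = scaled_mollifier t x z - scaled_mollifier t y z" for z
    have q: "L2_on (ball 0 1) q"
      unfolding q_def[abs_def] by (intro L2_on_diff L2_on_scaled_mollifier)
    have "smoothed u t x - smoothed u t y = L2_inner (ball 0 1) u q"
      using L2_inner_lincomb_right[OF u L2_on_scaled_mollifier L2_on_scaled_mollifier, of t x "-1" t y]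
      by (simp add: smoothed_def L2_inner_def q_def)
    then have "\<bar>smoothed u t x - smoothed u t y\<bar> \<le> L2_norm_on (ball 0 1) u * L2_norm_on (ball 0 1) q"
      using L2_Cauchy_Schwarz[OF u q] by simp
    also have "\<dots> \<le> L2_norm_on (ball 0 1) u * ((D * norm (x - y)) * s)"
      unfolding s_def using k D q
      by (intro mult_left_mono L2_norm_on_le_bound L2_norm_on_nonneg) (auto simp: q_def L2_on_def)
    finally show ?thesis by (simp add: mult_ac)
  qed
  moreover have "0 \<le> D * s" using D by (simp add: s_def)
  ultimately show thesis using that by blast
qed

lemma measure_cball_scaling:
  "0 \<le> t \<Longrightarrow> measure lebesgue (cball (a :: 'a::euclidean_space) t) = t ^ DIM('a) * measure lebesgue (cball (0 :: 'a) 1)"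
  by (simp add: content_cball)

text \<open>Both bounds reduce by scaling to \<open>potential 1 0\<close>, whose gradient is bounded
  and Lipschitz.\<close>

lemma grad_potential_bounds:
  obtains V where "0 < V"
    "\<And>t a x. 0 < t \<Longrightarrow> norm (grad (potential t a) (x :: 'a::euclidean_space)) \<le> V / t ^ DIM('a)"
    "\<And>t a b x. 0 < t \<Longrightarrow> norm (grad (potential t a) (x :: 'a) - grad (potential t b) x) \<le> V * norm (a - b) / t ^ Suc DIM('a)"
proof -
  have tf: "test_function UNIV (potential 1 (0 :: 'a))"
    by (rule potential_test_function) auto
  obtain V1 where V1: "0 < V1" "\<And>x. norm (grad (potential 1 (0 :: 'a)) x) \<le> V1"
    using test_function_bounded[OF tf] by metis
  obtain V2 where V2: "0 < V2" "\<And>x y. norm (grad (potential 1 (0 :: 'a)) x - grad (potential 1 0) y) \<le> V2 * norm (x - y)"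
    using test_function_grad_lipschitz[OF tf] by metis
  have scale: "grad (potential t a) x = (1 / t ^ DIM('a)) *\<^sub>R grad (potential 1 0) ((1 / t) *\<^sub>R (x - a))" if "0 < t" for t a and x :: 'a
    using that by (simp add: grad_potential)
  show thesis
  proof (rule that[of "V1 + V2"])
    fix t :: real and a b x :: 'a assume t: "0 < t"
    have "norm (grad (potential 1 0) ((1 / t) *\<^sub>R (x - a))) \<le> V1 + V2"
      using V1(2)[of "(1 / t) *\<^sub>R (x - a)"] V2(1) by linarith
    then show "norm (grad (potential t a) x) \<le> (V1 + V2) / t ^ DIM('a)"
      using t by (simp add: scale[OF t] divide_right_mono)
    have "norm (grad (potential t a) x - grad (potential t b) x) =
        norm (grad (potential 1 0) ((1 / t) *\<^sub>R (x - a)) - grad (potential 1 0) ((1 / t) *\<^sub>R (x - b))) / t ^ DIM('a)"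
      using t by (simp add: scale[OF t] flip: scaleR_diff_right)
    also have "\<dots> \<le> (V2 * norm ((1 / t) *\<^sub>R (x - a) - (1 / t) *\<^sub>R (x - b))) / t ^ DIM('a)"
      using t by (intro divide_right_mono V2) simp
    also have "(1 / t) *\<^sub>R (x - a) - (1 / t) *\<^sub>R (x - b) = (1 / t) *\<^sub>R (b - a)"
      by (simp add: algebra_simps)
    also have "(V2 * norm ((1 / t) *\<^sub>R (b - a))) / t ^ DIM('a) = V2 * norm (a - b) / t ^ Suc DIM('a)"
      using t by (simp add: norm_minus_commute)
    also have "\<dots> \<le> (V1 + V2) * norm (a - b) / t ^ Suc DIM('a)"
      using V1(1) t by (intro divide_right_mono mult_right_mono) auto
    finally show "norm (grad (potential t a) x - grad (potential t b) x) \<le> (V1 + V2) * norm (a - b) / t ^ Suc DIM('a)" .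
  qed (use V1 V2 in simp)
qed

section \<open>The logarithmic modulus of continuity\<close>

text \<open>The two derivative bounds say that \<open>smoothed u t\<close> converges at a linear rate as \<open>t\<close> tends
  to \<open>0\<close>, while its increments over a distance \<open>r\<close> change only at rate \<open>r / t\<close>;
  integrating the latter down to \<open>t = r\<close> produces the logarithm.\<close>

lemma smoothed_derivative_bounds:
  assumes M: "0 \<le> M"
  obtains C where "0 < C"
    "\<And>\<sigma> u t x. \<sigma> \<in> borel_measurable borel \<Longrightarrow> (\<And>s. \<bar>\<sigma> s\<bar> \<le> M) \<Longrightarrow> local_minimizer \<sigma> u \<Longrightarrow>
      0 < t \<Longrightarrow> t \<le> 1/2 \<Longrightarrow> (x :: 'a::euclidean_space) \<in> ball 0 (1/2) \<Longrightarrow>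
      \<exists>D. ((\<lambda>t. smoothed u t x) has_real_derivative D) (at t) \<and> \<bar>D\<bar> \<le> C"
    "\<And>\<sigma> u t x y. \<sigma> \<in> borel_measurable borel \<Longrightarrow> (\<And>s. \<bar>\<sigma> s\<bar> \<le> M) \<Longrightarrow> local_minimizer \<sigma> u \<Longrightarrow>
      0 < t \<Longrightarrow> t \<le> 1/2 \<Longrightarrow> (x :: 'a) \<in> ball 0 (1/2) \<Longrightarrow> y \<in> ball 0 (1/2) \<Longrightarrow> x \<noteq> y \<Longrightarrow>
      \<exists>D. ((\<lambda>t. smoothed u t x - smoothed u t y) has_real_derivative D) (at t) \<and> \<bar>D\<bar> \<le> C * norm (x - y) / t"
proof -
  obtain V where V: "0 < V"
    "\<And>t a x. 0 < t \<Longrightarrow> norm (grad (potential t a) (x :: 'a)) \<le> V / t ^ DIM('a)"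
    "\<And>t a b x. 0 < t \<Longrightarrow> norm (grad (potential t a) (x :: 'a) - grad (potential t b) x) \<le> V * norm (a - b) / t ^ Suc DIM('a)"
    by (rule grad_potential_bounds[where 'a='a]) blast
  define \<omega> where "\<omega> = measure lebesgue (cball (0 :: 'a) 1)"
  have \<omega>: "0 \<le> \<omega>" by (simp add: \<omega>_def)
  \<comment> \<open>The gradient bound \<open>V / t ^ DIM('a)\<close> times the volume
    \<open>\<omega> * t ^ DIM('a)\<close> of the support is free of \<open>t\<close>.\<close>
  define E where "E = (1/2 + 2 * M) * V * \<omega>"
  \<comment> \<open>The factor 2 accounts for the two balls supporting a difference of potentials;
    the added 1 ensures positivity.\<close>
  define C where "C = 2 * E + 1"
  have "0 \<le> E" using M V(1) \<omega> by (simp add: E_def)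
  then have C: "0 < C" "E \<le> C" "2 * E \<le> C" by (auto simp: C_def)
  have sub: "cball x t \<subseteq> ball 0 1" if "t \<le> 1/2" "x \<in> ball 0 (1/2)" for x :: 'a and t
  proof
    fix z assume "z \<in> cball x t"
    then show "z \<in> ball 0 1" using that dist_triangle[of 0 z x] by simp
  qed
  show thesis
  proof (rule that[OF C(1)])
    fix \<sigma> and u :: "'a \<Rightarrow> real" and t :: real and x :: 'a
    assume \<sigma>: "\<sigma> \<in> borel_measurable borel" "\<And>s. \<bar>\<sigma> s\<bar> \<le> M" and min: "local_minimizer \<sigma> u"
      and t: "0 < t" "t \<le> 1/2" and x: "x \<in> ball 0 (1/2)"
    obtain g where u: "L2_on (ball 0 1) u" and g: "L2_on (ball 0 1) g" "weak_gradient_on (ball 0 1) u g"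
      using min by (auto simp: local_minimizer_def H1_def)
    note px = potential_test_function[OF t(1) sub[OF t(2) x]]
    have "\<bar>L2_inner (ball 0 1) g (grad (potential t x))\<bar> \<le> (1/2 + 2 * M) * (V / t ^ DIM('a)) * measure lebesgue (cball x t)"
      using potential_outside[OF t(1)] V t
      by (intro local_minimizer_almost_harmonic[OF min \<sigma> g px]) auto
    also have "\<dots> = E"
      unfolding measure_cball_scaling[OF less_imp_le[OF t(1)], of x] using t by (simp add: \<omega>_def E_def)
    finally have "\<bar>L2_inner (ball 0 1) g (grad (potential t x))\<bar> \<le> C" using C(2) by linarith
    with smoothed_DERIV[OF u g t(1) sub[OF t(2) x]]
    show "\<exists>D. ((\<lambda>t. smoothed u t x) has_real_derivative D) (at t) \<and> \<bar>D\<bar> \<le> C" by blast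
  next
    fix \<sigma> and u :: "'a \<Rightarrow> real" and t :: real and x y :: 'a
    assume \<sigma>: "\<sigma> \<in> borel_measurable borel" "\<And>s. \<bar>\<sigma> s\<bar> \<le> M" and min: "local_minimizer \<sigma> u"
      and t: "0 < t" "t \<le> 1/2" and x: "x \<in> ball 0 (1/2)" and y: "y \<in> ball 0 (1/2)" and "x \<noteq> y"
    obtain g where u: "L2_on (ball 0 1) u" and g: "L2_on (ball 0 1) g" "weak_gradient_on (ball 0 1) u g"
      using min by (auto simp: local_minimizer_def H1_def)
    note px = potential_test_function[OF t(1) sub[OF t(2) x]] and py = potential_test_function[OF t(1) sub[OF t(2) y]]
    \<comment> \<open>The two potentials are tested together: separate bounds would lose the factor
      \<open>norm (x - y) / t\<close>.\<close>
    define \<psi> where "\<psi> z = potential t x z + (-1) * potential t y z" for z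
    have \<psi>: "test_function (ball 0 1) \<psi>"
      unfolding \<psi>_def[abs_def] by (intro test_function_add test_function_cmult px py)
    have g\<psi>: "grad \<psi> z = grad (potential t x) z + (-1) *\<^sub>R grad (potential t y) z" for z
      unfolding \<psi>_def[abs_def] by (rule grad_linear[OF px py])
    have b: "(ball 0 1 :: 'a set) \<in> lmeasurable" by simp
    define A where "A = cball x t \<union> cball y t"
    have A: "A \<in> lmeasurable" by (auto simp: A_def)
    have "measure lebesgue A \<le> measure lebesgue (cball x t) + measure lebesgue (cball y t)"
      unfolding A_def by (rule measure_Un_le) auto
    then have mA: "measure lebesgue A \<le> 2 * \<omega> * t ^ DIM('a)"
      using t measure_cball_scaling[of t x] measure_cball_scaling[of t y] by (simp add: \<omega>_def mult_ac)
    define Q where "Q = V * norm (x - y) / t ^ Suc DIM('a)"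
    have Q: "0 < Q" using V(1) t \<open>x \<noteq> y\<close> by (simp add: Q_def)
    have "\<bar>L2_inner (ball 0 1) g (grad \<psi>)\<bar> \<le> (1/2 + 2 * M) * Q * measure lebesgue A"
    proof (rule local_minimizer_almost_harmonic[OF min \<sigma> g \<psi> A])
      show "\<psi> z = 0" "grad \<psi> z = 0" if "z \<notin> A" for z
        using that potential_outside[OF t(1), of z x] potential_outside[OF t(1), of z y]
        by (auto simp: A_def \<psi>_def g\<psi>)
      show "norm (grad \<psi> z) \<le> Q" for z
        using V(3)[OF t(1), of x z y] by (simp add: g\<psi> Q_def)
    qed (fact Q)
    also have "\<dots> \<le> (1/2 + 2 * M) * Q * (2 * \<omega> * t ^ DIM('a))"
      using mA M Q by (intro mult_left_mono) auto
    also have "\<dots> = 2 * E * (norm (x - y) / t)"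
      using t by (simp add: Q_def E_def)
    also have "\<dots> \<le> C * (norm (x - y) / t)"
      using C(3) t by (intro mult_right_mono) auto
    finally have 1: "\<bar>L2_inner (ball 0 1) g (grad \<psi>)\<bar> \<le> C * norm (x - y) / t" by simp
    have "L2_inner (ball 0 1) g (grad \<psi>) = L2_inner (ball 0 1) g (grad (potential t x)) - L2_inner (ball 0 1) g (grad (potential t y))"
      unfolding g\<psi>[abs_def]
      using L2_inner_lincomb_right[OF g(1) L2_on_test_function(2)[OF px b] L2_on_test_function(2)[OF py b], of "-1"] by simp
    then have "((\<lambda>t. smoothed u t x - smoothed u t y) has_real_derivative L2_inner (ball 0 1) g (grad \<psi>)) (at t)"
      using DERIV_diff[OF smoothed_DERIV[OF u g t(1) sub[OF t(2) x]] smoothed_DERIV[OF u g t(1) sub[OF t(2) y]]] by simp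
    with 1 show "\<exists>D. ((\<lambda>t. smoothed u t x - smoothed u t y) has_real_derivative D) (at t) \<and> \<bar>D\<bar> \<le> C * norm (x - y) / t"
      by blast
  qed
qed

text \<open>The representative is the limit of \<open>smoothed u t\<close> as \<open>t\<close> tends
  to 0, divided by the mass. This is the inhomogeneous estimate, before the lower bound on the norm
  of \<open>u\<close> is used.\<close>

lemma local_minimizer_log_lipschitz:
  assumes M: "0 \<le> M"
  obtains C where "0 < C"
    "\<And>\<sigma> u. \<sigma> \<in> borel_measurable borel \<Longrightarrow> (\<And>s. \<bar>\<sigma> s\<bar> \<le> M) \<Longrightarrow> local_minimizer \<sigma> (u :: 'a::euclidean_space \<Rightarrow> real) \<Longrightarrow>
      \<exists>w. (AE x in lebesgue_on (ball 0 (1/2)). w x = u x) \<and>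
        (\<forall>x\<in>ball 0 (1/2). \<forall>y\<in>ball 0 (1/2). x \<noteq> y \<longrightarrow>
          \<bar>w x - w y\<bar> \<le> C * (1 + L2_norm_on (ball 0 1) u) * norm (x - y) + C * norm (x - y) * max 0 (ln (1 / norm (x - y))))"
proof -
  obtain C1 where C1: "0 < C1"
    "\<And>\<sigma> u t x. \<sigma> \<in> borel_measurable borel \<Longrightarrow> (\<And>s. \<bar>\<sigma> s\<bar> \<le> M) \<Longrightarrow> local_minimizer \<sigma> u \<Longrightarrow>
      0 < t \<Longrightarrow> t \<le> 1/2 \<Longrightarrow> (x :: 'a) \<in> ball 0 (1/2) \<Longrightarrow>
      \<exists>D. ((\<lambda>t. smoothed u t x) has_real_derivative D) (at t) \<and> \<bar>D\<bar> \<le> C1"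
    "\<And>\<sigma> u t x y. \<sigma> \<in> borel_measurable borel \<Longrightarrow> (\<And>s. \<bar>\<sigma> s\<bar> \<le> M) \<Longrightarrow> local_minimizer \<sigma> u \<Longrightarrow>
      0 < t \<Longrightarrow> t \<le> 1/2 \<Longrightarrow> (x :: 'a) \<in> ball 0 (1/2) \<Longrightarrow> y \<in> ball 0 (1/2) \<Longrightarrow> x \<noteq> y \<Longrightarrow>
      \<exists>D. ((\<lambda>t. smoothed u t x - smoothed u t y) has_real_derivative D) (at t) \<and> \<bar>D\<bar> \<le> C1 * norm (x - y) / t"
    by (rule smoothed_derivative_bounds[OF M, where 'a='a]) blast
  obtain C2 where C2: "0 \<le> C2" "\<And>u x y. L2_on (ball 0 1) u \<Longrightarrow>
      \<bar>smoothed u (1/2) x - smoothed u (1/2) (y :: 'a)\<bar> \<le> C2 * L2_norm_on (ball 0 1) u * norm (x - y)"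
    using smoothed_lipschitz[of "1/2", where 'a='a] by auto
  define m where "m = mollifier_mass TYPE('a)"
  have m: "0 < m" by (simp add: m_def mollifier_mass_pos)
  define C where "C = (2 * C1 + C2) / m"
  have C: "0 < C" using C1(1) C2(1) m by (simp add: C_def)
  have "\<exists>w. (AE x in lebesgue_on (ball 0 (1/2)). w x = u x) \<and>
        (\<forall>x\<in>ball 0 (1/2). \<forall>y\<in>ball 0 (1/2). x \<noteq> y \<longrightarrow>
          \<bar>w x - w y\<bar> \<le> C * (1 + L2_norm_on (ball 0 1) u) * norm (x - y) + C * norm (x - y) * max 0 (ln (1 / norm (x - y))))"
    if \<sigma>: "\<sigma> \<in> borel_measurable borel" "\<And>s. \<bar>\<sigma> s\<bar> \<le> M" and min: "local_minimizer \<sigma> u" for \<sigma> and u :: "'a \<Rightarrow> real"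
  proof -
    define B' where "B' = ball (0::'a) (1/2)"
    have B': "open B'" "bounded B'" by (auto simp: B'_def)
    note mB' = bounded_open_lmeasurable[OF B']
    have u: "L2_on (ball 0 1) u" using min by (simp add: local_minimizer_def H1_def)
    have lin: "\<bar>smoothed u s x - smoothed u t x\<bar> \<le> C1 * \<bar>s - t\<bar>"
      if "s \<in> {0<..1/2}" "t \<in> {0<..1/2}" "x \<in> B'" for s t x
    proof -
      have "\<exists>D. \<forall>t\<in>{0<..1/2}. ((\<lambda>t. smoothed u t x) has_real_derivative D t) (at t) \<and> \<bar>D t\<bar> \<le> C1"
        using C1(2)[OF \<sigma> min] that(3) unfolding B'_def by (intro bchoice) auto
      then obtain D where D: "\<And>t. t \<in> {0<..1/2} \<Longrightarrow> ((\<lambda>t. smoothed u t x) has_real_derivative D t) (at t)"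
        "\<And>t. t \<in> {0<..1/2} \<Longrightarrow> \<bar>D t\<bar> \<le> C1" by blast
      have "norm (smoothed u s x - smoothed u t x) \<le> C1 * norm (s - t)"
        by (rule field_differentiable_bound[of "{0<..1/2}"]) (use D that in \<open>auto intro: DERIV_subset\<close>)
      then show ?thesis by simp
    qed
    \<comment> \<open>A null sequence of admissible scales; the shift by 2 puts already the first
      term at 1/2.\<close>
    define a where "a i = 1 / real (i + 2)" for i :: nat
    have a: "a i \<in> {0<..1/2}" for i by (auto simp: a_def field_simps)
    have a0: "a \<longlonglongrightarrow> 0" unfolding a_def by (rule LIMSEQ_ignore_initial_segment[OF lim_1_over_n])
    have conv: "convergent (\<lambda>i. smoothed u (a i) x)" if x: "x \<in> B'" for x
    proof (rule Cauchy_convergent, rule metric_CauchyI)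
      fix e :: real assume "0 < e"
      then have "0 < e / C1" using C1 by simp
      then obtain N where N: "\<And>i j. i \<ge> N \<Longrightarrow> j \<ge> N \<Longrightarrow> dist (a i) (a j) < e / C1"
        using metric_CauchyD[OF LIMSEQ_imp_Cauchy[OF a0]] by metis
      have "dist (smoothed u (a i) x) (smoothed u (a j) x) < e" if "i \<ge> N" "j \<ge> N" for i j
      proof -
        have "C1 * \<bar>a i - a j\<bar> < e"
          using N[OF that] C1(1) by (simp add: dist_real_def field_simps)
        then show ?thesis using lin[OF a a x, of i j] by (simp add: dist_real_def)
      qed
      then show "\<exists>N. \<forall>i\<ge>N. \<forall>j\<ge>N. dist (smoothed u (a i) x) (smoothed u (a j) x) < e" by blast
    qed
    define W where "W x = lim (\<lambda>i. smoothed u (a i) x)" for x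
    have W: "(\<lambda>i. smoothed u (a i) x) \<longlonglongrightarrow> W x" if "x \<in> B'" for x
      using conv[OF that] by (simp add: W_def convergent_LIMSEQ_iff)
    have W_close: "\<bar>smoothed u t x - W x\<bar> \<le> C1 * t" if t: "t \<in> {0<..1/2}" and x: "x \<in> B'" for t x
    proof (rule LIMSEQ_le)
      show "(\<lambda>i. \<bar>smoothed u t x - smoothed u (a i) x\<bar>) \<longlonglongrightarrow> \<bar>smoothed u t x - W x\<bar>"
        by (intro tendsto_intros W x)
      have "(\<lambda>i. C1 * \<bar>t - a i\<bar>) \<longlonglongrightarrow> C1 * \<bar>t - 0\<bar>"
        by (intro tendsto_intros a0)
      then show "(\<lambda>i. C1 * \<bar>t - a i\<bar>) \<longlonglongrightarrow> C1 * t" using t by simp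
      show "\<exists>N. \<forall>n\<ge>N. \<bar>smoothed u t x - smoothed u (a n) x\<bar> \<le> C1 * \<bar>t - a n\<bar>"
        using lin[OF t a x] by blast
    qed
    have cont: "continuous_on UNIV (smoothed u t)" if t: "0 < t" for t
    proof -
      obtain c where "0 \<le> c" "\<And>x y. \<bar>smoothed u t x - smoothed u t y\<bar> \<le> c * L2_norm_on (ball 0 1) u * norm (x - y)"
        using smoothed_lipschitz[OF t, where 'a='a] u by metis
      then have "(c * L2_norm_on (ball 0 1) u)-lipschitz_on UNIV (smoothed u t)"
        by (intro lipschitz_onI) (auto simp: dist_norm L2_norm_on_nonneg)
      then show ?thesis by (rule lipschitz_on_continuous_on)
    qed
    have W_meas: "W \<in> borel_measurable (lebesgue_on B')"
      by (rule borel_measurable_LIMSEQ_real[of _ "\<lambda>i. smoothed u (a i)"])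
        (use W a in \<open>auto intro!: continuous_imp_measurable_lebesgue_on cont\<close>)
    have W_L2: "L2_on B' W"
    proof (rule L2_on_bounded[OF mB' W_meas])
      fix x assume x: "x \<in> B'"
      have "\<bar>smoothed u (1/2) x - smoothed u (1/2) 0\<bar> \<le> C2 * L2_norm_on (ball 0 1) u * norm (x - 0)"
        by (rule C2(2)[OF u])
      also have "\<dots> \<le> C2 * L2_norm_on (ball 0 1) u * 1"
        using x C2(1) L2_norm_on_nonneg[of "ball 0 1" u] by (intro mult_left_mono) (auto simp: B'_def)
      finally show "norm (W x) \<le> C2 * L2_norm_on (ball 0 1) u + \<bar>smoothed u (1/2) 0\<bar> + C1 * (1/2)"
        using W_close[OF _ x, of "1/2"] unfolding real_norm_def
        by (simp only: greaterThanAtMost_iff) linarith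
    qed
    have uB': "L2_on B' u"
    proof -
      have "B' \<subseteq> ball 0 1" by (auto simp: B'_def)
      then have r: "lebesgue_on B' = restrict_space (lebesgue_on (ball 0 1)) B'"
        using mB' by (subst restrict_restrict_space) (auto simp: Int_absorb1)
      have i: "integrable (lebesgue_on (ball 0 1)) (\<lambda>x. (norm (u x))\<^sup>2)" and um: "u \<in> borel_measurable (lebesgue_on (ball 0 1))"
        using u by (auto simp: L2_on_def)
      have s: "B' \<in> sets (lebesgue_on (ball 0 1))"
        using \<open>B' \<subseteq> ball 0 1\<close> B' by (auto simp: sets_restrict_space_iff borel_open lborelD)
      show ?thesis
        unfolding L2_on_def r
      proof
        show "u \<in> borel_measurable (restrict_space (lebesgue_on (ball 0 1)) B')"
          by (rule measurable_restrict_space1[OF um])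
        have "integrable (lebesgue_on (ball 0 1)) (\<lambda>x. indicator B' x *\<^sub>R (norm (u x))\<^sup>2)"
          by (rule integrable_mult_indicator[OF s i])
        then show "integrable (restrict_space (lebesgue_on (ball 0 1)) B') (\<lambda>x. (norm (u x))\<^sup>2)"
          by (rule integrable_restrict_space[THEN iffD2, rotated]) (use s in auto)
      qed
    qed
    \<comment> \<open>The limit is the mass times \<open>u\<close>, tested weakly: the uniform
      convergence to \<open>W\<close> and the weak limit of \<open>smoothed_weak_limit\<close> must
      agree.\<close>
    have ae: "AE x in lebesgue_on B'. W x + (- m) *\<^sub>R u x = 0"
    proof (rule AE_zero_of_test_functions[OF B' L2_on_lincomb[OF W_L2 uB']])
      fix \<psi> assume \<psi>: "test_function B' \<psi>"
      note \<psi>2 = L2_on_test_function(1)[OF \<psi> mB']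
      have cp: "continuous_on UNIV \<psi>" using \<psi> by (rule test_function_continuous)
      have out: "\<psi> x = 0" if "x \<notin> B'" for x
        using test_function_support[OF \<psi>] that by (metis subsetD)
      obtain L where L: "0 < L" "\<And>x y. \<bar>\<psi> x - \<psi> y\<bar> \<le> L * norm (x - y)"
        using test_function_lipschitz[OF \<psi>] by metis
      have uball: "(LINT y|lebesgue_on (ball 0 1). u y * \<psi> y) = L2_inner B' u \<psi>"
      proof -
        have "(LINT y|lebesgue_on (ball 0 1). u y * \<psi> y) = (LINT y|lebesgue. indicator (ball 0 1) y *\<^sub>R (u y * \<psi> y))"
          by (rule integral_restrict_space) simp
        also have "(\<lambda>y. indicator (ball 0 1) y *\<^sub>R (u y * \<psi> y)) = (\<lambda>y. indicator B' y *\<^sub>R (u y * \<psi> y))"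
          using out by (auto simp: fun_eq_iff indicator_def B'_def)
        also have "(LINT y|lebesgue. indicator B' y *\<^sub>R (u y * \<psi> y)) = (LINT y|lebesgue_on B'. u y * \<psi> y)"
          by (rule integral_restrict_space[symmetric]) (simp add: B'_def)
        finally show ?thesis by (simp add: L2_inner_def)
      qed
      define X where "X = L2_inner B' W \<psi> - m * L2_inner B' u \<psi>"
      define D where "D = C1 * (LINT x|lebesgue_on B'. \<bar>\<psi> x\<bar>) + m * L * (LINT y|lebesgue_on (ball 0 1). \<bar>u y\<bar>)"
      \<comment> \<open>Both approximations err by a multiple of \<open>t\<close>, so the constant
        \<open>X\<close> is at most \<open>D * t\<close> for all small \<open>t\<close>, hence
        0.\<close>
      have XD: "\<bar>X\<bar> \<le> D * t" if t: "t \<in> {0<..1/2}" for t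
      proof -
        have sL2: "L2_on B' (smoothed u t)"
        proof -
          have "compact (smoothed u t ` cball 0 (1/2))"
            using cont t by (intro compact_continuous_image) (auto intro: continuous_on_subset)
          then obtain b where "\<forall>x\<in>cball 0 (1/2). norm (smoothed u t x) \<le> b"
            by (auto dest!: compact_imp_bounded simp: bounded_iff)
          then show ?thesis
            using cont t by (intro L2_on_bounded[OF mB' continuous_imp_measurable_lebesgue_on, of _ b]) (auto simp: B'_def)
        qed
        have "(LINT a|lborel. smoothed u t a * \<psi> a) = L2_inner B' (smoothed u t) \<psi>"
          unfolding L2_inner_def inner_real_def using mB' out cp cont t
          by (intro lebesgue_on_integral_eq[symmetric] borel_measurable_continuous_onI continuous_intros) auto
        then have 1: "\<bar>L2_inner B' (smoothed u t) \<psi> - m * L2_inner B' u \<psi>\<bar> \<le> m * (L * t) * (LINT y|lebesgue_on (ball 0 1). \<bar>u y\<bar>)"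
          using smoothed_weak_limit[OF u \<psi> L(2) less_imp_le[OF L(1)], of t] t by (simp add: uball m_def)
        have "\<bar>L2_inner B' (smoothed u t) \<psi> - L2_inner B' W \<psi>\<bar> = \<bar>LINT x|lebesgue_on B'. (smoothed u t x - W x) * \<psi> x\<bar>"
          using L2_inner_lincomb_left[OF \<psi>2 sL2 W_L2, of "-1"] by (simp add: L2_inner_def)
        also have "\<dots> \<le> (LINT x|lebesgue_on B'. \<bar>(smoothed u t x - W x) * \<psi> x\<bar>)"
          by (rule integral_abs_bound)
        also have "\<dots> \<le> (LINT x|lebesgue_on B'. C1 * t * \<bar>\<psi> x\<bar>)"
        proof (rule integral_mono)
          show "integrable (lebesgue_on B') (\<lambda>x. \<bar>(smoothed u t x - W x) * \<psi> x\<bar>)"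
            using L2_on_integrable_inner[OF L2_on_diff[OF sL2 W_L2] \<psi>2] by (intro integrable_abs) simp
          have "L2_on B' (\<lambda>x. 1::real)" by (intro L2_on_bounded[where B=1] mB') auto
          from L2_on_integrable_inner[OF \<psi>2 this]
          show "integrable (lebesgue_on B') (\<lambda>x. C1 * t * \<bar>\<psi> x\<bar>)" by simp
          fix x assume "x \<in> space (lebesgue_on B')"
          then have "\<bar>smoothed u t x - W x\<bar> * \<bar>\<psi> x\<bar> \<le> C1 * t * \<bar>\<psi> x\<bar>"
            by (intro mult_right_mono W_close t) auto
          then show "\<bar>(smoothed u t x - W x) * \<psi> x\<bar> \<le> C1 * t * \<bar>\<psi> x\<bar>" by (simp add: abs_mult)
        qed
        also have "\<dots> = C1 * t * (LINT x|lebesgue_on B'. \<bar>\<psi> x\<bar>)" by simp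
        finally show ?thesis
          using 1 unfolding X_def D_def by (simp add: algebra_simps)
      qed
      have "(\<lambda>i. D * a i) \<longlonglongrightarrow> D * 0" by (intro tendsto_intros a0)
      then have "\<bar>X\<bar> \<le> D * 0"
        by (rule LIMSEQ_le_const) (use XD a in blast)
      then have "X = 0" by simp
      moreover have "(LINT x|lebesgue_on B'. (W x + (- m) *\<^sub>R u x) * \<psi> x) = X"
        using L2_inner_lincomb_left[OF \<psi>2 W_L2 uB', of "-m"] unfolding X_def by (simp add: L2_inner_def)
      ultimately show "(LINT x|lebesgue_on B'. (W x + (- m) *\<^sub>R u x) * \<psi> x) = 0" by simp
    qed
    \<comment> \<open>Passing from \<open>W\<close> to scale \<open>s\<close> costs
      \<open>C1 * r\<close> at each point, moving from \<open>s\<close> to 1/2 gives the logarithm,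
      and at scale 1/2 the smoothed function is Lipschitz.\<close>
    have est: "\<bar>W x - W y\<bar> \<le> 2 * C1 * r + C2 * L2_norm_on (ball 0 1) u * r + C1 * r * max 0 (ln (1 / r))"
      if x: "x \<in> B'" and y: "y \<in> B'" and "x \<noteq> y" and r: "r = norm (x - y)" for x y r
    proof -
      have "0 < r" using r \<open>x \<noteq> y\<close> by simp
      define h where "h t = smoothed u t x - smoothed u t y" for t
      \<comment> \<open>Two points of the half ball can be more than 1/2 apart, while the derivative
        bounds reach only up to scale 1/2.\<close>
      define s where "s = min r (1/2)"
      have s: "s \<in> {0<..1/2}" "s \<le> r" using \<open>0 < r\<close> by (auto simp: s_def)
      have 1: "\<bar>h (1/2)\<bar> \<le> C2 * L2_norm_on (ball 0 1) u * r"
        using C2(2)[OF u] by (simp add: h_def r)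
      have 2: "\<bar>h s - h (1/2)\<bar> \<le> C1 * r * (ln (1/2) - ln s)"
      proof -
        \<comment> \<open>The derivative of \<open>h\<close> is at most \<open>C1 * r / t\<close> in
          absolute value, so adding \<open>C1 * r * ln t\<close> to \<open>h\<close> or to its
          negative gives a nondecreasing function; the two signs bound the increment.\<close>
        have *: "C1 * r * ln s + \<epsilon> * h s \<le> C1 * r * ln (1/2) + \<epsilon> * h (1/2)" if \<epsilon>: "\<bar>\<epsilon>\<bar> = 1" for \<epsilon>
        proof (rule DERIV_nonneg_imp_nondecreasing[where f="\<lambda>t. C1 * r * ln t + \<epsilon> * h t"])
          fix t assume t: "s \<le> t" "t \<le> 1/2"
          then have "0 < t" using s by auto
          obtain D where D: "(h has_real_derivative D) (at t)" "\<bar>D\<bar> \<le> C1 * r / t"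
            using C1(3)[OF \<sigma> min \<open>0 < t\<close> t(2) x[unfolded B'_def] y[unfolded B'_def] \<open>x \<noteq> y\<close>] by (auto simp: h_def[abs_def] r)
          have "((\<lambda>t. C1 * r * ln t + \<epsilon> * h t) has_real_derivative (C1 * r * (1 / t) + \<epsilon> * D)) (at t)"
            by (intro DERIV_add DERIV_cmult D DERIV_ln_divide \<open>0 < t\<close>)
          moreover have "\<bar>\<epsilon> * D\<bar> \<le> C1 * r / t" using D(2) \<epsilon> by (simp add: abs_mult)
          then have "0 \<le> C1 * r * (1 / t) + \<epsilon> * D" by (simp add: abs_le_iff)
          ultimately show "\<exists>D. ((\<lambda>t. C1 * r * ln t + \<epsilon> * h t) has_real_derivative D) (at t) \<and> 0 \<le> D" by blast
        qed (use s in simp)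
        from *[of 1] *[of "-1"] show ?thesis by (simp add: abs_le_iff right_diff_distrib)
      qed
      have 3: "C1 * r * (ln (1/2) - ln s) \<le> C1 * r * max 0 (ln (1 / r))"
      proof -
        have "ln (1/2) - ln s \<le> max 0 (ln (1 / r))"
        proof (cases "r \<le> 1/2")
          case True
          then have "s = r" by (simp add: s_def)
          moreover have "ln (1/2 :: real) \<le> 0" by (simp add: ln_le_zero_iff)
          moreover have "ln (1 / r) = - ln r" using \<open>0 < r\<close> by (simp add: ln_div)
          ultimately have "ln (1/2) - ln s \<le> ln (1 / r)" by simp
          then show ?thesis by (simp add: le_max_iff_disj)
        qed (simp add: s_def)
        then show ?thesis using C1(1) \<open>0 < r\<close> by (intro mult_left_mono) auto
      qed
      have 4: "\<bar>smoothed u s x - W x\<bar> \<le> C1 * r" "\<bar>smoothed u s y - W y\<bar> \<le> C1 * r"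
      proof -
        have "C1 * s \<le> C1 * r" using s C1(1) by simp
        then show "\<bar>smoothed u s x - W x\<bar> \<le> C1 * r" "\<bar>smoothed u s y - W y\<bar> \<le> C1 * r"
          using W_close[OF s(1) x] W_close[OF s(1) y] by linarith+
      qed
      have "\<bar>h s - (W x - W y)\<bar> \<le> 2 * (C1 * r)"
        using 4 unfolding h_def by linarith
      with 1 2 3 show ?thesis by linarith
    qed
    show ?thesis
    proof (intro exI[of _ "\<lambda>x. W x / m"] conjI ballI impI)
      show "AE x in lebesgue_on (ball 0 (1/2)). W x / m = u x"
        using ae unfolding B'_def
      proof eventually_elim
        case (elim x)
        then show ?case using m by (simp add: field_simps)
      qed
      fix x y assume xy: "x \<in> ball 0 (1/2)" "y \<in> ball 0 (1/2)" "x \<noteq> (y :: 'a)"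
      define r U l where "r = norm (x - y)" and "U = L2_norm_on (ball 0 1) u" and "l = max 0 (ln (1 / r))"
      have nn: "0 \<le> r" "0 \<le> U" "0 \<le> l" by (auto simp: r_def U_def l_def L2_norm_on_nonneg)
      have "\<bar>W x - W y\<bar> \<le> 2 * C1 * r + C2 * U * r + C1 * r * l"
        using est[of x y r] xy by (simp add: r_def U_def l_def B'_def)
      also have "\<dots> \<le> (2 * C1 + C2) * (1 + U) * r + (2 * C1 + C2) * r * l"
        using nn C1(1) C2(1) by (simp add: algebra_simps)
      finally have "\<bar>W x - W y\<bar> / m \<le> ((2 * C1 + C2) * (1 + U) * r + (2 * C1 + C2) * r * l) / m"
        using m by (intro divide_right_mono) auto
      also have "\<dots> = C * (1 + U) * r + C * r * l"
        by (simp only: C_def times_divide_eq_left) (simp only: add_divide_distrib)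
      also have "\<bar>W x - W y\<bar> / m = \<bar>W x / m - W y / m\<bar>"
        using m by (simp flip: diff_divide_distrib)
      finally show "\<bar>W x / m - W y / m\<bar> \<le> C * (1 + L2_norm_on (ball 0 1) u) * norm (x - y) + C * norm (x - y) * max 0 (ln (1 / norm (x - y)))"
        by (simp add: r_def U_def l_def)
    qed
  qed
  with C show thesis using that by blast
qed

text \<open>The order of quantifiers expresses universality: the constant is fixed before
  \<open>\<sigma>\<close> and \<open>u\<close>. The bound \<open>d < 1\<close> keeps the logarithm
  away from 0, so that it can absorb a Lipschitz term; the condition that \<open>\<phi>\<close> is
  not in \<open>H10\<close> yields the lower bound on the norm of \<open>u\<close>.\<close>

theorem proposition3p2:
  fixes M d :: real and \<phi> :: "real ^ 'n \<Rightarrow> real"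
  assumes "H1 (ball 0 1) \<phi>" and "\<not> H10 (ball 0 1) \<phi>" and "d < 1"
  shows "\<exists>C>0. \<forall>\<sigma> u.
    \<sigma> \<in> borel_measurable borel \<and> (\<forall>t. \<bar>\<sigma> t\<bar> \<le> M) \<and>
    local_minimizer \<sigma> u \<and> H10 (ball 0 1) (\<lambda>x. u x - \<phi> x) \<longrightarrow>
    (\<exists>w. (AE x in lebesgue_on (ball 0 1). w x = u x) \<and>
      (\<forall>x\<in>ball 0 (1/2). \<forall>y\<in>ball 0 (1/2). norm (x - y) \<le> d \<longrightarrow>
        \<bar>w x - w y\<bar> \<le>
          C * L2_norm_on (ball 0 1) u * norm (x - y) * ln (1 / norm (x - y))))"
proof -
  define B :: "(real ^ 'n) set" where "B = ball 0 1"
  have B: "open B" "bounded B" by (auto simp: B_def)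
  obtain G where \<phi>: "L2_on B \<phi>" "L2_on B G" "weak_gradient_on B \<phi> G"
    using assms(1) by (auto simp: H1_def B_def)
  \<comment> \<open>The gradient bound of \<open>local_minimizer_gradient_bound\<close>; the
    absolute value makes it defined before any \<open>\<sigma>\<close> shows that \<open>M\<close>
    is nonnegative.\<close>
  define K where "K = sqrt ((L2_norm_on B G)\<^sup>2 + 4 * \<bar>M\<bar> * measure lebesgue B)"
  have K: "0 \<le> K" by (simp add: K_def)
  obtain c where c: "0 < c" "\<And>u g. L2_on B u \<Longrightarrow> L2_on B g \<Longrightarrow> weak_gradient_on B u g \<Longrightarrow>
      L2_norm_on B g \<le> K \<Longrightarrow> H10 B (\<lambda>x. u x - \<phi> x) \<Longrightarrow> c \<le> L2_norm_on B u"
    by (rule L2_norm_lower_bound[OF B assms(1,2)[folded B_def] K]) blast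
  obtain C where C: "0 < C"
    "\<And>\<sigma> u. \<sigma> \<in> borel_measurable borel \<Longrightarrow> (\<And>s. \<bar>\<sigma> s\<bar> \<le> \<bar>M\<bar>) \<Longrightarrow> local_minimizer \<sigma> (u :: real ^ 'n \<Rightarrow> real) \<Longrightarrow>
      \<exists>w. (AE x in lebesgue_on (ball 0 (1/2)). w x = u x) \<and>
        (\<forall>x\<in>ball 0 (1/2). \<forall>y\<in>ball 0 (1/2). x \<noteq> y \<longrightarrow>
          \<bar>w x - w y\<bar> \<le> C * (1 + L2_norm_on (ball 0 1) u) * norm (x - y) + C * norm (x - y) * max 0 (ln (1 / norm (x - y))))"
    by (rule local_minimizer_log_lipschitz[OF abs_ge_zero[of M], where 'a="real ^ 'n"]) blast
  \<comment> \<open>A lower bound for the logarithm at distances up to \<open>d\<close>. For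
    \<open>d\<close> at most 0 only \<open>x = y\<close> occurs, and 1 is a placeholder.\<close>
  define l where "l = (if 0 < d then ln (1 / d) else 1)"
  have l: "0 < l" using assms(3) by (simp add: l_def)
  \<comment> \<open>From 1 <= U/c with \<open>U\<close> the norm of \<open>u\<close>, and r <= r
    ln(1/r)/l: the first summand absorbs the Lipschitz term, the second the logarithmic one.\<close>
  define C' where "C' = C * ((1 / c + 1) / l + 1 / c)"
  have C': "0 < C'" using C(1) c(1) l by (auto simp: C'_def intro!: mult_pos_pos divide_pos_pos add_pos_pos)
  show ?thesis
  proof (intro exI[of _ C'] conjI allI impI C')
    fix \<sigma> u
    assume H: "\<sigma> \<in> borel_measurable borel \<and> (\<forall>t. \<bar>\<sigma> t\<bar> \<le> M) \<and> local_minimizer \<sigma> u \<and> H10 (ball 0 1) (\<lambda>x. u x - \<phi> x)"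
    then have \<sigma>: "\<sigma> \<in> borel_measurable borel" "\<And>t. \<bar>\<sigma> t\<bar> \<le> \<bar>M\<bar>" and min: "local_minimizer \<sigma> u"
      and diff: "H10 B (\<lambda>x. u x - \<phi> x)"
      by (auto simp: B_def intro: order_trans)
    obtain g where u: "L2_on B u" and g: "L2_on B g" "weak_gradient_on B u g"
      using min by (auto simp: local_minimizer_def H1_def B_def)
    have "(L2_norm_on B g)\<^sup>2 \<le> (L2_norm_on B G)\<^sup>2 + 4 * \<bar>M\<bar> * measure lebesgue B"
      unfolding B_def by (rule local_minimizer_gradient_bound[OF min \<sigma>]) (use g \<phi> diff in \<open>auto simp: B_def\<close>)
    then have "L2_norm_on B g \<le> K" unfolding K_def by (rule real_le_rsqrt)
    then have cu: "c \<le> L2_norm_on B u" using c(2)[OF u g] diff by simp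
    define U where "U = L2_norm_on B u"
    obtain w where w: "AE x in lebesgue_on (ball 0 (1/2)). w x = u x"
      "\<And>x y. x \<in> ball 0 (1/2) \<Longrightarrow> y \<in> ball 0 (1/2) \<Longrightarrow> x \<noteq> y \<Longrightarrow>
          \<bar>w x - w y\<bar> \<le> C * (1 + U) * norm (x - y) + C * norm (x - y) * max 0 (ln (1 / norm (x - y)))"
      using C(2)[OF \<sigma> min] by (auto simp: U_def B_def)
    \<comment> \<open>The representative is constructed only on the half ball; keeping
      \<open>u\<close> elsewhere gives equality almost everywhere on the unit ball.\<close>
    define w' where "w' x = (if x \<in> ball 0 (1/2) then w x else u x)" for x
    show "\<exists>w. (AE x in lebesgue_on (ball 0 1). w x = u x) \<and>
      (\<forall>x\<in>ball 0 (1/2). \<forall>y\<in>ball 0 (1/2). norm (x - y) \<le> d \<longrightarrow>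
        \<bar>w x - w y\<bar> \<le> C' * L2_norm_on (ball 0 1) u * norm (x - y) * ln (1 / norm (x - y)))"
    proof (intro exI[of _ w'] conjI ballI impI)
      have "AE x in lebesgue. x \<in> ball 0 (1/2) \<longrightarrow> w x = u x"
        using w(1) by (subst (asm) AE_restrict_space_iff) auto
      then have "AE x in lebesgue. x \<in> ball 0 1 \<longrightarrow> w' x = u x"
        by eventually_elim (simp add: w'_def)
      then show "AE x in lebesgue_on (ball 0 1). w' x = u x"
        by (subst AE_restrict_space_iff) auto
      fix x y :: "real ^ 'n" assume xy: "x \<in> ball 0 (1/2)" "y \<in> ball 0 (1/2)" "norm (x - y) \<le> d"
      show "\<bar>w' x - w' y\<bar> \<le> C' * L2_norm_on (ball 0 1) u * norm (x - y) * ln (1 / norm (x - y))"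
      proof (cases "x = y")
        case False
        define r where "r = norm (x - y)"
        have r: "0 < r" "r \<le> d" using False xy(3) by (auto simp: r_def)
        then have "l = ln (1 / d)" by (simp add: l_def)
        also have "\<dots> \<le> ln (1 / r)" using r by (simp add: frac_le)
        finally have lr: "l \<le> ln (1 / r)" .
        have U: "c \<le> U" "0 < U" using cu c(1) by (auto simp: U_def)
        have 1: "1 \<le> U / c" using U c(1) by (simp add: field_simps)
        have 2: "r \<le> r * ln (1 / r) / l" using lr l r by (simp add: field_simps)
        have "\<bar>w' x - w' y\<bar> \<le> C * (1 + U) * r + C * r * ln (1 / r)"
          using w(2)[OF xy(1,2) False] xy lr l by (simp add: w'_def r_def max_def split: if_splits)
        also have "\<dots> \<le> C * (U / c + U) * (r * ln (1 / r) / l) + C * (U / c) * (r * ln (1 / r))"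
        proof (rule add_mono)
          show "C * (1 + U) * r \<le> C * (U / c + U) * (r * ln (1 / r) / l)"
            using 1 2 C(1) U c(1) r by (intro mult_mono) auto
          have "0 \<le> r * ln (1 / r)" using r lr l by (intro mult_nonneg_nonneg) linarith+
          then have "C * 1 * (r * ln (1 / r)) \<le> C * (U / c) * (r * ln (1 / r))"
            using 1 C(1) by (intro mult_right_mono mult_left_mono) auto
          then show "C * r * ln (1 / r) \<le> C * (U / c) * (r * ln (1 / r))" by simp
        qed
        also have "\<dots> = C' * U * r * ln (1 / r)"
          using l c(1) by (simp add: C'_def field_simps)
        finally show ?thesis by (simp add: U_def B_def r_def)
      qed simp
    qed
  qed
qed

end
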